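(* Let $n$ be a positive squarefree odd integer such that $n^2+1=2q$ for some prime $q$, and write $n=n_1n_2$, where $n_1$ is the product of the prime factors of $n$ congruent to $\pm1 \pmod 8$ and $n_2$ is the product of the prime factors of $n$ congruent to $\pm 3\pmod 8$. Let $r$ (resp. $s$) be the number of prime factors of $n_1$ congruent to $1$ (resp. $7$) modulo $8$, and let $t$ be the number of prime factors of $n_2$. Let $m$ be an even nonnegative integer and let $E_{m,n}: y^2=x(x-2^m n^2)(x+2^m)$. Then $$\operatorname{Sel}_2(E_{m,n}/\mathbb{Q})=\begin{cases}\langle (b,b),(1,2)\rangle\times E[2]^*, & n_2=1,\\ \langle (b,b)\rangle\times E[2]^*, & n_2>1,\end{cases}$$ where the products are internal direct products and the generators $(b,b)$ range over all positive divisors $b\mid n$ with $b\equiv\pm1\pmod 8$. Moreover, the 2-Selmer rank is $$s_2(E_{m,n})=\begin{cases}r+s+1, & n_2=1,\\ r+s+t-1, & n_2>1.\end{cases}$$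
   Context: Write $n=p_1\cdots p_k$ with distinct odd primes $p_i$. $\mathbb{Q}(S,2)=\langle -1,2,p_1,\dots,p_k,q\rangle$ denotes the subgroup of $\mathbb{Q}^\times/(\mathbb{Q}^\times)^2$ generated by these elements; its elements are represented by squarefree integers. The 2-Selmer group $\operatorname{Sel}_2(E_{m,n}/\mathbb{Q})$ is identified with the subgroup of pairs $(b_1,b_2)\in\mathbb{Q}(S,2)\times\mathbb{Q}(S,2)$ for which the system $b_1z_1^2-b_2z_2^2=2^mn^2$, $b_1z_1^2-b_1b_2z_3^2=-2^m$ (whence also $b_1b_2z_3^2-b_2z_2^2=2^{m+1}q$) has a solution $(z_1,z_2,z_3)\in\mathbb{Q}_l^3$ for every place $l$ of $\mathbb{Q}$ (with $\mathbb{Q}_\infty=\mathbb{R}$). The 2-Selmer rank is $s_2(E_{m,n})=\dim_{\mathbb{F}_2}\operatorname{Sel}_2(E_{m,n}/\mathbb{Q})-2$. The 2-descent map $\beta:E_{m,n}(\mathbb{Q})/2E_{m,n}(\mathbb{Q})\hookrightarrow\mathbb{Q}(S,2)\times\mathbb{Q}(S,2)$ is the standard injective homomorphism given by $(x,y)\mapsto(x,\,x-2^mn^2)$ when both entries are nonzero, $O\mapsto(1,1)$, $(0,0)\mapsto(-1,-2^m)$, $(2^mn^2,0)\mapsto(2^m,2q)$ (modulo squares). $E[2]^*$ denotes the image of the rational 2-torsion subgroup $E_{m,n}(\mathbb{Q})[2]$ under $\beta$. *)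

theory Defs
  imports
    "HOL-Algebra.QuotRing"
    "HOL-Algebra.Generated_Groups"
    "HOL-Number_Theory.Residues"
    "HOL-Computational_Algebra.Squarefree"
    "Jordan_Normal_Form.VS_Connect"
begin

section \<open>The completions of the rationals\<close>

definition padic_abs :: "nat \<Rightarrow> rat \<Rightarrow> real" where
  "padic_abs l x =
     (if x = 0 then 0
      else real l powi (int (multiplicity (int l) (snd (quotient_of x)))
                        - int (multiplicity (int l) (fst (quotient_of x)))))"

definition padic_cauchy :: "nat \<Rightarrow> (nat \<Rightarrow> rat) \<Rightarrow> bool" where
  "padic_cauchy l f \<longleftrightarrow>
     (\<forall>\<epsilon>>0. \<exists>N. \<forall>i\<ge>N. \<forall>j\<ge>N. padic_abs l (f i - f j) < \<epsilon>)"

definition padic_cauchy_ring :: "nat \<Rightarrow> (nat \<Rightarrow> rat) ring" where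
  "padic_cauchy_ring l =
     \<lparr>carrier = {f. padic_cauchy l f},
      monoid.mult = (\<lambda>f g i. f i * g i), one = (\<lambda>_. 1),
      zero = (\<lambda>_. 0), add = (\<lambda>f g i. f i + g i)\<rparr>"

definition padic_null :: "nat \<Rightarrow> (nat \<Rightarrow> rat) set" where
  "padic_null l = {f. (\<lambda>i. padic_abs l (f i)) \<longlonglongrightarrow> 0}"

text \<open>The field of $l$-adic numbers (for prime $l$), as the completion of the rationals:
  Cauchy sequences modulo null sequences. The latter are automatically Cauchy.\<close>

definition padic_field :: "nat \<Rightarrow> (nat \<Rightarrow> rat) set ring" where
  "padic_field l = padic_cauchy_ring l Quot padic_null l"


section \<open>Square classes of rational numbers\<close>

definition rat_units :: "rat monoid" where
  "rat_units = \<lparr>carrier = {x. x \<noteq> 0}, monoid.mult = (*), one = 1\<rparr>"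

definition rat_squares :: "rat set" where
  "rat_squares = {x\<^sup>2 | x. x \<noteq> 0}"

definition sq_group :: "rat set monoid" where
  "sq_group = rat_units Mod rat_squares"

definition sq_class :: "rat \<Rightarrow> rat set" where
  "sq_class x = rat_squares #>\<^bsub>rat_units\<^esub> x"

definition sq_pairs :: "(rat set \<times> rat set) monoid" where
  "sq_pairs = sq_group \<times>\<times> sq_group"

definition sq_pair :: "rat \<Rightarrow> rat \<Rightarrow> rat set \<times> rat set" where
  "sq_pair x y = (sq_class x, sq_class y)"

definition QS2 :: "nat \<Rightarrow> nat \<Rightarrow> rat set set" where
  "QS2 n q = generate sq_group
     (sq_class ` ({-1, 2, of_nat q} \<union> {of_nat p | p. p \<in> prime_factors n}))"


section \<open>The 2-Selmer group\<close>

text \<open>Here \<open>[k] \<cdot>\<^bsub>R\<^esub> x\<close> is the integer multiple $kx$ in the ring \<open>R\<close>.\<close>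

definition descent_soluble ::
  "('a, 'b) ring_scheme \<Rightarrow> nat \<Rightarrow> nat \<Rightarrow> int \<Rightarrow> int \<Rightarrow> bool" where
  "descent_soluble R m n b1 b2 \<longleftrightarrow>
     (\<exists>z1\<in>carrier R. \<exists>z2\<in>carrier R. \<exists>z3\<in>carrier R.
        ([b1] \<cdot>\<^bsub>R\<^esub> (z1 [^]\<^bsub>R\<^esub> (2::nat))) \<ominus>\<^bsub>R\<^esub> ([b2] \<cdot>\<^bsub>R\<^esub> (z2 [^]\<^bsub>R\<^esub> (2::nat)))
          = [(2 ^ m * (int n)\<^sup>2)] \<cdot>\<^bsub>R\<^esub> \<one>\<^bsub>R\<^esub> \<and>
        ([b1] \<cdot>\<^bsub>R\<^esub> (z1 [^]\<^bsub>R\<^esub> (2::nat))) \<ominus>\<^bsub>R\<^esub> ([(b1 * b2)] \<cdot>\<^bsub>R\<^esub> (z3 [^]\<^bsub>R\<^esub> (2::nat)))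
          = [(- (2 ^ m) :: int)] \<cdot>\<^bsub>R\<^esub> \<one>\<^bsub>R\<^esub>)"

definition everywhere_soluble :: "nat \<Rightarrow> nat \<Rightarrow> int \<Rightarrow> int \<Rightarrow> bool" where
  "everywhere_soluble m n b1 b2 \<longleftrightarrow>
     descent_soluble (class_ring :: real ring) m n b1 b2 \<and>
     (\<forall>l. prime l \<longrightarrow> descent_soluble (padic_field l) m n b1 b2)"

text \<open>Every square class contains exactly one squarefree integer; solubility does not depend
  on the representative, since square factors of the coefficients can be absorbed in the
  unknowns.\<close>

definition Sel2 :: "nat \<Rightarrow> nat \<Rightarrow> nat \<Rightarrow> (rat set \<times> rat set) set" where
  "Sel2 m n q =
     {(B1, B2) \<in> QS2 n q \<times> QS2 n q.
        \<exists>b1 b2 :: int. squarefree b1 \<and> squarefree b2 \<and>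
          B1 = sq_class (of_int b1) \<and> B2 = sq_class (of_int b2) \<and>
          everywhere_soluble m n b1 b2}"

text \<open>A group of exponent 2, with carrier \<open>H\<close> inside \<open>G\<close>, as a vector space over the field of
  two elements: vector addition is the group operation and scalars act as exponents. The
  ring multiplication of the record is irrelevant for a module and has no meaning here.\<close>

definition F2_space :: "('a, 'b) monoid_scheme \<Rightarrow> 'a set \<Rightarrow> (int, 'a) module" where
  "F2_space G H =
     \<lparr>carrier = H, monoid.mult = monoid.mult G, one = \<one>\<^bsub>G\<^esub>,
      zero = \<one>\<^bsub>G\<^esub>, add = monoid.mult G, smult = (\<lambda>a x. x [^]\<^bsub>G\<^esub> a)\<rparr>"

definition selmer_rank :: "nat \<Rightarrow> nat \<Rightarrow> nat \<Rightarrow> int" where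
  "selmer_rank m n q =
     int (vectorspace.dim (residue_ring 2) (F2_space sq_pairs (Sel2 m n q))) - 2"


section \<open>Rational points and the image of the 2-torsion\<close>

datatype point = Infinity | Affine rat rat

text \<open>Chord and tangent addition on $y^2 = x^3 + a x^2 + b x + c$; the formulas do not involve
  the constant term.\<close>

definition weierstrass_add :: "rat \<Rightarrow> rat \<Rightarrow> point \<Rightarrow> point \<Rightarrow> point" where
  "weierstrass_add a b P Q =
     (case P of
        Infinity \<Rightarrow> Q
      | Affine x1 y1 \<Rightarrow>
         (case Q of
            Infinity \<Rightarrow> P
          | Affine x2 y2 \<Rightarrow>
              if x1 = x2 \<and> y1 = - y2 then Infinity
              else
                let k = (if x1 = x2 then (3 * x1\<^sup>2 + 2 * a * x1 + b) / (2 * y1)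
                         else (y2 - y1) / (x2 - x1));
                    x3 = k\<^sup>2 - a - x1 - x2
                in Affine x3 (k * (x1 - x3) - y1)))"

text \<open>The curve $E_{m,n}$: $y^2 = x (x - 2^m n^2) (x + 2^m)
  = x^3 + (2^m - 2^m n^2) x^2 - 2^m n^2 2^m x$.\<close>

definition E_points :: "nat \<Rightarrow> nat \<Rightarrow> point set" where
  "E_points m n =
     insert Infinity
       {Affine x y | x y. y\<^sup>2 = x * (x - 2 ^ m * (of_nat n)\<^sup>2) * (x + 2 ^ m)}"

definition E_add :: "nat \<Rightarrow> nat \<Rightarrow> point \<Rightarrow> point \<Rightarrow> point" where
  "E_add m n = weierstrass_add (2 ^ m - 2 ^ m * (of_nat n)\<^sup>2) (- (2 ^ m * (of_nat n)\<^sup>2 * 2 ^ m))"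

definition E_2torsion :: "nat \<Rightarrow> nat \<Rightarrow> point set" where
  "E_2torsion m n = {P \<in> E_points m n. E_add m n P P = Infinity}"

text \<open>The 2-descent map, as a map on $E_{m,n}(\mathbb{Q})$ (that is, composed with the projection
  from $E_{m,n}(\mathbb{Q})$ to $E_{m,n}(\mathbb{Q})/2E_{m,n}(\mathbb{Q})$).\<close>

definition descent_map :: "nat \<Rightarrow> nat \<Rightarrow> nat \<Rightarrow> point \<Rightarrow> rat set \<times> rat set" where
  "descent_map m n q P =
     (case P of
        Infinity \<Rightarrow> sq_pair 1 1
      | Affine x y \<Rightarrow>
          if x = 0 then sq_pair (- 1) (- (2 ^ m))
          else if x = 2 ^ m * (of_nat n)\<^sup>2 then sq_pair (2 ^ m) (2 * of_nat q)
          else sq_pair x (x - 2 ^ m * (of_nat n)\<^sup>2))"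

definition E2_star :: "nat \<Rightarrow> nat \<Rightarrow> nat \<Rightarrow> (rat set \<times> rat set) set" where
  "E2_star m n q = descent_map m n q ` E_2torsion m n"


section \<open>Internal direct products and the diagonal generators\<close>

definition internal_direct_product ::
  "('a, 'b) monoid_scheme \<Rightarrow> 'a set \<Rightarrow> 'a set \<Rightarrow> 'a set \<Rightarrow> bool" where
  "internal_direct_product G H A B \<longleftrightarrow>
     subgroup H G \<and>
     A \<lhd> (G\<lparr>carrier := H\<rparr>) \<and> B \<lhd> (G\<lparr>carrier := H\<rparr>) \<and>
     A \<inter> B = {\<one>\<^bsub>G\<^esub>} \<and> A <#>\<^bsub>G\<^esub> B = H"

definition diagonal_gens :: "nat \<Rightarrow> (rat set \<times> rat set) set" where
  "diagonal_gens n =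
     {sq_pair (of_nat b) (of_nat b) | b. b dvd n \<and> (b mod 8 = 1 \<or> b mod 8 = 7)}"

end

theory Submission
  imports Defs "HOL-Number_Theory.Quadratic_Reciprocity"
begin

text \<open>
  Since \<open>m\<close> is even, \<open>2 ^ m\<close> is a square and can be absorbed into the unknowns. The pair
  \<open>(b1, b2)\<close> is then soluble in a completion of the rationals iff there is an \<open>x\<close> in it such that
  \<open>b1 * x\<close>, \<open>b2 * (x - n\<^sup>2)\<close> and \<open>b1 * b2 * (x + 1)\<close> are squares. The Selmer group consists of
  the classes of the pairs \<open>(e * b, e * b * c)\<close>, where \<open>e\<close> is a sign, \<open>b\<close> is a divisor of \<open>n\<close>
  that is 1 or 7 modulo 8, and \<open>c\<close> is 1 or \<open>2 * q\<close>; the values 2 and \<open>q\<close> of \<open>c\<close> are also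
  possible when all prime factors of \<open>n\<close> are 1 or 7 modulo 8.

  \<^bold>\<open>Every Selmer pair has this shape\<close> (\<open>everywhere_soluble_imp_shape\<close>). An l-adic
  solution is approximated by a rational one and made homogeneous, which gives a primitive integral
  solution of two congruences modulo \<open>l ^ 3\<close> (\<open>descent_soluble_padic_imp_primitive\<close>).
  Comparing divisibility by \<open>l\<close> shows that \<open>b1\<close> is prime to \<open>2 * q\<close> and that \<open>b1\<close> and \<open>b2\<close> have the
  same prime factors in \<open>n\<close>, so \<open>b1\<close> is \<open>e * b\<close> and \<open>b2\<close> is \<open>b1\<close> times \<open>c\<close>; the two signs agree
  because of the real place. At \<open>q\<close>, \<open>b1\<close> must be a quadratic residue. For a prime
  factor \<open>p\<close> of \<open>n\<close>, \<open>2 * q\<close> is 1 modulo \<open>p\<close>, and \<open>q\<close> is 1 modulo 4, so reciprocity says that \<open>p\<close>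
  is a residue modulo \<open>q\<close> iff 2 is one modulo \<open>p\<close>; hence \<open>b\<close> is 1 or 7 modulo 8. At \<open>p\<close>, \<open>c\<close> must be a
  residue, which excludes 2 and \<open>q\<close> as soon as some \<open>p\<close> is 3 or 5 modulo 8.

  \<^bold>\<open>Every pair of this shape is soluble\<close> (\<open>shape_imp_everywhere_soluble\<close>). At 2 and \<open>q\<close> the
  pair is locally trivial or in the class of a 2-torsion point. At a prime factor of \<open>n\<close> there is
  an explicit rational \<open>x\<close> for which \<open>b1 * x\<close> and \<open>b1 * (x - n\<^sup>2)\<close> are squares of rational numbers and
  \<open>x + 1\<close> is a local square, and so is \<open>c\<close>. At a prime \<open>l\<close> of good reduction, the number of solutions modulo \<open>l\<close>
  is a character sum in which the only term that is hard to evaluate does not depend on the class of the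
  pair. For the trivial class the number is not negative, and for the others it is larger
  by 4, hence positive (\<open>exists_residue_with_characters\<close>). Such a solution lifts by Hensel's lemma.

  Distinct squarefree integers have distinct square classes, so the shapes
  can be counted and the direct product decomposition can be read off from the representatives
  (\<open>Sel2_eq_set_mult\<close>, \<open>twist_inject\<close>). The divisors of \<open>n\<close> that are 1 or 7 modulo 8
  are all of them, or exactly half of them if some prime factor is 3 or 5 modulo 8
  (\<open>card_divisors_pm1_mod_8\<close>), and a space with \<open>2 ^ d\<close> elements over the field with two elements has
  dimension \<open>d\<close> (\<open>F2_space_dim\<close>).
\<close>

section \<open>The l-adic absolute value\<close>

lemma padic_abs_0 [simp]: "padic_abs l 0 = 0"
  by (simp add: padic_abs_def)

text \<open>A common factor of numerator and denominator cancels in the difference of the valuations, so any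
  fraction may be used. Multiplicativity and the ultrametric inequality thereby reduce to
  statements about multiplicities in integers.\<close>

lemma padic_abs_fraction:
  assumes l: "prime l" and a: "a \<noteq> 0" and b: "b \<noteq> 0"
  shows "padic_abs l (of_int a / of_int b)
           = real l powi (int (multiplicity (int l) b) - int (multiplicity (int l) a))"
proof -
  obtain c d where cd: "quotient_of (of_int a / of_int b) = (c, d)"
    by (cases "quotient_of (of_int a / of_int b)")
  have d: "d > 0" using cd quotient_of_denom_pos by blast
  have "(of_int a / of_int b :: rat) = of_int c / of_int d"
    using cd quotient_of_div by blast
  then have "(of_int a * of_int d :: rat) = of_int c * of_int b"
    using b d by (simp add: field_simps)
  then have eq: "a * d = c * b"
    by (metis of_int_eq_iff of_int_mult)
  then have c: "c \<noteq> 0" using a d by auto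
  have pr: "prime_elem (int l)" using l by simp
  have "multiplicity (int l) a + multiplicity (int l) d
      = multiplicity (int l) c + multiplicity (int l) b"
    using prime_elem_multiplicity_mult_distrib[OF pr] a b c d eq
    by (metis less_irrefl)
  then have "int (multiplicity (int l) d) - int (multiplicity (int l) c)
      = int (multiplicity (int l) b) - int (multiplicity (int l) a)" by simp
  moreover have "(of_int a / of_int b :: rat) \<noteq> 0" using a b by simp
  ultimately show ?thesis
    by (simp add: padic_abs_def cd)
qed

lemma padic_abs_nonneg: "0 \<le> padic_abs l x"
  by (simp add: padic_abs_def)

lemma padic_abs_minus: "padic_abs l (- x) = padic_abs l x"
proof -
  obtain a b where ab: "quotient_of x = (a, b)" by (cases "quotient_of x")
  have "quotient_of (- x) = (- a, b)"
    using ab by (simp add: rat_uminus_code)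
  then show ?thesis using ab by (simp add: padic_abs_def)
qed

lemma padic_abs_diff_commute: "padic_abs l (x - y) = padic_abs l (y - x)"
  using padic_abs_minus[of l "x - y"] by simp

lemma padic_abs_mult:
  assumes l: "prime l"
  shows "padic_abs l (x * y) = padic_abs l x * padic_abs l y"
proof (cases "x = 0 \<or> y = 0")
  case False
  obtain a b where x: "x = of_int a / of_int b" "b > 0"
    by (metis quotient_of_denom_pos quotient_of_div surj_pair)
  obtain c d where y: "y = of_int c / of_int d" "d > 0"
    by (metis quotient_of_denom_pos quotient_of_div surj_pair)
  have nz: "a \<noteq> 0" "c \<noteq> 0" "b \<noteq> 0" "d \<noteq> 0" using False x y by auto
  have l0: "real l \<noteq> 0" using l prime_gt_0_nat by fastforce
  have pr: "prime_elem (int l)" using l by simp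
  have xy: "x * y = of_int (a * c) / of_int (b * d)" by (simp add: x y)
  have "padic_abs l (x * y) = real l powi (int (multiplicity (int l) (b * d)) - int (multiplicity (int l) (a * c)))"
    unfolding xy by (rule padic_abs_fraction[OF l]) (use nz in auto)
  also have "\<dots> = real l powi ((int (multiplicity (int l) b) - int (multiplicity (int l) a))
        + (int (multiplicity (int l) d) - int (multiplicity (int l) c)))"
    using nz by (simp add: prime_elem_multiplicity_mult_distrib[OF pr] algebra_simps)
  also have "\<dots> = padic_abs l x * padic_abs l y"
    using l0 nz by (simp add: power_int_add x y padic_abs_fraction[OF l])
  finally show ?thesis .
qed auto

lemma padic_abs_ultrametric:
  assumes l: "prime l"
  shows "padic_abs l (x + y) \<le> max (padic_abs l x) (padic_abs l y)"
proof (cases "x = 0 \<or> y = 0 \<or> x + y = 0")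
  case True
  then show ?thesis using padic_abs_nonneg[of l] by (auto simp: le_max_iff_disj)
next
  case False
  obtain a b where x: "x = of_int a / of_int b" "b > 0"
    by (metis quotient_of_denom_pos quotient_of_div surj_pair)
  obtain c d where y: "y = of_int c / of_int d" "d > 0"
    by (metis quotient_of_denom_pos quotient_of_div surj_pair)
  let ?v = "multiplicity (int l)"
  have nz: "a \<noteq> 0" "c \<noteq> 0" "b \<noteq> 0" "d \<noteq> 0" using False x y by auto
  have x': "x = of_int (a * d) / of_int (b * d)" and y': "y = of_int (c * b) / of_int (b * d)"
    using nz by (simp_all add: x y)
  have s': "x + y = of_int (a * d + c * b) / of_int (b * d)"
    unfolding x' y' by (simp add: add_divide_distrib)
  have s0: "a * d + c * b \<noteq> 0" using False s' by (metis div_0 of_int_0)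
  have l1: "1 \<le> real l" using l prime_ge_1_nat by fastforce
  have ab: "padic_abs l x = real l powi (int (?v (b * d)) - int (?v (a * d)))"
    unfolding x' by (rule padic_abs_fraction[OF l]) (use nz in auto)
  have cd: "padic_abs l y = real l powi (int (?v (b * d)) - int (?v (c * b)))"
    unfolding y' by (rule padic_abs_fraction[OF l]) (use nz in auto)
  have s: "padic_abs l (x + y) = real l powi (int (?v (b * d)) - int (?v (a * d + c * b)))"
    unfolding s' by (rule padic_abs_fraction[OF l s0]) (use nz in auto)
  define k where "k = min (?v (a * d)) (?v (c * b))"
  have "int l ^ k dvd a * d" "int l ^ k dvd c * b"
    unfolding k_def by (auto simp: multiplicity_dvd' )
  then have "int l ^ k dvd a * d + c * b" by simp
  then have "k \<le> ?v (a * d + c * b)"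
    by (rule multiplicity_geI[rotated 2]) (use s0 l in auto)
  then have "?v (a * d) \<le> ?v (a * d + c * b) \<or> ?v (c * b) \<le> ?v (a * d + c * b)"
    unfolding k_def by linarith
  then show ?thesis
    unfolding ab cd s using l1 by (auto simp: le_max_iff_disj intro!: power_int_increasing)
qed

lemma padic_abs_triangle:
  assumes l: "prime l"
  shows "padic_abs l (x + y) \<le> padic_abs l x + padic_abs l y"
  using padic_abs_ultrametric[OF l, of x y] padic_abs_nonneg[of l x] padic_abs_nonneg[of l y] by linarith

text \<open>This lemma and the next translate between small absolute values and divisibility by powers of
  \<open>l\<close>, that is, between the analytic definition of the completion and congruences.\<close>

lemma padic_abs_int_le:
  assumes l: "prime l" and "int l ^ k dvd a"
  shows "padic_abs l (of_int a) \<le> 1 / real l ^ k"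
proof (cases "a = 0")
  case False
  have l1: "1 \<le> real l" using l prime_ge_1_nat by fastforce
  have "k \<le> multiplicity (int l) a"
    by (rule multiplicity_geI) (use False l assms in auto)
  then have "real l powi (- int (multiplicity (int l) a)) \<le> real l powi (- int k)"
    using l1 by (intro power_int_increasing) auto
  then show ?thesis
    using padic_abs_fraction[OF l False, of 1] by (simp add: power_int_minus divide_inverse)
qed (use l in simp)

lemma padic_abs_le_imp_fraction:
  assumes l: "prime l" and le: "padic_abs l x \<le> 1 / real l ^ k"
  shows "\<exists>a s. \<not> int l dvd s \<and> x * of_int s = of_int (int l ^ k * a)"
proof (cases "x = 0")
  case True
  then show ?thesis using l by (intro exI[of _ 0] exI[of _ 1]) (auto simp: prime_nat_iff)
next
  case False
  obtain c d where cd: "quotient_of x = (c, d)" by (cases "quotient_of x")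
  have d: "d > 0" using cd quotient_of_denom_pos by blast
  have x: "x = of_int c / of_int d" using cd quotient_of_div by blast
  have c: "c \<noteq> 0" using False x by auto
  have l1: "1 < real l" using l prime_gt_1_nat by fastforce
  have cop: "coprime c d" using cd quotient_of_coprime by blast
  let ?v = "multiplicity (int l)"
  have "padic_abs l x = real l powi (int (?v d) - int (?v c))"
    unfolding x using padic_abs_fraction[OF l c] d by auto
  then have "real l powi (int (?v d) - int (?v c)) \<le> real l powi (- int k)"
    using le by (simp add: power_int_minus divide_inverse)
  then have le': "?v d + k \<le> ?v c"
    using power_int_strict_increasing[of "- int k" "int (?v d) - int (?v c)" "real l"] l1
    by (cases "?v d + k \<le> ?v c") auto
  have c': "int l ^ ?v c dvd c" by (rule multiplicity_dvd)
  show ?thesis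
  proof (cases "int l dvd d")
    case False
    obtain a where "c = int l ^ k * a"
      using c' le' by (meson dvdE dvd_trans le_imp_power_dvd le_add2 le_trans)
    then show ?thesis using False d by (intro exI[of _ a] exI[of _ d]) (simp add: x)
  next
    case True
    then have "?v d > 0" using d l by (simp add: prime_multiplicity_gt_zero_iff)
    then have "int l dvd c" using c' le' by (metis add_is_0 dvd_power_same dvd_trans dvd_refl le_zero_eq not_gr_zero dvd_power)
    then show ?thesis using True cop l
      by (metis coprime_common_divisor not_prime_unit prime_int_nat_transfer prime_nat_int_transfer)
  qed
qed

section \<open>Cauchy sequences and equations over the l-adic numbers\<close>

lemma padic_nullD:
  assumes "f \<in> padic_null l" "\<epsilon> > 0"
  shows "\<exists>N. \<forall>i\<ge>N. padic_abs l (f i) < \<epsilon>"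
  using assms padic_abs_nonneg[of l] unfolding padic_null_def LIMSEQ_iff by simp

lemma padic_nullI:
  assumes "\<And>\<epsilon>. \<epsilon> > 0 \<Longrightarrow> \<exists>N. \<forall>i\<ge>N. padic_abs l (f i) < \<epsilon>"
  shows "f \<in> padic_null l"
  using assms padic_abs_nonneg[of l] unfolding padic_null_def LIMSEQ_iff by simp

lemma padic_null_zero: "(\<lambda>i. 0) \<in> padic_null l"
  by (rule padic_nullI) simp

lemma padic_null_minus: "f \<in> padic_null l \<Longrightarrow> (\<lambda>i. - f i) \<in> padic_null l"
  by (simp add: padic_null_def padic_abs_minus)

text \<open>The closure properties of null sequences are all instances of one comparison, with \<open>B\<close> and \<open>C\<close>
  bounds for the other factors involved.\<close>

lemma padic_null_le_sum:
  assumes f: "f \<in> padic_null l" and g: "g \<in> padic_null l"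
    and le: "\<And>i. padic_abs l (h i) \<le> B * padic_abs l (f i) + C * padic_abs l (g i)"
  shows "h \<in> padic_null l"
proof -
  have "(\<lambda>i. B * padic_abs l (f i) + C * padic_abs l (g i)) \<longlonglongrightarrow> B * 0 + C * 0"
    using f g unfolding padic_null_def by (intro tendsto_intros) auto
  then have "(\<lambda>i. padic_abs l (h i)) \<longlonglongrightarrow> 0"
    by (intro real_tendsto_sandwich[of "\<lambda>_. 0" "\<lambda>i. padic_abs l (h i)" sequentially
          "\<lambda>i. B * padic_abs l (f i) + C * padic_abs l (g i)" 0])
       (use le in \<open>auto simp: padic_abs_nonneg\<close>)
  then show ?thesis by (simp add: padic_null_def)
qed

lemma padic_null_add:
  assumes "prime l" "f \<in> padic_null l" "g \<in> padic_null l"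
  shows "(\<lambda>i. f i + g i) \<in> padic_null l"
  by (rule padic_null_le_sum[OF assms(2,3), where B = 1 and C = 1])
     (simp add: padic_abs_triangle[OF assms(1)])

lemma padic_null_diff:
  assumes "prime l" "f \<in> padic_null l" "g \<in> padic_null l"
  shows "(\<lambda>i. f i - g i) \<in> padic_null l"
  using padic_null_add[OF assms(1,2) padic_null_minus[OF assms(3)]] by simp

lemma padic_null_bounded_mult:
  assumes l: "prime l" and f: "f \<in> padic_null l" and B: "\<And>i. padic_abs l (g i) \<le> B"
  shows "(\<lambda>i. g i * f i) \<in> padic_null l"
  by (rule padic_null_le_sum[OF f f, where B = B and C = 0])
     (simp add: padic_abs_mult[OF l] mult_right_mono B padic_abs_nonneg)

lemma padic_null_const_mult:
  assumes "prime l" "f \<in> padic_null l"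
  shows "(\<lambda>i. c * f i) \<in> padic_null l"
  by (rule padic_null_bounded_mult[OF assms order_refl])

lemma padic_cauchyD:
  assumes "padic_cauchy l f" "\<epsilon> > 0"
  shows "\<exists>N. \<forall>i\<ge>N. \<forall>j\<ge>N. padic_abs l (f i - f j) < \<epsilon>"
  using assms by (simp add: padic_cauchy_def)

lemma padic_cauchy_const: "padic_cauchy l (\<lambda>_. c)"
  by (simp add: padic_cauchy_def)

lemma padic_cauchy_minus: "padic_cauchy l f \<Longrightarrow> padic_cauchy l (\<lambda>i. - f i)"
  using padic_abs_diff_commute[of l] by (simp add: padic_cauchy_def)

lemma padic_cauchy_bounded:
  assumes l: "prime l" and f: "padic_cauchy l f"
  obtains B where "B > 0" "\<And>i. padic_abs l (f i) \<le> B"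
proof -
  obtain N where N: "\<And>i j. i \<ge> N \<Longrightarrow> j \<ge> N \<Longrightarrow> padic_abs l (f i - f j) < 1"
    using padic_cauchyD[OF f, of 1] by auto
  define M where "M = Max ((\<lambda>i. padic_abs l (f i)) ` {..N})"
  have M: "padic_abs l (f i) \<le> M" if "i \<le> N" for i
    unfolding M_def using that by (intro Max_ge) auto
  have M0: "M \<ge> 0" using M[of N] padic_abs_nonneg[of l "f N"] by simp
  show ?thesis
  proof (rule that[of "M + 1"])
    show "M + 1 > 0" using M0 by simp
    show "padic_abs l (f i) \<le> M + 1" for i
    proof (cases "i \<le> N")
      case True
      then show ?thesis using M[of i] by simp
    next
      case False
      then have "padic_abs l (f i - f N) < 1" using N[of i N] by simp
      then show ?thesis
        using padic_abs_triangle[OF l, of "f i - f N" "f N"] M[of N] by simp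
    qed
  qed
qed

lemma padic_cauchy_add:
  assumes l: "prime l" and f: "padic_cauchy l f" and g: "padic_cauchy l g"
  shows "padic_cauchy l (\<lambda>i. f i + g i)"
  unfolding padic_cauchy_def
proof (intro allI impI)
  fix \<epsilon> :: real assume "\<epsilon> > 0"
  then obtain N M where
    N: "\<And>i j. i \<ge> N \<Longrightarrow> j \<ge> N \<Longrightarrow> padic_abs l (f i - f j) < \<epsilon> / 2" and
    M: "\<And>i j. i \<ge> M \<Longrightarrow> j \<ge> M \<Longrightarrow> padic_abs l (g i - g j) < \<epsilon> / 2"
    using padic_cauchyD[OF f, of "\<epsilon> / 2"] padic_cauchyD[OF g, of "\<epsilon> / 2"]
    by (metis half_gt_zero)
  have "padic_abs l (f i + g i - (f j + g j)) < \<epsilon>" if "i \<ge> max N M" "j \<ge> max N M" for i j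
  proof -
    have e: "f i + g i - (f j + g j) = (f i - f j) + (g i - g j)" by simp
    have "padic_abs l (f i - f j) < \<epsilon> / 2" "padic_abs l (g i - g j) < \<epsilon> / 2"
      using N[of i j] M[of i j] that by auto
    then show ?thesis
      unfolding e using padic_abs_triangle[OF l, of "f i - f j" "g i - g j"] by linarith
  qed
  then show "\<exists>N. \<forall>i\<ge>N. \<forall>j\<ge>N. padic_abs l (f i + g i - (f j + g j)) < \<epsilon>" by blast
qed

lemma padic_cauchy_mult:
  assumes l: "prime l" and f: "padic_cauchy l f" and g: "padic_cauchy l g"
  shows "padic_cauchy l (\<lambda>i. f i * g i)"
  unfolding padic_cauchy_def
proof (intro allI impI)
  fix \<epsilon> :: real assume e: "\<epsilon> > 0"
  obtain B C where B: "B > 0" "\<And>i. padic_abs l (f i) \<le> B" and C: "C > 0" "\<And>i. padic_abs l (g i) \<le> C"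
    using padic_cauchy_bounded[OF l f] padic_cauchy_bounded[OF l g] by metis
  obtain N M where
    N: "\<And>i j. i \<ge> N \<Longrightarrow> j \<ge> N \<Longrightarrow> padic_abs l (f i - f j) < \<epsilon> / (2 * C)" and
    M: "\<And>i j. i \<ge> M \<Longrightarrow> j \<ge> M \<Longrightarrow> padic_abs l (g i - g j) < \<epsilon> / (2 * B)"
    using padic_cauchyD[OF f, of "\<epsilon> / (2 * C)"] padic_cauchyD[OF g, of "\<epsilon> / (2 * B)"] e B(1) C(1)
    by (metis divide_pos_pos mult_pos_pos zero_less_numeral)
  have "padic_abs l (f i * g i - f j * g j) < \<epsilon>" if "i \<ge> max N M" "j \<ge> max N M" for i j
  proof -
    have "f i * g i - f j * g j = (f i - f j) * g i + f j * (g i - g j)" by (simp add: algebra_simps)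
    then have "padic_abs l (f i * g i - f j * g j)
        \<le> padic_abs l (f i - f j) * padic_abs l (g i) + padic_abs l (f j) * padic_abs l (g i - g j)"
      using padic_abs_triangle[OF l] by (metis padic_abs_mult[OF l])
    also have "\<dots> \<le> padic_abs l (f i - f j) * C + B * padic_abs l (g i - g j)"
      by (intro add_mono mult_mono) (use B C in \<open>auto simp: padic_abs_nonneg less_imp_le\<close>)
    also have "\<dots> < \<epsilon> / (2 * C) * C + B * (\<epsilon> / (2 * B))"
      by (intro add_strict_mono mult_strict_right_mono mult_strict_left_mono)
         (use N[of i j] M[of i j] that B C in auto)
    also have "\<dots> = \<epsilon>" using B C by simp
    finally show ?thesis .
  qed
  then show "\<exists>N. \<forall>i\<ge>N. \<forall>j\<ge>N. padic_abs l (f i * g i - f j * g j) < \<epsilon>" by blast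
qed

lemma padic_null_imp_cauchy:
  assumes l: "prime l" and f: "f \<in> padic_null l"
  shows "padic_cauchy l f"
  unfolding padic_cauchy_def
proof (intro allI impI)
  fix \<epsilon> :: real assume "\<epsilon> > 0"
  then obtain N where N: "\<And>i. i \<ge> N \<Longrightarrow> padic_abs l (f i) < \<epsilon>"
    using padic_nullD[OF f] by blast
  have "padic_abs l (f i - f j) < \<epsilon>" if "i \<ge> N" "j \<ge> N" for i j
    using padic_abs_ultrametric[OF l, of "f i" "- f j"] N[OF that(1)] N[OF that(2)]
    by (simp add: padic_abs_minus)
  then show "\<exists>N. \<forall>i\<ge>N. \<forall>j\<ge>N. padic_abs l (f i - f j) < \<epsilon>" by blast
qed

lemma padic_cauchy_ring_simps:
  "carrier (padic_cauchy_ring l) = {f. padic_cauchy l f}"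
  "f \<otimes>\<^bsub>padic_cauchy_ring l\<^esub> g = (\<lambda>i. f i * g i)"
  "\<one>\<^bsub>padic_cauchy_ring l\<^esub> = (\<lambda>_. 1)"
  "\<zero>\<^bsub>padic_cauchy_ring l\<^esub> = (\<lambda>_. 0)"
  "f \<oplus>\<^bsub>padic_cauchy_ring l\<^esub> g = (\<lambda>i. f i + g i)"
  by (simp_all add: padic_cauchy_ring_def)

lemma padic_cauchy_ring_cring:
  assumes l: "prime l"
  shows "cring (padic_cauchy_ring l)"
proof (rule cringI)
  show "abelian_group (padic_cauchy_ring l)"
  proof (rule abelian_groupI)
    show "\<exists>y\<in>carrier (padic_cauchy_ring l). y \<oplus>\<^bsub>padic_cauchy_ring l\<^esub> x = \<zero>\<^bsub>padic_cauchy_ring l\<^esub>"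
      if "x \<in> carrier (padic_cauchy_ring l)" for x
      using that by (intro bexI[of _ "\<lambda>i. - x i"]) (auto simp: padic_cauchy_ring_simps padic_cauchy_minus)
  qed (auto simp: padic_cauchy_ring_simps padic_cauchy_add[OF l] padic_cauchy_const algebra_simps)
  show "comm_monoid (padic_cauchy_ring l)"
    by (rule comm_monoidI)
       (auto simp: padic_cauchy_ring_simps padic_cauchy_mult[OF l] padic_cauchy_const algebra_simps)
qed (auto simp: padic_cauchy_ring_simps algebra_simps)

lemma padic_cauchy_ring_uminus:
  assumes l: "prime l" and f: "padic_cauchy l f"
  shows "\<ominus>\<^bsub>padic_cauchy_ring l\<^esub> f = (\<lambda>i. - f i)"
proof -
  interpret cring "padic_cauchy_ring l" by (rule padic_cauchy_ring_cring[OF l])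
  show ?thesis
    by (rule minus_equality) (use f in \<open>auto simp: padic_cauchy_ring_simps padic_cauchy_minus\<close>)
qed

lemma padic_cauchy_ring_add_pow:
  assumes l: "prime l" and f: "padic_cauchy l f"
  shows "[(k::int)] \<cdot>\<^bsub>padic_cauchy_ring l\<^esub> f = (\<lambda>i. of_int k * f i)"
proof -
  interpret cring "padic_cauchy_ring l" by (rule padic_cauchy_ring_cring[OF l])
  have nat: "[(j::nat)] \<cdot>\<^bsub>padic_cauchy_ring l\<^esub> f = (\<lambda>i. of_nat j * f i)" for j
    by (induction j) (auto simp: add.nat_pow_Suc padic_cauchy_ring_simps algebra_simps)
  have c: "padic_cauchy l (\<lambda>i. of_nat j * f i)" for j
    by (intro padic_cauchy_mult[OF l] padic_cauchy_const f)
  show ?thesis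
  proof (cases "k \<ge> 0")
    case True
    then show ?thesis by (simp add: add_pow_int_ge nat)
  next
    case False
    then show ?thesis using padic_cauchy_ring_uminus[OF l c[of "nat (- k)"]]
      by (simp add: add_pow_int_lt nat)
  qed
qed

lemma padic_null_ideal:
  assumes l: "prime l"
  shows "ideal (padic_null l) (padic_cauchy_ring l)"
proof -
  interpret cring "padic_cauchy_ring l" by (rule padic_cauchy_ring_cring[OF l])
  have bm: "(\<lambda>i. g i * f i) \<in> padic_null l" if "padic_cauchy l g" "f \<in> padic_null l" for f g
    using padic_cauchy_bounded[OF l that(1)] padic_null_bounded_mult[OF l that(2)] by metis
  show ?thesis
  proof (rule idealI)
    show "ring (padic_cauchy_ring l)" by unfold_locales
    show "subgroup (padic_null l) (add_monoid (padic_cauchy_ring l))"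
    proof (rule add.subgroupI)
      show "padic_null l \<subseteq> carrier (padic_cauchy_ring l)"
        by (auto simp: padic_cauchy_ring_simps padic_null_imp_cauchy[OF l])
      show "padic_null l \<noteq> {}" using padic_null_zero by blast
      show "\<ominus>\<^bsub>padic_cauchy_ring l\<^esub> a \<in> padic_null l" if "a \<in> padic_null l" for a
        using that by (simp add: padic_cauchy_ring_uminus[OF l] padic_null_imp_cauchy[OF l] padic_null_minus)
      show "a \<oplus>\<^bsub>padic_cauchy_ring l\<^esub> b \<in> padic_null l" if "a \<in> padic_null l" "b \<in> padic_null l" for a b
        using that by (simp add: padic_cauchy_ring_simps padic_null_add[OF l])
    qed
    show "x \<otimes>\<^bsub>padic_cauchy_ring l\<^esub> a \<in> padic_null l"
      if "a \<in> padic_null l" "x \<in> carrier (padic_cauchy_ring l)" for a x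
      using that bm by (simp add: padic_cauchy_ring_simps)
    show "a \<otimes>\<^bsub>padic_cauchy_ring l\<^esub> x \<in> padic_null l"
      if "a \<in> padic_null l" "x \<in> carrier (padic_cauchy_ring l)" for a x
      using bm[of x a] that by (simp add: padic_cauchy_ring_simps mult.commute[of "a _"])
  qed
qed

text \<open>The map from Cauchy sequences to the completion is a surjective ring homomorphism. Hence
  representatives can be chosen for the unknowns, and an equation holds iff the two sides, evaluated
  at the representatives, differ by a null sequence.\<close>

lemma descent_soluble_padic_iff:
  assumes l: "prime l"
  shows "descent_soluble (padic_field l) m n b1 b2 \<longleftrightarrow>
    (\<exists>f1 f2 f3. padic_cauchy l f1 \<and> padic_cauchy l f2 \<and> padic_cauchy l f3 \<and>
      (\<lambda>i. of_int b1 * (f1 i)\<^sup>2 - of_int b2 * (f2 i)\<^sup>2 - 2 ^ m * (of_nat n)\<^sup>2) \<in> padic_null l \<and>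
      (\<lambda>i. of_int b1 * (f1 i)\<^sup>2 - of_int (b1 * b2) * (f3 i)\<^sup>2 + 2 ^ m) \<in> padic_null l)"
proof -
  let ?R = "padic_cauchy_ring l" and ?I = "padic_null l"
  let ?S = "?R Quot ?I"
  interpret R: cring ?R by (rule padic_cauchy_ring_cring[OF l])
  interpret I: ideal ?I ?R by (rule padic_null_ideal[OF l])
  define h where "h = (+>\<^bsub>?R\<^esub>) ?I"
  interpret h: ring_hom_ring ?R ?S h unfolding h_def by (rule I.rcos_ring_hom_ring)
  have carr: "carrier ?S = h ` carrier ?R"
    by (auto simp: FactRing_def A_RCOSETS_def' h_def)
  have pow2: "z [^]\<^bsub>?R\<^esub> (2::nat) = (\<lambda>i. (z i)\<^sup>2)" if "z \<in> carrier ?R" for z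
    using that R.nat_pow_Suc[of z 1] by (simp add: numeral_2_eq_2 padic_cauchy_ring_simps power2_eq_square)
  have intmult: "[(k::int)] \<cdot>\<^bsub>?S\<^esub> (h z) = h ([k] \<cdot>\<^bsub>?R\<^esub> z)" if "z \<in> carrier ?R" for k z
  proof -
    interpret a: group_hom "add_monoid ?R" "add_monoid ?S" h by (rule h.a_group_hom)
    show ?thesis using a.hom_int_pow[of z k] that by (simp add: add_pow_def)
  qed
  have c: "(\<lambda>i. of_int k * (z i)\<^sup>2) \<in> carrier ?R" if "z \<in> carrier ?R" for z k
    using that by (auto simp: padic_cauchy_ring_simps power2_eq_square intro!: padic_cauchy_mult[OF l] padic_cauchy_const)
  have sq_term: "[(k::int)] \<cdot>\<^bsub>?S\<^esub> (h z [^]\<^bsub>?S\<^esub> (2::nat)) = h (\<lambda>i. of_int k * (z i)\<^sup>2)" if "z \<in> carrier ?R" for k z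
  proof -
    have z2: "padic_cauchy l (\<lambda>i. (z i)\<^sup>2)" using c[OF that, of 1] by (simp add: padic_cauchy_ring_simps)
    have "[(k::int)] \<cdot>\<^bsub>?S\<^esub> (h z [^]\<^bsub>?S\<^esub> (2::nat)) = [k] \<cdot>\<^bsub>?S\<^esub> (h (\<lambda>i. (z i)\<^sup>2))"
      using h.hom_nat_pow[OF that, of 2] pow2[OF that] by simp
    also have "\<dots> = h (\<lambda>i. of_int k * (z i)\<^sup>2)"
      using intmult[of "\<lambda>i. (z i)\<^sup>2" k] z2 padic_cauchy_ring_add_pow[OF l z2, of k]
      by (simp add: padic_cauchy_ring_simps)
    finally show ?thesis .
  qed
  have const: "[(k::int)] \<cdot>\<^bsub>?S\<^esub> \<one>\<^bsub>?S\<^esub> = h (\<lambda>i. of_int k)" for k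
    using intmult[OF R.one_closed, of k, unfolded h.hom_one] padic_cauchy_ring_add_pow[OF l padic_cauchy_const[of l 1], of k]
    by (simp add: padic_cauchy_ring_simps padic_cauchy_const)
  have kc: "(\<lambda>i. of_int k) \<in> carrier ?R" for k
    by (simp add: padic_cauchy_ring_simps padic_cauchy_const)
  have minus: "x \<ominus>\<^bsub>?R\<^esub> y = (\<lambda>i. x i - y i)" if "y \<in> carrier ?R" for x y
    using that by (simp add: a_minus_def padic_cauchy_ring_uminus[OF l] padic_cauchy_ring_simps)
  have eq: "(h x \<ominus>\<^bsub>?S\<^esub> h y = h z) \<longleftrightarrow> (\<lambda>i. x i - y i - z i) \<in> ?I"
    if "x \<in> carrier ?R" "y \<in> carrier ?R" "z \<in> carrier ?R" for x y z
  proof -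
    have "h x \<ominus>\<^bsub>?S\<^esub> h y = h (x \<ominus>\<^bsub>?R\<^esub> y)"
      using that by (simp add: a_minus_def)
    then have "(h x \<ominus>\<^bsub>?S\<^esub> h y = h z) \<longleftrightarrow> (x \<ominus>\<^bsub>?R\<^esub> y) \<ominus>\<^bsub>?R\<^esub> z \<in> ?I"
      using R.quotient_eq_iff_same_a_r_cos[OF I.is_ideal, of "x \<ominus>\<^bsub>?R\<^esub> y" z] that
      by (auto simp: h_def)
    then show ?thesis using that by (simp add: minus)
  qed
  have key: "([b1] \<cdot>\<^bsub>?S\<^esub> (h z1 [^]\<^bsub>?S\<^esub> (2::nat))) \<ominus>\<^bsub>?S\<^esub> ([b2] \<cdot>\<^bsub>?S\<^esub> (h z2 [^]\<^bsub>?S\<^esub> (2::nat)))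
          = [(2 ^ m * (int n)\<^sup>2)] \<cdot>\<^bsub>?S\<^esub> \<one>\<^bsub>?S\<^esub> \<and>
        ([b1] \<cdot>\<^bsub>?S\<^esub> (h z1 [^]\<^bsub>?S\<^esub> (2::nat))) \<ominus>\<^bsub>?S\<^esub> ([(b1 * b2)] \<cdot>\<^bsub>?S\<^esub> (h z3 [^]\<^bsub>?S\<^esub> (2::nat)))
          = [(- (2 ^ m) :: int)] \<cdot>\<^bsub>?S\<^esub> \<one>\<^bsub>?S\<^esub> \<longleftrightarrow>
      (\<lambda>i. of_int b1 * (z1 i)\<^sup>2 - of_int b2 * (z2 i)\<^sup>2 - 2 ^ m * (of_nat n)\<^sup>2) \<in> ?I \<and>
      (\<lambda>i. of_int b1 * (z1 i)\<^sup>2 - of_int (b1 * b2) * (z3 i)\<^sup>2 + 2 ^ m) \<in> ?I"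
    if z: "z1 \<in> carrier ?R" "z2 \<in> carrier ?R" "z3 \<in> carrier ?R" for z1 z2 z3
    unfolding sq_term[OF z(1)] sq_term[OF z(2)] sq_term[OF z(3)] const
      eq[OF c[OF z(1)] c[OF z(2)] kc] eq[OF c[OF z(1)] c[OF z(3)] kc]
    by simp
  have im: "(\<exists>z\<in>h ` A. P z) \<longleftrightarrow> (\<exists>z\<in>A. P (h z))" for A P by blast
  show ?thesis
    unfolding descent_soluble_def padic_field_def carr im
    by (simp only: key cong: bex_cong) (auto simp: padic_cauchy_ring_simps(1))
qed

section \<open>Squares of l-adic numbers and the descent equations\<close>

text \<open>Being a square in the completion, for a rational number; this is phrased with sequences, as the square
  root itself is in general not rational.\<close>

definition padic_square :: "nat \<Rightarrow> rat \<Rightarrow> bool" where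
  "padic_square l u \<longleftrightarrow> (\<exists>f. padic_cauchy l f \<and> (\<lambda>i. (f i)\<^sup>2 - u) \<in> padic_null l)"

lemma padic_square_power2: "padic_square l (c\<^sup>2)"
  unfolding padic_square_def
  by (rule exI[of _ "\<lambda>_. c"]) (simp add: padic_cauchy_const padic_null_zero)

lemma padic_square_mult:
  assumes l: "prime l" and u: "padic_square l u" and v: "padic_square l v"
  shows "padic_square l (u * v)"
proof -
  obtain f g where f: "padic_cauchy l f" "(\<lambda>i. (f i)\<^sup>2 - u) \<in> padic_null l"
    and g: "padic_cauchy l g" "(\<lambda>i. (g i)\<^sup>2 - v) \<in> padic_null l"
    using u v unfolding padic_square_def by blast
  have "padic_cauchy l (\<lambda>i. (g i)\<^sup>2)"
    unfolding power2_eq_square by (intro padic_cauchy_mult[OF l] g)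
  then obtain B where B: "\<And>i. padic_abs l ((g i)\<^sup>2) \<le> B"
    using padic_cauchy_bounded[OF l] by blast
  have "(\<lambda>i. (g i)\<^sup>2 * ((f i)\<^sup>2 - u) + u * ((g i)\<^sup>2 - v)) \<in> padic_null l"
    by (intro padic_null_add[OF l] padic_null_bounded_mult[OF l f(2) B] padic_null_const_mult[OF l g(2)])
  moreover have "(g i)\<^sup>2 * ((f i)\<^sup>2 - u) + u * ((g i)\<^sup>2 - v) = (f i * g i)\<^sup>2 - u * v" for i
    by (simp add: power2_eq_square algebra_simps)
  ultimately have "(\<lambda>i. (f i * g i)\<^sup>2 - u * v) \<in> padic_null l" by simp
  then show ?thesis
    unfolding padic_square_def using padic_cauchy_mult[OF l f(1) g(1)] by blast
qed

lemma padic_cauchy_int_sequence: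
  assumes l: "prime l" and y: "\<And>k. int l ^ k dvd y (Suc k) - y k"
  shows "padic_cauchy l (\<lambda>k. of_int (y k))"
  unfolding padic_cauchy_def
proof (intro allI impI)
  fix \<epsilon> :: real assume e: "\<epsilon> > 0"
  have l1: "1 / real l < 1" using prime_gt_1_nat[OF l] by simp
  obtain k where k: "1 / real l ^ k < \<epsilon>"
    using real_arch_pow_inv[OF e l1] by (auto simp: power_one_over)
  have step: "int l ^ k dvd y (k + i) - y k" for i
  proof (induction i)
    case (Suc i)
    have "int l ^ k dvd int l ^ (k + i)" by (simp add: le_imp_power_dvd)
    then have "int l ^ k dvd y (Suc (k + i)) - y (k + i)" using y dvd_trans by blast
    from dvd_add[OF this Suc] show ?case by simp
  qed simp
  have "padic_abs l (of_int (y i) - of_int (y j)) < \<epsilon>" if "i \<ge> k" "j \<ge> k" for i j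
  proof -
    have "int l ^ k dvd (y i - y k) - (y j - y k)"
      using dvd_diff[OF step[of "i - k"] step[of "j - k"]] that by simp
    then show ?thesis using padic_abs_int_le[OF l, of k "y i - y j"] k by simp
  qed
  then show "\<exists>N. \<forall>i\<ge>N. \<forall>j\<ge>N. padic_abs l (of_int (y i) - of_int (y j)) < \<epsilon>" by blast
qed

text \<open>Hensel's lemma for a monic quadratic polynomial and a simple root modulo \<open>l\<close>: as the derivative
  is a unit, a root modulo \<open>l ^ Suc k\<close> can be corrected by a multiple of \<open>l ^ Suc k\<close> to a root modulo the
  next power. The linear term is kept because square roots at \<open>l = 2\<close> need it.\<close>

lemma quadratic_root_lift:
  fixes \<beta> \<gamma> y0 :: int
  assumes l: "prime l" and y0: "int l dvd y0\<^sup>2 + \<beta> * y0 + \<gamma>" "\<not> int l dvd 2 * y0 + \<beta>"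
  obtains y :: "nat \<Rightarrow> int" where
    "\<And>k. int l ^ k dvd (y k)\<^sup>2 + \<beta> * y k + \<gamma>" "\<And>k. int l ^ k dvd y (Suc k) - y k"
proof -
  let ?F = "\<lambda>y. y\<^sup>2 + \<beta> * y + \<gamma>"
  let ?P = "\<lambda>k y. int l ^ Suc k dvd ?F y \<and> \<not> int l dvd 2 * y + \<beta>"
  have base: "\<exists>y. ?P 0 y" using y0 by auto
  \<comment> \<open>The correction \<open>- a * t\<close> is one Newton step: \<open>t\<close> inverts the derivative modulo \<open>l\<close>.\<close>
  have step: "\<exists>y'. ?P (Suc k) y' \<and> int l ^ Suc k dvd y' - y" if P: "?P k y" for k y
  proof -
    have pr: "prime (int l)" using l by simp
    obtain a where a: "?F y = int l ^ Suc k * a" using P by (elim conjE dvdE)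
    have "coprime (2 * y + \<beta>) (int l)"
      using P pr by (meson coprime_commute prime_imp_coprime)
    then obtain t where t: "[(2 * y + \<beta>) * t = 1] (mod int l)"
      using cong_solve_coprime_int by blast
    have "[(2 * y + \<beta>) * t * (- a) = 1 * (- a)] (mod int l)"
      by (intro cong_mult t cong_refl)
    then have d: "int l dvd a + (2 * y + \<beta>) * (- a * t)"
      by (simp add: cong_iff_dvd_diff algebra_simps)
    define y' where "y' = y + int l ^ Suc k * (- a * t)"
    have "?F y' = int l ^ Suc k * (a + (2 * y + \<beta>) * (- a * t)) + int l ^ Suc k * (int l ^ Suc k * (a * t)\<^sup>2)"
      using a unfolding y'_def by (simp add: power2_eq_square algebra_simps)
    also have "int l ^ Suc (Suc k) dvd \<dots>"
    proof (rule dvd_add)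
      show "int l ^ Suc (Suc k) dvd int l ^ Suc k * (a + (2 * y + \<beta>) * (- a * t))"
        using mult_dvd_mono[OF dvd_refl[of "int l ^ Suc k"] d] by (simp add: mult.commute)
      have "int l dvd int l ^ Suc k * (a * t)\<^sup>2" by simp
      from mult_dvd_mono[OF dvd_refl[of "int l ^ Suc k"] this]
      show "int l ^ Suc (Suc k) dvd int l ^ Suc k * (int l ^ Suc k * (a * t)\<^sup>2)" by (simp add: mult.commute)
    qed
    finally have 1: "int l ^ Suc (Suc k) dvd ?F y'" .
    have "2 * y' + \<beta> = (2 * y + \<beta>) + int l * (2 * int l ^ k * (- a * t))"
      unfolding y'_def by (simp add: algebra_simps)
    then have 2: "\<not> int l dvd 2 * y' + \<beta>"
      using P by (metis dvd_add_left_iff dvd_triv_left)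
    show ?thesis using 1 2 by (intro exI[of _ y']) (simp add: y'_def)
  qed
  obtain y where y: "\<And>k. ?P k (y k)" "\<And>k. int l ^ Suc k dvd y (Suc k) - y k"
    using dependent_nat_choice[of ?P "\<lambda>k y y'. int l ^ Suc k dvd y' - y", OF base step] by metis
  have d: "int l ^ k dvd int l ^ Suc k" for k by simp
  show ?thesis
    by (rule that[of y]) (use y d dvd_trans in blast)+
qed

text \<open>If \<open>y\<close> is a root, then \<open>(2 * y + \<beta>)\<^sup>2\<close> is the discriminant. For odd \<open>l\<close> one takes \<open>\<beta> = 0\<close>. For
  \<open>l = 2\<close> the polynomial \<open>y\<^sup>2 + y - 2 * t\<close> has the simple root 0 modulo 2 and discriminant
  \<open>1 + 8 * t\<close>, so that the 2-adic units that are 1 modulo 8 are covered by the same lifting.\<close>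

lemma padic_square_discriminant:
  fixes \<beta> \<gamma> y0 :: int
  assumes l: "prime l" and y0: "int l dvd y0\<^sup>2 + \<beta> * y0 + \<gamma>" "\<not> int l dvd 2 * y0 + \<beta>"
  shows "padic_square l (of_int (\<beta>\<^sup>2 - 4 * \<gamma>))"
proof -
  obtain y :: "nat \<Rightarrow> int" where y: "\<And>k. int l ^ k dvd (y k)\<^sup>2 + \<beta> * y k + \<gamma>"
    and c: "\<And>k. int l ^ k dvd y (Suc k) - y k"
    using quadratic_root_lift[OF l y0] by blast
  define f where "f k = 2 * (of_int (y k) :: rat) + of_int \<beta>" for k
  have "padic_cauchy l f"
    unfolding f_def by (intro padic_cauchy_add padic_cauchy_mult padic_cauchy_const padic_cauchy_int_sequence l c)
  moreover have "(\<lambda>k. (f k)\<^sup>2 - of_int (\<beta>\<^sup>2 - 4 * \<gamma>)) \<in> padic_null l"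
  proof -
    have "(\<lambda>k. (of_int ((y k)\<^sup>2 + \<beta> * y k + \<gamma>))) \<in> padic_null l"
    proof (rule padic_nullI)
      fix \<epsilon> :: real assume e: "\<epsilon> > 0"
      have l1: "1 / real l < 1" using prime_gt_1_nat[OF l] by simp
      obtain k where k: "1 / real l ^ k < \<epsilon>"
        using real_arch_pow_inv[OF e l1] by (auto simp: power_one_over)
      have "padic_abs l (of_int ((y i)\<^sup>2 + \<beta> * y i + \<gamma>)) < \<epsilon>" if "i \<ge> k" for i
      proof -
        have "int l ^ k dvd (y i)\<^sup>2 + \<beta> * y i + \<gamma>"
          using y[of i] that by (meson dvd_trans le_imp_power_dvd)
        then show ?thesis using padic_abs_int_le[OF l] k by fastforce
      qed
      then show "\<exists>N. \<forall>i\<ge>N. padic_abs l (of_int ((y i)\<^sup>2 + \<beta> * y i + \<gamma>)) < \<epsilon>" by blast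
    qed
    then have "(\<lambda>k. 4 * (of_int ((y k)\<^sup>2 + \<beta> * y k + \<gamma>))) \<in> padic_null l"
      by (rule padic_null_const_mult[OF l])
    moreover have "(f k)\<^sup>2 - of_int (\<beta>\<^sup>2 - 4 * \<gamma>) = 4 * (of_int ((y k)\<^sup>2 + \<beta> * y k + \<gamma>))" for k
      by (simp add: f_def power2_eq_square algebra_simps)
    ultimately show ?thesis by (simp only:)
  qed
  ultimately show ?thesis unfolding padic_square_def by blast
qed

lemma padic_square_odd:
  assumes l: "prime l" "l \<noteq> 2" and u: "QuadRes (int l) u" "\<not> int l dvd u"
  shows "padic_square l (of_int u)"
proof -
  have pr: "prime (int l)" using l by simp
  obtain w where w: "[w\<^sup>2 = u] (mod int l)" using u(1) unfolding QuadRes_def by blast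
  have d: "int l dvd w\<^sup>2 + 0 * w + - u" using w by (simp add: cong_iff_dvd_diff)
  have "\<not> int l dvd w"
  proof
    assume "int l dvd w"
    then have "int l dvd w\<^sup>2" by (simp add: power2_eq_square)
    then have "int l dvd w\<^sup>2 - (w\<^sup>2 + 0 * w + - u)" using d by (rule dvd_diff)
    then show False using u(2) by simp
  qed
  moreover have "\<not> int l dvd 2"
    using l by (metis int_dvd_int_iff of_nat_numeral primes_dvd_imp_eq two_is_prime_nat)
  ultimately have "\<not> int l dvd 2 * w + 0"
    using pr by (simp add: prime_dvd_mult_iff)
  from padic_square_discriminant[OF l(1) d this]
  have "padic_square l (4 * of_int u)" by simp
  from padic_square_mult[OF l(1) this padic_square_power2[of l "1 / 2"]]
  show ?thesis by (simp add: power2_eq_square)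
qed

lemma padic_square_two:
  assumes u: "u mod 8 = 1"
  shows "padic_square 2 (of_int u)"
proof -
  define t where "t = u div 8"
  have t: "1\<^sup>2 - 4 * (- 2 * t) = u" unfolding t_def using u by (simp add: power2_eq_square) presburger
  have "padic_square 2 (of_int (1\<^sup>2 - 4 * (- 2 * t)))"
    by (rule padic_square_discriminant[where ?y0.0 = 0]) auto
  then show ?thesis by (simp only: t)
qed

text \<open>The unknowns are the three square roots, divided by \<open>b1\<close>, \<open>b2\<close> and \<open>b1 * b2\<close> and multiplied by the
  square root of \<open>2 ^ m\<close>.\<close>

lemma descent_soluble_padicI:
  assumes l: "prime l" and m: "even m" and b: "b1 \<noteq> 0" "b2 \<noteq> 0"
    and x: "padic_square l (of_int b1 * x)" "padic_square l (of_int b2 * (x - (of_nat n)\<^sup>2))"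
      "padic_square l (of_int (b1 * b2) * (x + 1))"
  shows "descent_soluble (padic_field l) m n b1 b2"
proof -
  obtain f1 f2 f3 where f:
    "padic_cauchy l f1" "(\<lambda>i. (f1 i)\<^sup>2 - of_int b1 * x) \<in> padic_null l"
    "padic_cauchy l f2" "(\<lambda>i. (f2 i)\<^sup>2 - of_int b2 * (x - (of_nat n)\<^sup>2)) \<in> padic_null l"
    "padic_cauchy l f3" "(\<lambda>i. (f3 i)\<^sup>2 - of_int (b1 * b2) * (x + 1)) \<in> padic_null l"
    using x unfolding padic_square_def by blast
  define c :: rat where "c = 2 ^ (m div 2)"
  have c2: "c\<^sup>2 = 2 ^ m"
    unfolding c_def using m by (simp flip: power_mult)
  have cd: "padic_cauchy l (\<lambda>i. c / a * g i)" if "padic_cauchy l g" for a g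
    by (intro padic_cauchy_mult padic_cauchy_const l that)
  have nz: "(of_int b1 :: rat) \<noteq> 0" "(of_int b2 :: rat) \<noteq> 0" using b by auto
  have "(\<lambda>i. c\<^sup>2 / of_int b1 * ((f1 i)\<^sup>2 - of_int b1 * x)
        - c\<^sup>2 / of_int b2 * ((f2 i)\<^sup>2 - of_int b2 * (x - (of_nat n)\<^sup>2))) \<in> padic_null l"
    by (intro padic_null_diff[OF l] padic_null_const_mult[OF l] f)
  also have "(\<lambda>i. c\<^sup>2 / of_int b1 * ((f1 i)\<^sup>2 - of_int b1 * x)
        - c\<^sup>2 / of_int b2 * ((f2 i)\<^sup>2 - of_int b2 * (x - (of_nat n)\<^sup>2)))
    = (\<lambda>i. of_int b1 * (c / of_int b1 * f1 i)\<^sup>2 - of_int b2 * (c / of_int b2 * f2 i)\<^sup>2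
          - 2 ^ m * (of_nat n)\<^sup>2)"
    unfolding c2[symmetric] using nz by (intro ext) (simp add: field_simps power2_eq_square)
  finally have 1: "\<dots> \<in> padic_null l" .
  have "(\<lambda>i. c\<^sup>2 / of_int b1 * ((f1 i)\<^sup>2 - of_int b1 * x)
        - c\<^sup>2 / of_int (b1 * b2) * ((f3 i)\<^sup>2 - of_int (b1 * b2) * (x + 1))) \<in> padic_null l"
    by (intro padic_null_diff[OF l] padic_null_const_mult[OF l] f)
  also have "(\<lambda>i. c\<^sup>2 / of_int b1 * ((f1 i)\<^sup>2 - of_int b1 * x)
        - c\<^sup>2 / of_int (b1 * b2) * ((f3 i)\<^sup>2 - of_int (b1 * b2) * (x + 1)))
    = (\<lambda>i. of_int b1 * (c / of_int b1 * f1 i)\<^sup>2 - of_int (b1 * b2) * (c / of_int (b1 * b2) * f3 i)\<^sup>2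
          + 2 ^ m)"
    unfolding c2[symmetric] using nz by (intro ext) (simp add: field_simps power2_eq_square)
  finally have 2: "\<dots> \<in> padic_null l" .
  show ?thesis
    unfolding descent_soluble_padic_iff[OF l]
    using 1 2 cd[OF f(1)] cd[OF f(3)] cd[OF f(5)] by blast
qed

text \<open>Here \<open>D\<close> is a common denominator of an approximate solution, \<open>g\<close> is the greatest common divisor of the
  resulting homogeneous coordinates, and \<open>D * c\<close> is one of these coordinates. As \<open>g\<close> divides
  \<open>D * c\<close>, passing from \<open>\<delta>\<close> to \<open>E\<close> costs at most the factor \<open>c\<^sup>2 = 2 ^ m\<close>; this is what the
  additional \<open>m\<close> in the exponent pays for.\<close>

lemma padic_small_clear_denominators:
  fixes E E' D g W c a :: int
  assumes l: "prime l" and small: "padic_abs l \<delta> \<le> 1 / real l ^ (k + m)"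
    and E: "of_int (g\<^sup>2 * E) = (of_int D)\<^sup>2 * \<delta>" and W: "D * c = g * W" and c: "c\<^sup>2 = 2 ^ m" and g: "g \<noteq> 0"
  shows "int l ^ k dvd E"
proof -
  have pr: "prime (int l)" using l by simp
  obtain a s where s: "\<not> int l dvd s" and as: "\<delta> * of_int s = of_int (int l ^ (k + m) * a)"
    using padic_abs_le_imp_fraction[OF l small] by blast
  have "(of_int (g\<^sup>2 * E * s) :: rat) = (of_int D)\<^sup>2 * (\<delta> * of_int s)"
    unfolding of_int_mult[of "g\<^sup>2 * E" s] E by (simp only: mult.assoc)
  also have "\<dots> = of_int (D\<^sup>2 * (int l ^ (k + m) * a))"
    unfolding as by (simp only: of_int_mult of_int_power)
  finally have eq: "g\<^sup>2 * E * s = D\<^sup>2 * (int l ^ (k + m) * a)" by (simp only: of_int_eq_iff)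
  have "g\<^sup>2 * (E * s * c\<^sup>2) = (g\<^sup>2 * E * s) * c\<^sup>2" by (simp only: mult_ac)
  also have "\<dots> = (D * c)\<^sup>2 * (int l ^ (k + m) * a)"
    unfolding eq by (simp only: power_mult_distrib mult_ac)
  also have "\<dots> = g\<^sup>2 * (int l ^ (k + m) * (a * W\<^sup>2))"
    unfolding W by (simp only: power_mult_distrib mult_ac)
  finally have "E * s * c\<^sup>2 = int l ^ (k + m) * (a * W\<^sup>2)" using g by simp
  then have "E * s * 2 ^ m = int l ^ (k + m) * (a * W\<^sup>2)"
    by (simp only: c)
  then have "s * (E * 2 ^ m) = int l ^ (k + m) * (a * W\<^sup>2)"
    by (simp only: mult_ac)
  then have "int l ^ (k + m) dvd s * (E * 2 ^ m)" by (rule dvdI)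
  moreover have "coprime (int l ^ (k + m)) s"
    using prime_imp_coprime[OF pr s] by (rule coprime_power_left_iff[THEN iffD2, OF disjI1])
  ultimately have d: "int l ^ (k + m) dvd E * 2 ^ m"
    using coprime_dvd_mult_right_iff by blast
  show ?thesis
  proof (cases "l = 2")
    case True
    then show ?thesis using d by (simp add: power_add)
  next
    case False
    have "int l ^ k dvd E * 2 ^ m" using d unfolding power_add by (rule dvd_mult_left)
    moreover have "\<not> int l dvd 2"
      using l False by (metis int_dvd_int_iff of_nat_numeral primes_dvd_imp_eq two_is_prime_nat)
    then have "coprime (int l) 2" using pr by (rule prime_imp_coprime[rotated])
    then have "coprime (int l ^ k) (2 ^ m)" by simp
    ultimately show ?thesis using coprime_dvd_mult_left_iff by blast
  qed
qed

text \<open>The homogenizing variable \<open>W\<close> absorbs the square root of \<open>2 ^ m\<close>. It may be divisible by \<open>l\<close>: points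
  near infinity are kept, and the lemmas on local obstructions apply to them as well.\<close>

lemma descent_soluble_padic_imp_primitive:
  assumes l: "prime l" and m: "even m" and sol: "descent_soluble (padic_field l) m n b1 b2"
  obtains Z1 Z2 Z3 W :: int where
    "\<not> (int l dvd Z1 \<and> int l dvd Z2 \<and> int l dvd Z3 \<and> int l dvd W)"
    "int l ^ k dvd b1 * Z1\<^sup>2 - b2 * Z2\<^sup>2 - (int n)\<^sup>2 * W\<^sup>2"
    "int l ^ k dvd b1 * Z1\<^sup>2 - b1 * b2 * Z3\<^sup>2 + W\<^sup>2"
proof -
  obtain f1 f2 f3 where
    f: "(\<lambda>i. of_int b1 * (f1 i)\<^sup>2 - of_int b2 * (f2 i)\<^sup>2 - 2 ^ m * (of_nat n)\<^sup>2) \<in> padic_null l"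
      "(\<lambda>i. of_int b1 * (f1 i)\<^sup>2 - of_int (b1 * b2) * (f3 i)\<^sup>2 + 2 ^ m) \<in> padic_null l"
    using sol unfolding descent_soluble_padic_iff[OF l] by blast
  have pos: "0 < 1 / real l ^ (k + m)" using prime_gt_0_nat[OF l] by simp
  obtain N where N: "\<And>i. i \<ge> N \<Longrightarrow>
      padic_abs l (of_int b1 * (f1 i)\<^sup>2 - of_int b2 * (f2 i)\<^sup>2 - 2 ^ m * (of_nat n)\<^sup>2) < 1 / real l ^ (k + m)"
    using padic_nullD[OF f(1) pos] by blast
  obtain M where M: "\<And>i. i \<ge> M \<Longrightarrow>
      padic_abs l (of_int b1 * (f1 i)\<^sup>2 - of_int (b1 * b2) * (f3 i)\<^sup>2 + 2 ^ m) < 1 / real l ^ (k + m)"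
    using padic_nullD[OF f(2) pos] by blast
  define z1 z2 z3 where "z1 = f1 (max N M)" "z2 = f2 (max N M)" "z3 = f3 (max N M)"
  define \<delta> \<delta>' where "\<delta> = of_int b1 * z1\<^sup>2 - of_int b2 * z2\<^sup>2 - 2 ^ m * (of_nat n)\<^sup>2"
    and "\<delta>' = of_int b1 * z1\<^sup>2 - of_int (b1 * b2) * z3\<^sup>2 + 2 ^ m"
  have small: "padic_abs l \<delta> \<le> 1 / real l ^ (k + m)" "padic_abs l \<delta>' \<le> 1 / real l ^ (k + m)"
    unfolding \<delta>_def \<delta>'_def z1_z2_z3_def by (intro less_imp_le N M max.cobounded1 max.cobounded2)+
  obtain a1 d1 where 1: "z1 = of_int a1 / of_int d1" "d1 > 0"
    by (metis quotient_of_denom_pos quotient_of_div surj_pair)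
  obtain a2 d2 where 2: "z2 = of_int a2 / of_int d2" "d2 > 0"
    by (metis quotient_of_denom_pos quotient_of_div surj_pair)
  obtain a3 d3 where 3: "z3 = of_int a3 / of_int d3" "d3 > 0"
    by (metis quotient_of_denom_pos quotient_of_div surj_pair)
  define c :: int where "c = 2 ^ (m div 2)"
  have c2: "c\<^sup>2 = 2 ^ m"
    unfolding c_def using m by (simp flip: power_mult)
  define D where "D = d1 * d2 * d3"
  define g where "g = Gcd {a1 * d2 * d3, a2 * d1 * d3, a3 * d1 * d2, D * c}"
  have "g dvd a1 * d2 * d3" "g dvd a2 * d1 * d3" "g dvd a3 * d1 * d2" "g dvd D * c"
    unfolding g_def by (auto intro!: Gcd_dvd simp del: Gcd_insert)
  then obtain Z1 Z2 Z3 W where Z: "a1 * d2 * d3 = g * Z1" "a2 * d1 * d3 = g * Z2"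
      "a3 * d1 * d2 = g * Z3" and W: "D * c = g * W"
    by (elim dvdE)
  have g: "g \<noteq> 0" using W 1 2 3 by (auto simp: D_def c_def)
  have zZ: "of_int (g * Z1) = of_int D * z1" "of_int (g * Z2) = of_int D * z2" "of_int (g * Z3) = of_int D * z3"
    unfolding Z[symmetric] using 1 2 3 by (simp_all add: D_def)
  have cc: "(of_int (D * c))\<^sup>2 = (of_int D)\<^sup>2 * (2 ^ m :: rat)"
  proof -
    have "(of_int (D * c))\<^sup>2 = (of_int D)\<^sup>2 * (of_int (c\<^sup>2) :: rat)"
      by (simp add: power_mult_distrib)
    then show ?thesis by (simp add: c2)
  qed
  have sq: "(of_int (g\<^sup>2 * Z1\<^sup>2) :: rat) = (of_int D)\<^sup>2 * z1\<^sup>2" "(of_int (g\<^sup>2 * Z2\<^sup>2) :: rat) = (of_int D)\<^sup>2 * z2\<^sup>2"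
      "(of_int (g\<^sup>2 * Z3\<^sup>2) :: rat) = (of_int D)\<^sup>2 * z3\<^sup>2" "(of_int (g\<^sup>2 * W\<^sup>2) :: rat) = (of_int D)\<^sup>2 * 2 ^ m"
    using zZ[THEN arg_cong[where f = "\<lambda>x. x\<^sup>2"]] cc unfolding W by (simp_all add: power_mult_distrib)
  show ?thesis
  proof (rule that[of Z1 Z2 Z3 W])
    show "\<not> (int l dvd Z1 \<and> int l dvd Z2 \<and> int l dvd Z3 \<and> int l dvd W)"
    proof
      assume "int l dvd Z1 \<and> int l dvd Z2 \<and> int l dvd Z3 \<and> int l dvd W"
      then have "g * int l dvd Gcd {g * Z1, g * Z2, g * Z3, g * W}"
        by (intro Gcd_greatest) (auto simp del: Gcd_insert)
      then have "g * int l dvd g"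
        by (simp only: g_def[symmetric] Z[symmetric] W[symmetric])
      then have "int l dvd 1" using g by simp
      then show False using l by (simp add: prime_nat_iff)
    qed
    show "int l ^ k dvd b1 * Z1\<^sup>2 - b2 * Z2\<^sup>2 - (int n)\<^sup>2 * W\<^sup>2"
    proof (rule padic_small_clear_denominators[OF l small(1) _ W c2 g])
      have "(of_int (g\<^sup>2 * (b1 * Z1\<^sup>2 - b2 * Z2\<^sup>2 - (int n)\<^sup>2 * W\<^sup>2)) :: rat)
        = of_int b1 * of_int (g\<^sup>2 * Z1\<^sup>2) - of_int b2 * of_int (g\<^sup>2 * Z2\<^sup>2) - (of_nat n)\<^sup>2 * of_int (g\<^sup>2 * W\<^sup>2)"
        by (simp add: algebra_simps)
      also have "\<dots> = (of_int D)\<^sup>2 * \<delta>"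
        unfolding sq by (simp add: \<delta>_def algebra_simps)
      finally show "of_int (g\<^sup>2 * (b1 * Z1\<^sup>2 - b2 * Z2\<^sup>2 - (int n)\<^sup>2 * W\<^sup>2)) = (of_int D)\<^sup>2 * \<delta>" .
    qed
    show "int l ^ k dvd b1 * Z1\<^sup>2 - b1 * b2 * Z3\<^sup>2 + W\<^sup>2"
    proof (rule padic_small_clear_denominators[OF l small(2) _ W c2 g])
      have "(of_int (g\<^sup>2 * (b1 * Z1\<^sup>2 - b1 * b2 * Z3\<^sup>2 + W\<^sup>2)) :: rat)
        = of_int b1 * of_int (g\<^sup>2 * Z1\<^sup>2) - of_int (b1 * b2) * of_int (g\<^sup>2 * Z3\<^sup>2) + of_int (g\<^sup>2 * W\<^sup>2)"
        by (simp add: algebra_simps)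
      also have "\<dots> = (of_int D)\<^sup>2 * \<delta>'"
        unfolding sq by (simp add: \<delta>'_def algebra_simps)
      finally show "of_int (g\<^sup>2 * (b1 * Z1\<^sup>2 - b1 * b2 * Z3\<^sup>2 + W\<^sup>2)) = (of_int D)\<^sup>2 * \<delta>'" .
    qed
  qed
qed

section \<open>Quadratic characters modulo a prime\<close>

lemma Legendre_cases: "Legendre a p = -1 \<or> Legendre a p = 0 \<or> Legendre a p = 1"
  by (simp add: Legendre_def)

lemma Legendre_cong: "[a = b] (mod p) \<Longrightarrow> Legendre a p = Legendre b p"
  unfolding Legendre_def QuadRes_def by (simp add: cong_def)

lemma Legendre_mod: "Legendre (a mod p) p = Legendre a p"
  by (rule Legendre_cong) (simp add: cong_def)

lemma Legendre_eq_0_iff: "Legendre a p = 0 \<longleftrightarrow> p dvd a"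
  by (simp add: Legendre_def cong_0_iff)

lemma Legendre_eq_1_iff: "Legendre a p = 1 \<longleftrightarrow> \<not> p dvd a \<and> QuadRes p a"
  by (simp add: Legendre_def cong_0_iff)

text \<open>By Euler's criterion the two sides are congruent, and they differ by at most 2, which is less than \<open>p\<close>.\<close>

lemma Legendre_mult:
  assumes p: "prime p" "2 < p"
  shows "Legendre (a * b) (int p) = Legendre a (int p) * Legendre b (int p)"
proof -
  let ?L = "\<lambda>a. Legendre a (int p)" and ?k = "(p - 1) div 2"
  have "[?L (a * b) = (a * b) ^ ?k] (mod int p)"
    by (rule euler_criterion[OF p])
  also have "[(a * b) ^ ?k = ?L a * ?L b] (mod int p)"
    unfolding power_mult_distrib
    by (intro cong_mult cong_sym[OF euler_criterion[OF p]])
  finally have "int p dvd ?L (a * b) - ?L a * ?L b"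
    by (simp add: cong_iff_dvd_diff)
  moreover have "\<bar>?L (a * b) - ?L a * ?L b\<bar> < int p"
    using Legendre_cases[of "a * b" "int p"] Legendre_cases[of a "int p"] Legendre_cases[of b "int p"] p(2)
    by auto
  ultimately show ?thesis
    using dvd_imp_le_int[of "?L (a * b) - ?L a * ?L b" "int p"] by linarith
qed

lemma Legendre_power2:
  assumes "\<not> p dvd a" "prime p"
  shows "Legendre (a\<^sup>2) p = 1"
proof -
  have "\<not> p dvd a\<^sup>2" using assms prime_dvd_power by blast
  moreover have "QuadRes p (a\<^sup>2)" unfolding QuadRes_def using cong_refl by blast
  ultimately show ?thesis by (simp add: Legendre_eq_1_iff)
qed

text \<open>In Gauss's lemma for 2, with \<open>h = (p - 1) / 2\<close>, none of the numbers \<open>2, 4, \<dots>, 2 * h\<close> is reduced, and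
  those above \<open>h\<close> are the doubles of the integers in \<open>{h div 2<..h}\<close>. Their number is even
  exactly for \<open>p\<close> equal to 1 or 7 modulo 8.\<close>

lemma Legendre_two:
  assumes p: "prime p" "2 < p"
  shows "Legendre 2 (int p) = (if p mod 8 = 1 \<or> p mod 8 = 7 then 1 else -1)"
proof -
  have odd: "odd p" using p prime_odd_nat by blast
  have "\<not> int p dvd 2" using p(2) zdvd_not_zless[of 2 "int p"] by simp
  then interpret G: GAUSS p 2
    by unfold_locales (use p in \<open>auto simp: cong_0_iff\<close>)
  define h where "h = (int p - 1) div 2"
  have h: "int p = 2 * h + 1" using odd unfolding h_def by presburger
  have "G.E = (\<lambda>x. x * 2) ` {h div 2 <.. h}"
  proof -
    have "x * 2 mod int p = x * 2" if "0 < x" "x \<le> h" for x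
      using that h by (intro mod_pos_pos_trivial) auto
    then have "G.C = (\<lambda>x. x * 2) ` {0 <.. h}"
      unfolding G.C_def G.B_def G.A_def h_def[symmetric] image_image by (intro image_cong) auto
    then have "G.E = (\<lambda>x. x * 2) ` {0 <.. h} \<inter> {h <..}"
      unfolding G.E_def h_def by simp
    also have "\<dots> = (\<lambda>x. x * 2) ` {h div 2 <.. h}"
    proof (intro equalityI subsetI)
      fix y assume "y \<in> (\<lambda>x. x * 2) ` {0 <.. h} \<inter> {h <..}"
      then obtain x where "y = x * 2" "x \<le> h" "h < x * 2" by auto
      then show "y \<in> (\<lambda>x. x * 2) ` {h div 2 <.. h}" by (intro image_eqI[of _ _ x]) auto
    next
      fix y assume "y \<in> (\<lambda>x. x * 2) ` {h div 2 <.. h}"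
      then obtain x where x: "y = x * 2" "x \<le> h" "h div 2 < x" by auto
      moreover have "h \<ge> 0" using h p(2) by linarith
      ultimately have "0 < x" "h < x * 2" by linarith+
      then show "y \<in> (\<lambda>x. x * 2) ` {0 <.. h} \<inter> {h <..}" using x by auto
    qed
    finally show ?thesis .
  qed
  then have "card G.E = nat (h - h div 2)"
    by (simp add: card_image inj_on_def)
  then have "Legendre 2 (int p) = (-1) ^ nat (h - h div 2)"
    using G.gauss_lemma by simp
  moreover have "h - h div 2 \<ge> 0" using h p(2) by linarith
  then have "even (nat (h - h div 2)) \<longleftrightarrow> even (h - h div 2)" by (simp add: even_nat_iff)
  moreover have "even (h - h div 2) \<longleftrightarrow> p mod 8 = 1 \<or> p mod 8 = 7"
  proof -
    have "p mod 8 = 1 \<longleftrightarrow> int p mod 8 = 1" "p mod 8 = 7 \<longleftrightarrow> int p mod 8 = 7" by presburger+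
    moreover have "even (h - h div 2) \<longleftrightarrow> (2 * h + 1) mod 8 = 1 \<or> (2 * h + 1) mod 8 = 7" by presburger
    ultimately show ?thesis unfolding h by simp
  qed
  ultimately show ?thesis by simp
qed

lemma sum_residues_affine:
  fixes f :: "int \<Rightarrow> int" and p c d :: int
  assumes p: "p > 0" and periodic: "\<And>x. f (x mod p) = f x" and c: "coprime c p"
  shows "(\<Sum>x\<in>{0..<p}. f (c * x + d)) = (\<Sum>x\<in>{0..<p}. f x)"
proof -
  let ?g = "\<lambda>x. (c * x + d) mod p"
  have inj: "inj_on ?g {0..<p}"
  proof (rule inj_onI)
    fix x y assume xy: "x \<in> {0..<p}" "y \<in> {0..<p}" "?g x = ?g y"
    then have "[c * x + d = c * y + d] (mod p)" by (simp add: cong_def)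
    then have "[x = y] (mod p)"
      using c by (simp add: cong_add_rcancel cong_mult_lcancel coprime_commute)
    then show "x = y" using xy by (auto simp: cong_def)
  qed
  have "?g ` {0..<p} \<subseteq> {0..<p}" using p by auto
  then have surj: "?g ` {0..<p} = {0..<p}" using inj by (intro endo_inj_surj) auto
  have "(\<Sum>x\<in>{0..<p}. f x) = (\<Sum>x\<in>?g ` {0..<p}. f x)" by (simp add: surj)
  also have "\<dots> = (\<Sum>x\<in>{0..<p}. f (c * x + d))"
    by (simp add: sum.reindex[OF inj] periodic)
  finally show ?thesis by simp
qed

lemma odd_prime_not_dvd_2: "2 < p \<Longrightarrow> \<not> int p dvd 2"
  using zdvd_not_zless[of 2 "int p"] by simp

text \<open>Summed over all \<open>x\<close>, the left hand side counts all residues \<open>z\<close>, so the Legendre symbols sum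
  to 0.\<close>

lemma card_square_roots_mod:
  assumes p: "prime p" "2 < p" and x: "x \<in> {0..<int p}"
  shows "int (card {z \<in> {0..<int p}. z\<^sup>2 mod int p = x}) = 1 + Legendre x (int p)"
proof -
  have pr: "prime (int p)" using p by simp
  have p2: "\<not> int p dvd 2" by (rule odd_prime_not_dvd_2[OF p(2)])
  consider "x = 0" | "x \<noteq> 0" "QuadRes (int p) x" | "x \<noteq> 0" "\<not> QuadRes (int p) x" by blast
  then show ?thesis
  proof cases
    case 1
    have "{z \<in> {0..<int p}. z\<^sup>2 mod int p = x} = {0}"
    proof (intro equalityI subsetI)
      fix z assume "z \<in> {z \<in> {0..<int p}. z\<^sup>2 mod int p = x}"
      then have "int p dvd z\<^sup>2" "z \<in> {0..<int p}" using 1 by auto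
      then have "int p dvd z" using pr prime_dvd_power by blast
      then show "z \<in> {0}" using \<open>z \<in> {0..<int p}\<close> zdvd_imp_le[of "int p" z] by force
    qed (use 1 p in auto)
    then show ?thesis using 1 by (simp add: Legendre_def)
  next
    case 2
    obtain w where w: "[w\<^sup>2 = x] (mod int p)" using 2 unfolding QuadRes_def by blast
    have nx: "\<not> int p dvd x" using 2 x zdvd_imp_le[of "int p" x] by force
    then have nw: "\<not> int p dvd w"
    proof -
      have "int p dvd w\<^sup>2" if "int p dvd w" using that by (simp add: power2_eq_square)
      then show ?thesis using w nx cong_dvd_iff by blast
    qed
    have eq: "{z \<in> {0..<int p}. z\<^sup>2 mod int p = x} = {w mod int p, (- w) mod int p}"
    proof (intro equalityI subsetI)
      fix z assume "z \<in> {z \<in> {0..<int p}. z\<^sup>2 mod int p = x}"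
      then have z: "z \<in> {0..<int p}" "[z\<^sup>2 = x] (mod int p)" using x by (auto simp: cong_def)
      then have "[z\<^sup>2 = w\<^sup>2] (mod int p)" using w cong_sym cong_trans by blast
      then have "int p dvd (z - w) * (z + w)"
        by (simp add: cong_iff_dvd_diff power2_eq_square algebra_simps)
      then have "int p dvd z - w \<or> int p dvd z - (- w)" using pr by (simp add: prime_dvd_mult_iff)
      then have "z mod int p = w mod int p \<or> z mod int p = (- w) mod int p"
        by (simp add: mod_eq_dvd_iff)
      then show "z \<in> {w mod int p, (- w) mod int p}" using z by auto
    next
      fix z assume "z \<in> {w mod int p, (- w) mod int p}"
      then have "z \<in> {0..<int p}" "z\<^sup>2 mod int p = w\<^sup>2 mod int p"
        using p power_mod[of w "int p" 2] power_mod[of "- w" "int p" 2] by auto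
      then show "z \<in> {z \<in> {0..<int p}. z\<^sup>2 mod int p = x}" using w x by (simp add: cong_def)
    qed
    have "w mod int p \<noteq> (- w) mod int p"
    proof
      assume "w mod int p = (- w) mod int p"
      then have "int p dvd 2 * w" by (simp add: mod_eq_dvd_iff)
      then show False using pr nw p2 by (simp add: prime_dvd_mult_iff)
    qed
    then have "card {z \<in> {0..<int p}. z\<^sup>2 mod int p = x} = 2" unfolding eq by simp
    then show ?thesis using 2 nx by (simp add: Legendre_def cong_0_iff)
  next
    case 3
    have empty: "{z \<in> {0..<int p}. z\<^sup>2 mod int p = x} = {}"
      using 3 x unfolding QuadRes_def by (auto simp: cong_def)
    have "\<not> int p dvd x" using 3 x zdvd_imp_le[of "int p" x] by force
    then show ?thesis unfolding empty using 3 by (simp add: Legendre_def cong_0_iff)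
  qed
qed

lemma sum_Legendre:
  assumes p: "prime p" "2 < p"
  shows "(\<Sum>x\<in>{0..<int p}. Legendre x (int p)) = 0"
proof -
  have "(\<Sum>x\<in>{0..<int p}. 1 + Legendre x (int p))
      = (\<Sum>x\<in>{0..<int p}. \<Sum>z\<in>{z \<in> {0..<int p}. z\<^sup>2 mod int p = x}. 1)"
    using card_square_roots_mod[OF p] by (intro sum.cong) auto
  also have "\<dots> = (\<Sum>z\<in>{0..<int p}. 1)"
    using p by (intro sum.group) auto
  finally show ?thesis by (simp add: sum.distrib)
qed

lemma sum_Legendre_affine:
  assumes p: "prime p" "2 < p"
  shows "(\<Sum>x\<in>{0..<int p}. Legendre (x + d) (int p)) = 0"
  using sum_residues_affine[of "int p" "\<lambda>x. Legendre x (int p)" 1 d] sum_Legendre[OF p] p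
  by (simp add: Legendre_mod)

text \<open>Substituting \<open>a * x\<close> for \<open>x\<close> shows that the sum is the same for all \<open>a\<close> prime to \<open>p\<close>. The sum of
  these sums over all residues \<open>a\<close> vanishes, and \<open>a = 0\<close> contributes \<open>p - 1\<close>.\<close>

lemma sum_Legendre_product:
  assumes p: "prime p" "2 < p" and a: "\<not> int p dvd a"
  shows "(\<Sum>x\<in>{0..<int p}. Legendre x (int p) * Legendre (x + a) (int p)) = -1"
proof -
  let ?L = "\<lambda>a. Legendre a (int p)"
  define S where "S a = (\<Sum>x\<in>{0..<int p}. ?L x * ?L (x + a))" for a
  have pr: "prime (int p)" using p by simp
  have scale: "S a = S 1" if a: "\<not> int p dvd a" for a
  proof -
    have "coprime a (int p)" using pr a by (meson coprime_commute prime_imp_coprime)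
    moreover have "?L (x mod int p) * ?L (x mod int p + a) = ?L x * ?L (x + a)" for x
      using Legendre_mod[of x "int p"] Legendre_cong[of "x mod int p + a" "x + a" "int p"]
      by (simp add: cong_def mod_add_left_eq)
    ultimately have "S a = (\<Sum>x\<in>{0..<int p}. ?L (a * x + 0) * ?L (a * x + 0 + a))"
      unfolding S_def using sum_residues_affine[of "int p" "\<lambda>x. ?L x * ?L (x + a)" a 0] p by simp
    also have "\<dots> = (\<Sum>x\<in>{0..<int p}. (?L a * ?L a) * (?L x * ?L (x + 1)))"
    proof (rule sum.cong[OF refl])
      fix x
      have "?L (a * x + 0) = ?L a * ?L x" by (simp add: Legendre_mult[OF p])
      moreover have "?L (a * x + 0 + a) = ?L a * ?L (x + 1)"
        by (simp flip: Legendre_mult[OF p] add: algebra_simps)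
      ultimately show "?L (a * x + 0) * ?L (a * x + 0 + a) = (?L a * ?L a) * (?L x * ?L (x + 1))" by simp
    qed
    also have "\<dots> = S 1"
      using Legendre_cases[of a "int p"] a unfolding S_def
      by (auto simp: Legendre_eq_0_iff simp flip: sum_distrib_left)
    finally show ?thesis .
  qed
  have nd: "\<not> int p dvd x" if "x \<in> {0<..<int p}" for x
    using that zdvd_not_zless by auto
  have "S 0 = (\<Sum>x\<in>{0..<int p}. if x = 0 then 0 else 1)"
    unfolding S_def
  proof (rule sum.cong[OF refl])
    fix x assume "x \<in> {0..<int p}"
    then show "?L x * ?L (x + 0) = (if x = 0 then 0 else 1)"
      using nd[of x] Legendre_cases[of x "int p"] by (auto simp: Legendre_eq_0_iff)
  qed
  also have "\<dots> = (\<Sum>x\<in>{0..<int p} - {0}. 1)"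
    by (rule sum.mono_neutral_cong_right) auto
  finally have S0: "S 0 = int p - 1" using p by simp
  have "(\<Sum>a\<in>{0..<int p}. S a) = (\<Sum>x\<in>{0..<int p}. ?L x * (\<Sum>a\<in>{0..<int p}. ?L (a + x)))"
    unfolding S_def by (subst sum.swap) (simp add: sum_distrib_left add.commute)
  then have "(\<Sum>a\<in>{0..<int p}. S a) = 0" by (simp add: sum_Legendre_affine[OF p])
  moreover have "(\<Sum>a\<in>{0..<int p}. S a) = S 0 + (\<Sum>a\<in>{0<..<int p}. S a)"
  proof -
    have "{0..<int p} = insert 0 {0<..<int p}" using p by auto
    then show ?thesis by simp
  qed
  moreover have "(\<Sum>a\<in>{0<..<int p}. S a) = (\<Sum>a\<in>{0<..<int p}. S 1)"
    by (intro sum.cong refl scale nd) auto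
  ultimately have "(int p - 1) * (1 + S 1) = 0" using S0 p by (simp add: algebra_simps)
  then have "S 1 = -1" using p by simp
  then show ?thesis using scale[OF a] unfolding S_def by simp
qed

text \<open>Let \<open>A e1 e2\<close> be the number of solutions modulo \<open>p\<close>, written as a sum of products of
  characters. Expanding the products gives \<open>p - (e1 + e2 + e1 * e2) + S\<close>, where \<open>S\<close> is the sum of the
  characters of \<open>x * (x - a) * (x + 1)\<close>. As \<open>S\<close> is the same for all signs,
  \<open>A e1 e2\<close> is \<open>A 1 1 + 4\<close>, and \<open>A 1 1\<close> is a sum of nonnegative terms.\<close>

lemma exists_residue_with_characters:
  assumes p: "prime p" "2 < p" and a: "\<not> int p dvd a" "\<not> int p dvd a + 1"
    and e: "e1 \<in> {-1, 1}" "e2 \<in> {-1, 1}" "\<not> (e1 = 1 \<and> e2 = 1)"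
  shows "\<exists>x. Legendre x (int p) \<in> {0, e1} \<and> Legendre (x - a) (int p) \<in> {0, e2}
           \<and> Legendre (x + 1) (int p) \<in> {0, e1 * e2}"
proof -
  let ?L = "\<lambda>a. Legendre a (int p)" and ?I = "{0..<int p}"
  define A where "A e1 e2 = (\<Sum>x\<in>?I. (1 + e1 * ?L x) * (1 + e2 * ?L (x - a)) * (1 + e1 * e2 * ?L (x + 1)))" for e1 e2
  define S where "S = (\<Sum>x\<in>?I. ?L x * ?L (x - a) * ?L (x + 1))"
  have s1: "(\<Sum>x\<in>?I. ?L x) = 0" by (rule sum_Legendre[OF p])
  have s2: "(\<Sum>x\<in>?I. ?L (x - a)) = 0" using sum_Legendre_affine[OF p, of "-a"] by simp
  have s3: "(\<Sum>x\<in>?I. ?L (x + 1)) = 0" by (rule sum_Legendre_affine[OF p])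
  have s12: "(\<Sum>x\<in>?I. ?L x * ?L (x - a)) = -1" using sum_Legendre_product[OF p, of "-a"] a by simp
  have s13: "(\<Sum>x\<in>?I. ?L x * ?L (x + 1)) = -1"
    using sum_Legendre_product[OF p, of 1] p by simp
  have s23: "(\<Sum>x\<in>?I. ?L (x - a) * ?L (x + 1)) = -1"
  proof -
    have "?L (x mod int p) * ?L (x mod int p + (a + 1)) = ?L x * ?L (x + (a + 1))" for x
      using Legendre_mod[of x "int p"] Legendre_cong[of "x mod int p + (a + 1)" "x + (a + 1)" "int p"]
      by (simp add: cong_def mod_add_left_eq)
    then have "(\<Sum>x\<in>?I. ?L (1 * x + - a) * ?L (1 * x + - a + (a + 1))) = -1"
      using sum_residues_affine[of "int p" "\<lambda>x. ?L x * ?L (x + (a + 1))" 1 "- a"]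
        sum_Legendre_product[OF p a(2)] p by simp
    then show ?thesis by simp
  qed
  have expand: "A e1 e2 = int p - (e1 + e2 + e1 * e2) + S" if "e1 \<in> {-1, 1}" "e2 \<in> {-1, 1}" for e1 e2
  proof -
    have "A e1 e2 = (\<Sum>x\<in>?I. 1 + e1 * ?L x + e2 * ?L (x - a) + e1 * e2 * ?L (x + 1)
        + e1 * e2 * (?L x * ?L (x - a)) + e2 * (?L x * ?L (x + 1)) + e1 * (?L (x - a) * ?L (x + 1))
        + ?L x * ?L (x - a) * ?L (x + 1))"
      unfolding A_def using that by (intro sum.cong refl) (auto simp: algebra_simps)
    also have "\<dots> = int p - (e1 + e2 + e1 * e2) + S"
      unfolding sum.distrib sum_distrib_left[symmetric] s1 s2 s3 s12 s13 s23 S_def by simp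
    finally show ?thesis .
  qed
  \<comment> \<open>If not both signs are 1, then \<open>e1 + e2 + e1 * e2\<close> is \<open>-1\<close> instead of 3.\<close>
  have "A 1 1 \<ge> 0"
    unfolding A_def
  proof (intro sum_nonneg mult_nonneg_nonneg)
    show "0 \<le> 1 + 1 * ?L x" "0 \<le> 1 + 1 * ?L (x - a)" "0 \<le> 1 + 1 * 1 * ?L (x + 1)" for x
      using Legendre_cases[of x "int p"] Legendre_cases[of "x - a" "int p"] Legendre_cases[of "x + 1" "int p"] by auto
  qed
  moreover have "A e1 e2 = A 1 1 + 4" using e by (auto simp: expand)
  ultimately have "A e1 e2 \<noteq> 0" by simp
  then obtain x where "(1 + e1 * ?L x) * (1 + e2 * ?L (x - a)) * (1 + e1 * e2 * ?L (x + 1)) \<noteq> 0"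
    unfolding A_def by (meson sum.neutral)
  then show ?thesis
    using Legendre_cases[of x "int p"] Legendre_cases[of "x - a" "int p"] Legendre_cases[of "x + 1" "int p"] e
    by (intro exI[of _ x]) auto
qed

section \<open>Local obstructions\<close>

lemma prime_dvd_power2D:
  fixes p :: int
  assumes "prime p" "p dvd x\<^sup>2"
  shows "p dvd x"
  using assms prime_dvd_power by blast

text \<open>A squarefree coefficient contributes at most one factor \<open>p\<close>.\<close>

lemma prime_power2_dvd_mult:
  fixes p :: int
  assumes p: "prime p" and sf: "squarefree b" and d: "p ^ 2 dvd b * x\<^sup>2"
  shows "p dvd x"
proof (rule ccontr)
  assume "\<not> p dvd x"
  then have "coprime (p ^ 2) (x\<^sup>2)" using p by (simp add: prime_imp_coprime)
  then have "p ^ 2 dvd b" using d coprime_dvd_mult_left_iff by blast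
  then have "p dvd 1" using sf unfolding squarefree_def by blast
  then show False using p not_prime_unit by blast
qed

lemma prime_dvd_mult_not_left:
  fixes p :: int
  assumes p: "prime p" and "p dvd b * x\<^sup>2" "\<not> p dvd b"
  shows "p dvd x"
  using assms prime_dvd_power2D[OF p] by (auto simp: prime_dvd_mult_iff)

lemma power2_dvd_power2: "p dvd x \<Longrightarrow> p ^ 2 dvd (x::int)\<^sup>2"
  by (rule dvd_power_same)

lemma QuadRes_of_square_multiple:
  fixes p :: int
  assumes p: "prime p" and "\<not> p dvd x" "p dvd u * x\<^sup>2 - y\<^sup>2"
  shows "QuadRes p u"
proof -
  have "coprime x p" using assms(1,2) by (meson coprime_commute prime_imp_coprime)
  then obtain z where z: "[x * z = 1] (mod p)" using cong_solve_coprime_int by blast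
  have "[(y * z)\<^sup>2 = y\<^sup>2 * z\<^sup>2] (mod p)" by (simp add: power_mult_distrib)
  also have "[y\<^sup>2 * z\<^sup>2 = u * x\<^sup>2 * z\<^sup>2] (mod p)"
    using assms(3) by (intro cong_mult cong_refl) (simp add: cong_iff_dvd_diff dvd_diff_commute)
  also have "u * x\<^sup>2 * z\<^sup>2 = u * (x * z)\<^sup>2" by (simp add: power_mult_distrib)
  also have "[u * (x * z)\<^sup>2 = u * 1\<^sup>2] (mod p)"
    by (intro cong_mult cong_pow cong_refl z)
  finally show ?thesis unfolding QuadRes_def by auto
qed

text \<open>A homogeneous solution of the descent equations to precision \<open>p ^ 3\<close>, with coordinates that are not
  all divisible by \<open>p\<close>. The third power is what the argument needs in the worst case, where \<open>p\<close> divides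
  both coefficients: then \<open>b1 * b2\<close> has two factors \<open>p\<close>, and information modulo \<open>p\<close> has to remain after
  they are cancelled. Most lemmas below show that too many coordinates would be divisible by \<open>p\<close>.\<close>

locale primitive_solution =
  fixes p b1 b2 N :: int and Z1 Z2 Z3 W :: int
  assumes p: "prime p" and sf: "squarefree b1" "squarefree b2"
    and primitive: "\<not> (p dvd Z1 \<and> p dvd Z2 \<and> p dvd Z3 \<and> p dvd W)"
    and sol1: "p ^ 3 dvd b1 * Z1\<^sup>2 - b2 * Z2\<^sup>2 - N\<^sup>2 * W\<^sup>2"
    and sol2: "p ^ 3 dvd b1 * Z1\<^sup>2 - b1 * b2 * Z3\<^sup>2 + W\<^sup>2"
begin

text \<open>The defects are kept as constants so that divisibility can be combined by linear algebra without
  their summands being considered one at a time. The third equation is the difference of the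
  other two.\<close>

definition defect1 where "defect1 = b1 * Z1\<^sup>2 - b2 * Z2\<^sup>2 - N\<^sup>2 * W\<^sup>2"
definition defect2 where "defect2 = b1 * Z1\<^sup>2 - b1 * b2 * Z3\<^sup>2 + W\<^sup>2"
definition defect3 where "defect3 = b1 * b2 * Z3\<^sup>2 - b2 * Z2\<^sup>2 - (N\<^sup>2 + 1) * W\<^sup>2"

lemmas defect_defs = defect1_def defect2_def defect3_def

lemma defect3_eq: "defect3 = defect1 - defect2" by (simp add: defect_defs algebra_simps)

lemma p_dvd_powers: "p dvd p ^ 2" "p dvd p ^ 3" "p ^ 2 dvd p ^ 3"
  by (simp_all add: power2_eq_square power3_eq_cube)

lemma dvd_defect1: "p dvd defect1" "p ^ 2 dvd defect1" "p ^ 3 dvd defect1"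
  using sol1 p_dvd_powers dvd_trans unfolding defect1_def by blast+

lemma dvd_defect2: "p dvd defect2" "p ^ 2 dvd defect2" "p ^ 3 dvd defect2"
  using sol2 p_dvd_powers dvd_trans unfolding defect2_def by blast+

lemma dvd_defect3: "p dvd defect3" "p ^ 2 dvd defect3" "p ^ 3 dvd defect3"
  unfolding defect3_eq using dvd_defect1 dvd_defect2 by (auto intro: dvd_diff)

lemma dvd_coeff1_imp_dvd_W:
  assumes "p dvd b1"
  shows "p dvd W"
proof -
  have "p dvd defect2 - b1 * (Z1\<^sup>2 - b2 * Z3\<^sup>2)"
    using dvd_defect2(1) assms by (intro dvd_diff) auto
  then have "p dvd W\<^sup>2" by (simp add: defect_defs algebra_simps)
  then show ?thesis by (rule prime_dvd_power2D[OF p])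
qed

lemma dvd_Z1_iff_dvd_Z2:
  assumes W: "p dvd W"
  shows "p dvd Z1 \<longleftrightarrow> p dvd Z2"
proof -
  have W2: "p ^ 2 dvd W\<^sup>2" using W by (rule power2_dvd_power2)
  show ?thesis
  proof
    assume "p dvd Z1"
    then have "p ^ 2 dvd b1 * Z1\<^sup>2 - N\<^sup>2 * W\<^sup>2 - defect1"
      using dvd_defect1(2) W2 power2_dvd_power2[of p Z1] by (intro dvd_diff dvd_mult) auto
    then have "p ^ 2 dvd b2 * Z2\<^sup>2" by (simp add: defect_defs)
    then show "p dvd Z2" by (rule prime_power2_dvd_mult[OF p sf(2)])
  next
    assume "p dvd Z2"
    then have "p ^ 2 dvd defect1 + (b2 * Z2\<^sup>2 + N\<^sup>2 * W\<^sup>2)"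
      using dvd_defect1(2) W2 power2_dvd_power2[of p Z2] by (intro dvd_add dvd_mult) auto
    then have "p ^ 2 dvd b1 * Z1\<^sup>2" by (simp add: defect_defs)
    then show "p dvd Z1" by (rule prime_power2_dvd_mult[OF p sf(1)])
  qed
qed

lemma dvd_Z1_imp_dvd_W:
  assumes Z1: "p dvd Z1" and Z3: "p dvd b1 * b2 * Z3\<^sup>2"
  shows "p dvd W"
proof -
  have "p dvd defect2 - b1 * Z1\<^sup>2 + b1 * b2 * Z3\<^sup>2"
    using dvd_defect2(1) Z1 Z3 by (intro dvd_add dvd_diff) (auto simp: power2_eq_square)
  then have "p dvd W\<^sup>2" by (simp add: defect_defs)
  then show ?thesis by (rule prime_dvd_power2D[OF p])
qed

text \<open>If \<open>p\<close> divided both \<open>Z1\<close> and \<open>W\<close>, it would divide \<open>Z2\<close>, and \<open>b1 * b2 * Z3\<^sup>2\<close> would be divisible by \<open>p\<^sup>2\<close>.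
  Unless both coefficients are divisible this carries over to \<open>Z3\<close>.\<close>

lemma not_dvd_Z1_and_W:
  assumes b: "\<not> p dvd b1 \<or> \<not> p dvd b2"
  shows "\<not> (p dvd Z1 \<and> p dvd W)"
proof
  assume ZW: "p dvd Z1 \<and> p dvd W"
  have "p ^ 2 dvd b1 * Z1\<^sup>2 + W\<^sup>2 - defect2"
    using dvd_defect2(2) ZW power2_dvd_power2[of p] by (intro dvd_add dvd_diff dvd_mult) auto
  then have d: "p ^ 2 dvd b1 * (b2 * Z3\<^sup>2)" by (simp add: defect_defs algebra_simps)
  have "p dvd Z3"
  proof (cases "p dvd b1")
    case False
    then have "coprime (p ^ 2) b1" using p by (simp add: prime_imp_coprime)
    then have "p ^ 2 dvd b2 * Z3\<^sup>2" using d coprime_dvd_mult_right_iff by blast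
    then show ?thesis by (rule prime_power2_dvd_mult[OF p sf(2)])
  next
    case True
    then have "coprime (p ^ 2) b2" using p b by (simp add: prime_imp_coprime)
    moreover have "p ^ 2 dvd b2 * (b1 * Z3\<^sup>2)" using d by (simp only: mult.left_commute)
    ultimately have "p ^ 2 dvd b1 * Z3\<^sup>2" using coprime_dvd_mult_right_iff by blast
    then show ?thesis by (rule prime_power2_dvd_mult[OF p sf(1)])
  qed
  then show False using primitive ZW dvd_Z1_iff_dvd_Z2 by blast
qed

text \<open>If \<open>p\<close> did not divide \<open>b2\<close>, the first equation, in which \<open>b1\<close> and \<open>W\<close> are divisible, would force \<open>p\<close>
  into \<open>Z2\<close> and hence into \<open>Z1\<close>.\<close>

lemma dvd_coeff1_imp_dvd_coeff2:
  assumes b1: "p dvd b1"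
  shows "p dvd b2"
proof (rule ccontr)
  assume b2: "\<not> p dvd b2"
  have W: "p dvd W" by (rule dvd_coeff1_imp_dvd_W[OF b1])
  have "p dvd b1 * Z1\<^sup>2 - N\<^sup>2 * W\<^sup>2 - defect1"
    using dvd_defect1(1) b1 W by (intro dvd_diff) (auto simp: power2_eq_square)
  then have "p dvd b2 * Z2\<^sup>2" by (simp add: defect_defs)
  then have "p dvd Z2" by (rule prime_dvd_mult_not_left[OF p _ b2])
  then show False using not_dvd_Z1_and_W b2 W dvd_Z1_iff_dvd_Z2 by blast
qed

text \<open>In this case \<open>Z1\<close>, \<open>Z2\<close> and \<open>W\<close> are divisible by \<open>p\<close>, hence \<open>Z3\<close> is not. Dividing the second equation
  by \<open>p\<^sup>2\<close> leaves a congruence that makes \<open>b1 * b2 / p\<^sup>2\<close> a square modulo \<open>p\<close>.\<close>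

lemma dvd_coeffs_solution:
  assumes b1: "p dvd b1" and b2: "p dvd b2"
  obtains u W' where "b1 * b2 = p\<^sup>2 * u" "W = p * W'" "p dvd Z1" "p dvd Z2" "\<not> p dvd Z3" "p dvd u * Z3\<^sup>2 - W'\<^sup>2"
proof -
  have W: "p dvd W" by (rule dvd_coeff1_imp_dvd_W[OF b1])
  then obtain W' where W': "W = p * W'" by (elim dvdE)
  obtain c1 c2 where c: "b1 = p * c1" "b2 = p * c2" using b1 b2 by (elim dvdE)
  have bb: "b1 * b2 = p\<^sup>2 * (c1 * c2)" by (simp add: c power2_eq_square)
  have "p ^ 2 dvd b1 * b2 * Z3\<^sup>2 - W\<^sup>2 + defect2"
    using dvd_defect2(2) power2_dvd_power2[OF W] by (intro dvd_add dvd_diff) (auto simp: bb)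
  then have "p ^ 2 dvd b1 * Z1\<^sup>2" by (simp add: defect_defs)
  then have Z1: "p dvd Z1" by (rule prime_power2_dvd_mult[OF p sf(1)])
  then have Z2: "p dvd Z2" using dvd_Z1_iff_dvd_Z2[OF W] by blast
  then have Z3: "\<not> p dvd Z3" using primitive Z1 W by blast
  have "p ^ 3 dvd b1 * Z1\<^sup>2"
    using mult_dvd_mono[OF b1 power2_dvd_power2[OF Z1]] by (simp add: power3_eq_cube power2_eq_square mult.assoc)
  then have "p ^ 3 dvd b1 * Z1\<^sup>2 - defect2" using dvd_defect2(3) by (intro dvd_diff)
  also have "b1 * Z1\<^sup>2 - defect2 = (b1 * b2) * Z3\<^sup>2 - W\<^sup>2" by (simp add: defect_defs)
  also have "\<dots> = p\<^sup>2 * (c1 * c2 * Z3\<^sup>2 - W'\<^sup>2)"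
    unfolding bb W' by (simp add: power_mult_distrib algebra_simps)
  finally have "p\<^sup>2 * p dvd p\<^sup>2 * (c1 * c2 * Z3\<^sup>2 - W'\<^sup>2)" by (simp add: power3_eq_cube power2_eq_square)
  then have "p dvd c1 * c2 * Z3\<^sup>2 - W'\<^sup>2" using p by auto
  then show ?thesis using that[OF bb W' Z1 Z2 Z3] by blast
qed

text \<open>If \<open>p\<close> divides both coefficients, then in the third equation everything except \<open>b1 * b2 * Z3\<^sup>2\<close> is
  divisible by \<open>p ^ 3\<close>, as \<open>N\<^sup>2 + 1\<close> provides one more factor \<open>p\<close>. Since \<open>Z3\<close> is prime to \<open>p\<close>, one of
  the coefficients would not be squarefree.\<close>

lemma coprime_coeff1:
  assumes N: "p dvd N\<^sup>2 + 1"
  shows "\<not> p dvd b1"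
proof
  assume b1: "p dvd b1"
  then have b2: "p dvd b2" by (rule dvd_coeff1_imp_dvd_coeff2)
  obtain u W' where u: "b1 * b2 = p\<^sup>2 * u" "W = p * W'" "p dvd Z1" "p dvd Z2" "\<not> p dvd Z3" "p dvd u * Z3\<^sup>2 - W'\<^sup>2"
    using dvd_coeffs_solution[OF b1 b2] by blast
  have "p * p\<^sup>2 dvd b2 * Z2\<^sup>2 + (N\<^sup>2 + 1) * W\<^sup>2"
    using mult_dvd_mono[OF b2 power2_dvd_power2[OF u(4)]] mult_dvd_mono[OF N power2_dvd_power2[of p W]] u(2)
    by (intro dvd_add) auto
  then have "p ^ 3 dvd b2 * Z2\<^sup>2 + (N\<^sup>2 + 1) * W\<^sup>2" by (simp add: power3_eq_cube power2_eq_square mult.assoc)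
  then have "p ^ 3 dvd defect3 + (b2 * Z2\<^sup>2 + (N\<^sup>2 + 1) * W\<^sup>2)"
    by (rule dvd_add[OF dvd_defect3(3)])
  also have "defect3 + (b2 * Z2\<^sup>2 + (N\<^sup>2 + 1) * W\<^sup>2) = b1 * b2 * Z3\<^sup>2" by (simp add: defect_defs)
  finally have "p ^ 3 dvd p\<^sup>2 * (u * Z3\<^sup>2)" by (simp add: u(1) mult.assoc)
  then have "p\<^sup>2 * p dvd p\<^sup>2 * (u * Z3\<^sup>2)" by (simp add: power3_eq_cube power2_eq_square)
  then have uZ: "p dvd u * Z3\<^sup>2" using p by auto
  then have "p dvd u" using u(5) prime_dvd_power2D[OF p] p by (auto simp: prime_dvd_mult_iff)
  obtain c1 c2 where c: "b1 = p * c1" "b2 = p * c2" using b1 b2 by (elim dvdE)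
  have "u = c1 * c2" using u(1) p by (auto simp: c power2_eq_square)
  then have "p dvd c1 \<or> p dvd c2" using \<open>p dvd u\<close> p by (simp add: prime_dvd_mult_iff)
  then have "p ^ 2 dvd b1 \<or> p ^ 2 dvd b2" by (auto simp: c power2_eq_square)
  then have "p dvd 1" using sf unfolding squarefree_def by blast
  then show False using p not_prime_unit by blast
qed

lemma dvd_coeff2_imp_dvd_coeff1:
  assumes N: "p dvd N" and b2: "p dvd b2"
  shows "p dvd b1"
proof (rule ccontr)
  assume b1: "\<not> p dvd b1"
  have N2: "p dvd N\<^sup>2" using N by (simp add: power2_eq_square)
  have "p dvd defect1 + (b2 * Z2\<^sup>2 + N\<^sup>2 * W\<^sup>2)"
    using dvd_defect1(1) b2 N2 by (intro dvd_add) auto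
  then have "p dvd b1 * Z1\<^sup>2" by (simp add: defect_defs)
  then have Z1: "p dvd Z1" by (rule prime_dvd_mult_not_left[OF p _ b1])
  moreover have "p dvd W" by (rule dvd_Z1_imp_dvd_W[OF Z1]) (use b2 in auto)
  ultimately show False using not_dvd_Z1_and_W b1 by blast
qed

lemma QuadRes_coeff_product:
  assumes N: "p dvd N" and b: "\<not> p dvd b1" "\<not> p dvd b2"
  shows "QuadRes p (b1 * b2)"
proof -
  have N2: "p dvd N\<^sup>2" using N by (auto simp: power2_eq_square)
  have d: "p dvd defect1 + N\<^sup>2 * W\<^sup>2"
    using dvd_defect1(1) N2 by (intro dvd_add) auto
  show ?thesis
  proof (cases "p dvd Z1")
    case False
    have "p dvd b2 * (defect1 + N\<^sup>2 * W\<^sup>2)" using d by (simp add: defect_defs)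
    then have "p dvd (b1 * b2) * Z1\<^sup>2 - (b2 * Z2)\<^sup>2"
      by (simp add: defect_defs algebra_simps power2_eq_square)
    then show ?thesis using QuadRes_of_square_multiple[OF p False] by blast
  next
    case True
    have "p dvd b1 * Z1\<^sup>2 - defect2"
      using True dvd_defect2(1) by (intro dvd_diff) (auto simp: power2_eq_square)
    then have e: "p dvd (b1 * b2) * Z3\<^sup>2 - W\<^sup>2" by (simp add: defect_defs algebra_simps)
    have "\<not> p dvd Z3"
    proof
      assume "p dvd Z3"
      then have "p dvd W" by (intro dvd_Z1_imp_dvd_W[OF True]) (auto simp: power2_eq_square)
      then show False using not_dvd_Z1_and_W True b by blast
    qed
    then show ?thesis using QuadRes_of_square_multiple[OF p] e by blast
  qed
qed

text \<open>If \<open>p\<close> does not divide \<open>b2\<close>, the third equation says \<open>b1 * Z3\<^sup>2 = Z2\<^sup>2\<close> modulo \<open>p\<close>; if it does, or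
  if \<open>Z3\<close> vanishes, the first one says \<open>b1 * Z1\<^sup>2 = (N * W)\<^sup>2\<close>. The coordinate on the left cannot vanish
  because the solution is primitive.\<close>

lemma QuadRes_coeff1:
  assumes N: "p dvd N\<^sup>2 + 1"
  shows "QuadRes p b1"
proof -
  have b1: "\<not> p dvd b1" by (rule coprime_coeff1[OF N])
  have d: "p dvd b1 * Z3\<^sup>2 - Z2\<^sup>2" if "\<not> p dvd b2"
  proof -
    have "p dvd defect3 + (N\<^sup>2 + 1) * W\<^sup>2" using dvd_defect3(1) N by (intro dvd_add) auto
    then have "p dvd b2 * (b1 * Z3\<^sup>2 - Z2\<^sup>2)" by (simp add: defect_defs algebra_simps)
    then show ?thesis using p that by (simp add: prime_dvd_mult_iff)
  qed
  show ?thesis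
  proof (cases "p dvd b2 \<or> p dvd Z3")
    case False
    then show ?thesis using QuadRes_of_square_multiple[OF p] d by blast
  next
    case True
    have "p dvd b2 * Z2\<^sup>2"
    proof (cases "p dvd b2")
      case False
      then have "p dvd b1 * Z3\<^sup>2 - (b1 * Z3\<^sup>2 - Z2\<^sup>2)"
        using True by (intro dvd_diff d) (auto simp: power2_eq_square)
      then show ?thesis by simp
    qed simp
    then have "p dvd defect1 + b2 * Z2\<^sup>2" using dvd_defect1(1) by (intro dvd_add)
    then have e: "p dvd b1 * Z1\<^sup>2 - (N * W)\<^sup>2" by (simp add: defect_defs power_mult_distrib)
    have "\<not> p dvd Z1"
    proof
      assume Z1: "p dvd Z1"
      then have "p dvd W" using True by (intro dvd_Z1_imp_dvd_W) (auto simp: power2_eq_square)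
      then show False using not_dvd_Z1_and_W b1 Z1 by blast
    qed
    then show ?thesis using QuadRes_of_square_multiple[OF p] e by blast
  qed
qed

end

section \<open>Primes q with 2q = n^2 + 1\<close>

definition pm1_mod_8 :: "nat \<Rightarrow> bool" where
  "pm1_mod_8 b \<longleftrightarrow> b mod 8 = 1 \<or> b mod 8 = 7"

lemma pm1_mod_8_mult:
  assumes "odd a" "odd b"
  shows "pm1_mod_8 (a * b) \<longleftrightarrow> (pm1_mod_8 a \<longleftrightarrow> pm1_mod_8 b)"
proof -
  define x y where "x = a mod 8" and "y = b mod 8"
  have "x \<in> {1, 3, 5, 7}" "y \<in> {1, 3, 5, 7}" unfolding x_def y_def using assms by (simp, presburger)+
  moreover have "(a * b) mod 8 = (x * y) mod 8" unfolding x_def y_def by (simp add: mod_mult_eq)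
  ultimately show ?thesis unfolding pm1_mod_8_def x_def[symmetric] y_def[symmetric]
    by (elim insertE emptyE) simp_all
qed

locale half_square_prime =
  fixes n q :: nat
  assumes n_squarefree: "squarefree n" and n_odd: "odd n"
    and q_prime: "prime q" and n_q: "n\<^sup>2 + 1 = 2 * q"
begin

lemma n_pos: "n > 0" using n_odd by (cases n) auto

lemma n_ge_3: "n \<ge> 3"
proof (rule ccontr)
  assume "\<not> n \<ge> 3"
  then have "n = 1" using n_odd by presburger
  then have "q = 1" using n_q by simp
  then show False using q_prime by simp
qed

lemma n_q_int: "(int n)\<^sup>2 + 1 = 2 * int q"
  using n_q by (metis of_nat_1 of_nat_add of_nat_mult of_nat_numeral of_nat_power)

lemma q_gt_2: "q > 2"
proof -
  have "3 * 3 \<le> n * n" using n_ge_3 by (intro mult_mono) auto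
  then show ?thesis using n_q by (simp add: power2_eq_square)
qed

text \<open>The square of an odd number is 1 modulo 8, so \<open>2 * q\<close> is 2 modulo 8. If the number is 1 or 7
  modulo 8, its square is even 1 modulo 16, which gives \<open>q_mod_8\<close>.\<close>

lemma q_mod_4: "q mod 4 = 1"
proof -
  obtain k where k: "n = 2 * k + 1" using n_odd by (elim oddE)
  have "even (k * (k + 1))" by simp
  then obtain j where "k * (k + 1) = 2 * j" by (elim evenE)
  then have "n\<^sup>2 + 1 = 2 * (4 * j + 1)" by (simp add: k power2_eq_square algebra_simps)
  then have "q = 4 * j + 1" using n_q by simp
  then show ?thesis by simp
qed

lemma q_mod_8:
  assumes "pm1_mod_8 n"
  shows "q mod 8 = 1"
proof -
  obtain k where k: "n = 8 * k + 1 \<or> n = 8 * k + 7"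
    using assms mult_div_mod_eq[of 8 n] unfolding pm1_mod_8_def by metis
  then have "n\<^sup>2 + 1 = 2 * (8 * (4 * k\<^sup>2 + k) + 1) \<or> n\<^sup>2 + 1 = 2 * (8 * (4 * k\<^sup>2 + 7 * k + 3) + 1)"
    by (auto simp: power2_eq_square algebra_simps)
  then obtain j where "n\<^sup>2 + 1 = 2 * (8 * j + 1)" by blast
  then have "q = 8 * j + 1" using n_q by simp
  then show ?thesis by simp
qed

lemma q_not_dvd_n: "\<not> q dvd n"
proof
  assume "q dvd n"
  then have "q dvd n\<^sup>2" by (simp add: power2_eq_square)
  moreover have "q dvd n\<^sup>2 + 1" using n_q by simp
  ultimately have "q dvd 1" using dvd_add_right_iff by blast
  then show False using q_gt_2 by simp
qed

lemma prime_dvd_n: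
  assumes "prime p" "p dvd n"
  shows "p > 2" "p \<noteq> q" "\<not> int p dvd 2" "\<not> int p dvd int q"
proof -
  have "p \<noteq> 2" using assms n_odd by auto
  then show p2: "p > 2" using prime_ge_2_nat[OF assms(1)] by simp
  show pq: "p \<noteq> q" using assms q_not_dvd_n by auto
  show "\<not> int p dvd 2" by (rule odd_prime_not_dvd_2[OF p2])
  show "\<not> int p dvd int q" using pq assms q_prime primes_dvd_imp_eq by auto
qed

lemma Legendre_2q:
  assumes "prime p" "p dvd n"
  shows "Legendre (2 * int q) (int p) = 1"
proof -
  have "int p dvd (int n)\<^sup>2" using assms by (simp add: power2_eq_square)
  then have "[2 * int q = 1] (mod int p)"
    unfolding n_q_int[symmetric] by (simp add: cong_iff_dvd_diff)
  then have "Legendre (2 * int q) (int p) = Legendre 1 (int p)" by (rule Legendre_cong)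
  also have "\<dots> = 1"
    using Legendre_power2[of "int p" 1] assms prime_gt_1_nat[OF assms(1)] by simp
  finally show ?thesis .
qed

lemma Legendre_q_eq_2:
  assumes p: "prime p" "p dvd n"
  shows "Legendre (int q) (int p) = Legendre 2 (int p)"
proof -
  have "Legendre 2 (int p) * Legendre (int q) (int p) = 1"
    using Legendre_2q[OF p] Legendre_mult[OF p(1) prime_dvd_n(1)[OF p], of 2 "int q"] by simp
  then show ?thesis
    using Legendre_cases[of 2 "int p"] Legendre_cases[of "int q" "int p"] by auto
qed

text \<open>Reciprocity has no sign because \<open>q\<close> is 1 modulo 4, and \<open>q\<close> and 2 have the same character modulo \<open>p\<close>
  because \<open>2 * q\<close> is 1 there.\<close>

lemma Legendre_prime_q:
  assumes p: "prime p" "p dvd n"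
  shows "Legendre (int p) (int q) = Legendre 2 (int p)"
proof -
  have "even ((q - 1) div 2)" using q_mod_4 by presburger
  then have "Legendre (int p) (int q) * Legendre (int q) (int p) = 1"
    using Quadratic_Reciprocity[OF p(1) prime_dvd_n(1)[OF p] q_prime q_gt_2 prime_dvd_n(2)[OF p]] by simp
  then have "Legendre (int p) (int q) = Legendre (int q) (int p)"
    using Legendre_cases[of "int p" "int q"] Legendre_cases[of "int q" "int p"] by auto
  then show ?thesis using Legendre_q_eq_2[OF p] by simp
qed

lemma divisor_induct [consumes 1, case_names one mult]:
  assumes "b dvd n" and one: "P 1"
    and mult: "\<And>p c. prime p \<Longrightarrow> p dvd n \<Longrightarrow> c dvd n \<Longrightarrow> P c \<Longrightarrow> P (p * c)"
  shows "P b"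
  using assms(1)
proof (induction b rule: less_induct)
  case (less b)
  show ?case
  proof (cases "b = 1")
    case True
    then show ?thesis using one by simp
  next
    case False
    then obtain p where p: "prime p" "p dvd b" using prime_factor_nat by blast
    then obtain c where c: "b = p * c" by (elim dvdE)
    have pn: "p dvd n" and cn: "c dvd n" using p c less.prems dvd_trans by auto
    have "c \<noteq> 0" using cn n_pos by auto
    then have "c < b" using c p(1) prime_gt_1_nat by auto
    then show ?thesis using mult[OF p(1) pn cn less.IH[OF _ cn]] c by simp
  qed
qed

lemma odd_divisor: "b dvd n \<Longrightarrow> odd b"
  using n_odd dvd_trans by blast

lemma Legendre_divisor_q:
  assumes "b dvd n"
  shows "Legendre (int b) (int q) = (if pm1_mod_8 b then 1 else -1)"
  using assms
proof (induction rule: divisor_induct)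
  case one
  then show ?case
    using Legendre_power2[of "int q" 1] q_prime q_gt_2 by (simp add: pm1_mod_8_def)
next
  case (mult p c)
  have "pm1_mod_8 (p * c) \<longleftrightarrow> (pm1_mod_8 p \<longleftrightarrow> pm1_mod_8 c)"
    using mult by (intro pm1_mod_8_mult odd_divisor)
  moreover have "Legendre (int p) (int q) = (if pm1_mod_8 p then 1 else -1)"
    using Legendre_prime_q[OF mult(1,2)] Legendre_two[OF mult(1) prime_dvd_n(1)[OF mult(1,2)]]
    by (simp add: pm1_mod_8_def)
  ultimately show ?case
    using mult(4) Legendre_mult[OF q_prime q_gt_2, of "int p" "int c"] by simp
qed

lemma Legendre_minus_1_q: "Legendre (-1) (int q) = 1"
proof -
  have "[(int n)\<^sup>2 = -1] (mod int q)"
    using n_q_int by (simp add: cong_iff_dvd_diff)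
  then have "Legendre (-1) (int q) = Legendre ((int n)\<^sup>2) (int q)" using Legendre_cong by metis
  then show ?thesis using Legendre_power2[of "int q" "int n"] q_prime q_not_dvd_n by simp
qed

lemma Legendre_signed_divisor_q:
  assumes "b dvd n" "e \<in> {-1, 1}"
  shows "Legendre (e * int b) (int q) = (if pm1_mod_8 b then 1 else -1)"
proof -
  have "Legendre e (int q) = 1"
    using assms(2) Legendre_minus_1_q Legendre_power2[of "int q" 1] q_prime q_gt_2 by auto
  then show ?thesis
    using Legendre_divisor_q[OF assms(1)] Legendre_mult[OF q_prime q_gt_2, of e "int b"] by simp
qed

lemma divisors_2q: "c dvd 2 * q \<Longrightarrow> c \<in> {1, 2, q, 2 * q}"
proof -
  assume "c dvd 2 * q"
  then obtain a b where ab: "c = a * b" "a dvd 2" "b dvd q" using division_decomp by blast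
  have "a = 1 \<or> a = 2" using ab(2) two_is_prime_nat prime_nat_iff by blast
  moreover have "b = 1 \<or> b = q" using ab(3) q_prime prime_nat_iff by blast
  ultimately show ?thesis using ab(1) by auto
qed

lemma pm1_mod_8_n:
  assumes "\<And>p. prime p \<Longrightarrow> p dvd n \<Longrightarrow> pm1_mod_8 p"
  shows "pm1_mod_8 n"
proof -
  have "pm1_mod_8 b" if "b dvd n" for b
    using that
  proof (induction rule: divisor_induct)
    case one
    show ?case by (simp add: pm1_mod_8_def)
  next
    case (mult p c)
    then show ?case using assms[of p] pm1_mod_8_mult[of p c] odd_divisor by blast
  qed
  then show ?thesis by simp
qed

text \<open>The representatives of the Selmer group: \<open>(b, b)\<close> is a diagonal generator, while the sign \<open>e\<close> and the
  values 1 and \<open>2 * q\<close> of \<open>c\<close> account for the 2-torsion. As \<open>2 * 2 * q\<close> and \<open>q\<close> have the same square class, the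
  generator \<open>(1, 2)\<close> adds the values 2 and \<open>q\<close>.\<close>

definition selmer_shape :: "int \<Rightarrow> int \<Rightarrow> bool" where
  "selmer_shape b1 b2 \<longleftrightarrow> (\<exists>e b c. e \<in> {-1, 1} \<and> b dvd n \<and> pm1_mod_8 b \<and> c \<in> {1, 2, q, 2 * q} \<and>
     (c \<in> {2, q} \<longrightarrow> (\<forall>p. prime p \<longrightarrow> p dvd n \<longrightarrow> pm1_mod_8 p)) \<and>
     b1 = e * int b \<and> b2 = e * int b * int c)"

end

section \<open>Everywhere soluble pairs have the expected shape\<close>

lemma class_ring_add_pow:
  fixes x :: real
  shows "[(k::int)] \<cdot>\<^bsub>class_ring\<^esub> x = of_int k * x"
proof -
  have nat: "[(j::nat)] \<cdot>\<^bsub>class_ring\<^esub> x = of_nat j * x" for j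
  proof (induction j)
    case 0
    show ?case by (simp add: add_pow_def)
  next
    case (Suc j)
    then show ?case by (simp add: add_pow_def algebra_simps)
  qed
  show ?thesis
  proof (cases "k \<ge> 0")
    case True
    then show ?thesis by (simp add: add_pow_int_ge nat)
  next
    case False
    then show ?thesis by (simp add: add_pow_int_lt nat class_ring_simps)
  qed
qed

lemma descent_soluble_real_iff:
  "descent_soluble (class_ring :: real ring) m n b1 b2 \<longleftrightarrow>
    (\<exists>z1 z2 z3 :: real. of_int b1 * z1\<^sup>2 - of_int b2 * z2\<^sup>2 = 2 ^ m * (of_nat n)\<^sup>2 \<and>
       of_int b1 * z1\<^sup>2 - of_int (b1 * b2) * z3\<^sup>2 = - (2 ^ m))"
  unfolding descent_soluble_def class_ring_add_pow by (simp add: class_ring_simps)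

lemma descent_soluble_real_imp_pos:
  assumes sol: "descent_soluble (class_ring :: real ring) m n b1 b2" and n: "n > 0" and b: "b1 \<noteq> 0" "b2 \<noteq> 0"
  shows "b1 * b2 > 0"
proof (rule ccontr)
  assume "\<not> b1 * b2 > 0"
  then have neg: "b1 < 0 \<and> b2 > 0 \<or> b1 > 0 \<and> b2 < 0"
    using b by (auto simp: zero_less_mult_iff not_less)
  obtain z1 z2 z3 :: real where z: "of_int b1 * z1\<^sup>2 - of_int b2 * z2\<^sup>2 = 2 ^ m * (of_nat n)\<^sup>2"
       "of_int b1 * z1\<^sup>2 - of_int (b1 * b2) * z3\<^sup>2 = - (2 ^ m)"
    using sol unfolding descent_soluble_real_iff by blast
  have m: "(2::real) ^ m > 0" "(2::real) ^ m * (of_nat n)\<^sup>2 > 0" using n by auto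
  from neg show False
  proof (elim disjE conjE)
    assume "b1 < 0" "b2 > 0"
    then have "of_int b1 * z1\<^sup>2 \<le> 0" "of_int b2 * z2\<^sup>2 \<ge> 0" by (auto simp: mult_le_0_iff)
    then show False using z(1) m by linarith
  next
    assume "b1 > 0" "b2 < 0"
    then have "of_int b1 * z1\<^sup>2 \<ge> 0" "of_int (b1 * b2) * z3\<^sup>2 \<le> 0" by (auto simp: mult_le_0_iff)
    then show False using z(2) m by linarith
  qed
qed

text \<open>The points with \<open>x = 2 ^ m * n\<^sup>2\<close> and \<open>x = 0\<close> serve for positive and negative coefficients.\<close>

lemma descent_soluble_realI:
  assumes b: "b1 * b2 > 0"
  shows "descent_soluble (class_ring :: real ring) m n b1 b2"
proof (cases "b1 > 0")
  case True
  define z1 z3 where "z1 = sqrt (2 ^ m * (of_nat n)\<^sup>2 / of_int b1)"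
    and "z3 = sqrt ((2 ^ m * (of_nat n)\<^sup>2 + 2 ^ m) / of_int (b1 * b2))"
  have "z1\<^sup>2 = 2 ^ m * (of_nat n)\<^sup>2 / of_int b1"
    unfolding z1_def using True by (intro real_sqrt_pow2) auto
  moreover have "(of_int (b1 * b2) :: real) > 0" using b by (simp only: of_int_0_less_iff)
  then have "z3\<^sup>2 = (2 ^ m * (of_nat n)\<^sup>2 + 2 ^ m) / of_int (b1 * b2)"
    unfolding z3_def by (intro real_sqrt_pow2) auto
  ultimately show ?thesis
    unfolding descent_soluble_real_iff using b True
    by (intro exI[of _ z1] exI[of _ 0] exI[of _ z3]) (auto simp: zero_less_mult_iff)
next
  case False
  then have b2: "b2 < 0" using b by (simp add: zero_less_mult_iff)
  define z2 z3 where "z2 = sqrt (2 ^ m * (of_nat n)\<^sup>2 / (- of_int b2))"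
    and "z3 = sqrt (2 ^ m / of_int (b1 * b2))"
  have "z2\<^sup>2 = 2 ^ m * (of_nat n)\<^sup>2 / (- of_int b2)"
    unfolding z2_def using b2 by (intro real_sqrt_pow2 divide_nonneg_nonneg) auto
  moreover have "(of_int (b1 * b2) :: real) > 0" using b by (simp only: of_int_0_less_iff)
  then have "z3\<^sup>2 = 2 ^ m / of_int (b1 * b2)"
    unfolding z3_def by (intro real_sqrt_pow2) auto
  ultimately show ?thesis
    unfolding descent_soluble_real_iff using b b2
    by (intro exI[of _ 0] exI[of _ z2] exI[of _ z3]) (auto simp: zero_less_mult_iff)
qed

lemma squarefree_dvdI:
  fixes a b :: nat
  assumes sf: "squarefree a" and b: "b \<noteq> 0" and p: "\<And>p. prime p \<Longrightarrow> p dvd a \<Longrightarrow> p dvd b"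
  shows "a dvd b"
proof -
  define g where "g = gcd a b"
  obtain h where h: "a = g * h" unfolding g_def by (meson dvdE gcd_dvd1)
  have "h = 1"
  proof (rule ccontr)
    assume "h \<noteq> 1"
    then obtain r where r: "prime r" "r dvd h" using prime_factor_nat by blast
    then have "r dvd a" using h by simp
    then have "r dvd g" unfolding g_def using p[OF r(1)] by simp
    then have "r ^ 2 dvd a" unfolding h power2_eq_square using r(2) by (intro mult_dvd_mono)
    then have "r dvd 1" using sf unfolding squarefree_def by blast
    then show False using r(1) by simp
  qed
  then show ?thesis using h g_def by (metis gcd_dvd2 mult.right_neutral)
qed

lemma dvd_nat_abs_iff: "p dvd nat \<bar>x\<bar> \<longleftrightarrow> int p dvd (x :: int)"
  by (metis dvd_abs_iff int_dvd_int_iff int_nat_eq abs_ge_zero nat_0_le)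

lemma squarefree_nat_abs: "squarefree (b::int) \<Longrightarrow> squarefree (nat \<bar>b\<bar>)"
  unfolding squarefree_def
proof (intro allI impI)
  fix x :: nat assume "\<forall>x. x\<^sup>2 dvd b \<longrightarrow> x dvd 1" "x\<^sup>2 dvd nat \<bar>b\<bar>"
  then have "(int x)\<^sup>2 dvd b" by (metis int_dvd_int_iff of_nat_power dvd_abs_iff int_nat_eq abs_ge_zero nat_0_le)
  then have "int x dvd 1" using \<open>\<forall>x. x\<^sup>2 dvd b \<longrightarrow> x dvd 1\<close> by blast
  then show "x dvd 1" by simp
qed

context half_square_prime
begin

lemma everywhere_soluble_imp_shape:
  assumes sf: "squarefree b1" "squarefree b2" and m: "even m"
    and d: "nat \<bar>b1\<bar> dvd 2 * n * q" "nat \<bar>b2\<bar> dvd 2 * n * q"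
    and sol: "everywhere_soluble m n b1 b2"
  shows "selmer_shape b1 b2"
proof -
  have nz: "b1 \<noteq> 0" "b2 \<noteq> 0" using sf by auto
  have prim: "\<exists>Z1 Z2 Z3 W. primitive_solution (int p) b1 b2 (int n) Z1 Z2 Z3 W" if p: "prime p" for p
  proof -
    have "descent_soluble (padic_field p) m n b1 b2"
      using sol p unfolding everywhere_soluble_def by blast
    from descent_soluble_padic_imp_primitive[OF p m this, of 3]
    obtain Z1 Z2 Z3 W where "\<not> (int p dvd Z1 \<and> int p dvd Z2 \<and> int p dvd Z3 \<and> int p dvd W)"
      "int p ^ 3 dvd b1 * Z1\<^sup>2 - b2 * Z2\<^sup>2 - (int n)\<^sup>2 * W\<^sup>2"
      "int p ^ 3 dvd b1 * Z1\<^sup>2 - b1 * b2 * Z3\<^sup>2 + W\<^sup>2" by metis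
    then have "primitive_solution (int p) b1 b2 (int n) Z1 Z2 Z3 W"
      using p sf by unfold_locales auto
    then show ?thesis by blast
  qed
  have N1: "int p dvd (int n)\<^sup>2 + 1 \<Longrightarrow> prime p \<Longrightarrow> \<not> int p dvd b1" for p
    using prim primitive_solution.coprime_coeff1 by blast
  \<comment> \<open>Both 2 and \<open>q\<close> divide \<open>n\<^sup>2 + 1\<close>.\<close>
  have "\<not> 2 dvd nat \<bar>b1\<bar>" "\<not> q dvd nat \<bar>b1\<bar>"
    unfolding dvd_nat_abs_iff using N1[of 2] N1[of q] q_prime n_q_int by auto
  define b where "b = nat \<bar>b1\<bar>"
  define B where "B = nat \<bar>b2\<bar>"
  have bB0: "b \<noteq> 0" "B \<noteq> 0" using nz by (auto simp: b_def B_def)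
  have sfb: "squarefree b" "squarefree B" using sf squarefree_nat_abs by (auto simp: b_def B_def)
  have cop: "coprime b (2 * q)"
    using \<open>\<not> 2 dvd nat \<bar>b1\<bar>\<close> \<open>\<not> q dvd nat \<bar>b1\<bar>\<close> q_prime two_is_prime_nat
    unfolding b_def[symmetric] by (meson coprime_commute coprime_mult_right_iff prime_imp_coprime)
  have "b dvd n * (2 * q)" using d(1) by (simp add: b_def mult_ac)
  then have bn: "b dvd n" using cop coprime_dvd_mult_left_iff by blast
  have pn: "int p dvd b1 \<longleftrightarrow> int p dvd b2" if p: "prime p" "p dvd n" for p
    using prim[OF p(1)] p(2) primitive_solution.dvd_coeff1_imp_dvd_coeff2 primitive_solution.dvd_coeff2_imp_dvd_coeff1
    by (meson int_dvd_int_iff)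
  have "b dvd B"
  proof (rule squarefree_dvdI[OF sfb(1) bB0(2)])
    fix p assume p: "prime p" "p dvd b"
    then have "p dvd n" using bn dvd_trans by blast
    then show "p dvd B" using pn[OF p(1)] p(2) by (simp add: b_def B_def dvd_nat_abs_iff)
  qed
  then obtain c where c: "B = b * c" by (elim dvdE)
  have "coprime c n"
  proof (rule ccontr)
    assume "\<not> coprime c n"
    then have "gcd c n \<noteq> 1" unfolding coprime_iff_gcd_eq_1 .
    then obtain p where "prime p" "p dvd gcd c n" using prime_factor_nat by blast
    then have p: "prime p" "p dvd c" "p dvd n" by simp_all
    then have "p dvd B" using c by simp
    then have "p dvd b" using pn[OF p(1,3)] by (simp add: b_def B_def dvd_nat_abs_iff)
    then have "p ^ 2 dvd B" unfolding c power2_eq_square using p(2) by (intro mult_dvd_mono)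
    then have "p dvd 1" using sfb(2) unfolding squarefree_def by blast
    then show False using p(1) by simp
  qed
  moreover have "c dvd n * (2 * q)" using d(2) c by (simp add: B_def[symmetric] mult_ac) (metis dvd_mult_left mult.commute)
  ultimately have c2q: "c \<in> {1, 2, q, 2 * q}" using divisors_2q coprime_dvd_mult_right_iff by blast
  define e where "e = sgn b1"
  have e: "e \<in> {-1, 1}" using nz by (auto simp: e_def sgn_if)
  have b1: "b1 = e * int b" by (simp add: e_def b_def sgn_mult_abs)
  have "b1 * b2 > 0"
    using sol descent_soluble_real_imp_pos n_pos nz unfolding everywhere_soluble_def by blast
  then have "sgn b2 = e" unfolding e_def by (auto simp: zero_less_mult_iff)
  then have b2: "b2 = e * int b * int c"
    using sgn_mult_abs[of b2] c unfolding B_def by (metis abs_ge_zero int_nat_eq mult.assoc of_nat_mult)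
  have bb: "b1 * b2 = (int b)\<^sup>2 * int c" using e by (auto simp: b1 b2 power2_eq_square)
  have "QuadRes (int q) b1"
    using prim[OF q_prime] primitive_solution.QuadRes_coeff1 n_q_int by (metis dvd_triv_right)
  moreover have "\<not> int q dvd b1" using \<open>\<not> q dvd nat \<bar>b1\<bar>\<close> dvd_nat_abs_iff by simp
  ultimately have "Legendre b1 (int q) = 1" by (simp add: Legendre_eq_1_iff)
  then have pm: "pm1_mod_8 b"
    using Legendre_signed_divisor_q[OF bn e] b1 by (auto split: if_splits)
  have Lc: "Legendre (int c) (int p) = 1" if pf: "prime p" "p dvd n" for p
  proof -
    have pr: "prime (int p)" using pf by simp
    note p2 = prime_dvd_n[OF pf]
    have pc: "\<not> int p dvd int c"
    proof
      assume "int p dvd int c"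
      then have "p dvd 1" using coprime_common_divisor[OF \<open>coprime c n\<close>] pf(2) by simp
      then show False using pf(1) by simp
    qed
    obtain Z1 Z2 Z3 W where "primitive_solution (int p) b1 b2 (int n) Z1 Z2 Z3 W" using prim[OF pf(1)] by blast
    then interpret primitive_solution "int p" b1 b2 "int n" Z1 Z2 Z3 W .
    \<comment> \<open>The witness \<open>a\<close> is \<open>b\<close> freed from its factor \<open>p\<close>, if there is one.\<close>
    have "\<exists>a. \<not> int p dvd a \<and> QuadRes (int p) (a\<^sup>2 * int c)"
    proof (cases "int p dvd b1")
      case False
      then have "QuadRes (int p) (b1 * b2)" using QuadRes_coeff_product pn[OF pf] pf(2) by simp
      moreover have "\<not> int p dvd int b" using False e by (auto simp: b1)
      ultimately show ?thesis using bb by (intro exI[of _ "int b"]) simp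
    next
      case True
      then obtain u W' where u: "b1 * b2 = (int p)\<^sup>2 * u" "\<not> int p dvd Z3" "int p dvd u * Z3\<^sup>2 - W'\<^sup>2"
        using dvd_coeffs_solution pn[OF pf] by metis
      have "p dvd b" using True by (simp add: b_def dvd_nat_abs_iff)
      then obtain b' where b': "b = p * b'" by (elim dvdE)
      have "(int p)\<^sup>2 * u = (int p)\<^sup>2 * ((int b')\<^sup>2 * int c)"
        unfolding u(1)[symmetric] bb by (simp only: b' of_nat_mult power_mult_distrib mult_ac)
      then have "u = (int b')\<^sup>2 * int c" using pf(1) by auto
      moreover have "\<not> p dvd b'"
      proof
        assume "p dvd b'"
        then have "p ^ 2 dvd b" unfolding b' power2_eq_square by (intro mult_dvd_mono) auto
        then have "p dvd 1" using sfb(1) unfolding squarefree_def by blast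
        then show False using pf(1) by simp
      qed
      ultimately show ?thesis using QuadRes_of_square_multiple[OF pr u(2,3)] by (intro exI[of _ "int b'"]) simp
    qed
    then obtain a where a: "\<not> int p dvd a" "QuadRes (int p) (a\<^sup>2 * int c)" by blast
    then have "\<not> int p dvd a\<^sup>2 * int c" using pc pr prime_dvd_power[OF pr] by (auto simp: prime_dvd_mult_iff)
    then have "Legendre (a\<^sup>2 * int c) (int p) = 1" using a(2) by (simp add: Legendre_eq_1_iff)
    then show ?thesis
      using Legendre_mult[OF pf(1) p2(1), of "a\<^sup>2" "int c"] Legendre_power2[OF a(1) pr] by simp
  qed
  have "pm1_mod_8 p" if cq: "c \<in> {2, q}" and p: "prime p" "p dvd n" for p
  proof -
    have "Legendre 2 (int p) = 1" using Lc[OF p] cq Legendre_q_eq_2[OF p] by auto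
    then show ?thesis
      using Legendre_two[OF p(1) prime_dvd_n(1)[OF p]] by (simp add: pm1_mod_8_def split: if_splits)
  qed
  then show ?thesis
    unfolding selmer_shape_def using e bn pm c2q b1 b2 by blast
qed

end

section \<open>Pairs of the expected shape are everywhere soluble\<close>

lemma padic_square_Legendre:
  assumes "prime l" "l > 2" "Legendre u (int l) = 1"
  shows "padic_square l (of_int u)"
  using assms padic_square_odd[of l u] by (simp add: Legendre_eq_1_iff)

lemma padic_square_mult_power2:
  assumes "prime l" "padic_square l u"
  shows "padic_square l (u * c\<^sup>2)"
  by (rule padic_square_mult[OF assms padic_square_power2])

lemma padic_square_zero: "padic_square l 0"
  using padic_square_power2[of l 0] by simp

lemma padic_square_cong_power2:
  assumes l: "prime l" "l > 2" and a: "\<not> int l dvd a"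
  shows "padic_square l (of_int (a\<^sup>2 + int l * t))"
proof (rule padic_square_Legendre[OF l])
  have "Legendre (a\<^sup>2 + int l * t) (int l) = Legendre (a\<^sup>2) (int l)"
    by (rule Legendre_cong) (simp add: cong_iff_dvd_diff)
  then show "Legendre (a\<^sup>2 + int l * t) (int l) = 1"
    using Legendre_power2[OF a] l by simp
qed

text \<open>Near infinity on the curve \<open>x\<close>, \<open>x - n\<^sup>2\<close> and \<open>x + 1\<close> are all squares; \<open>x = 1 / l\<^sup>2\<close> is close enough.\<close>

lemma descent_soluble_both_squares:
  assumes l: "prime l" "l > 2" and m: "even m" and L: "Legendre b1 (int l) = 1" "Legendre b2 (int l) = 1"
  shows "descent_soluble (padic_field l) m n b1 b2"
proof (rule descent_soluble_padicI[OF l(1) m, where x = "(1 / of_nat l)\<^sup>2"])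
  show "b1 \<noteq> 0" "b2 \<noteq> 0" using L by (auto simp: Legendre_def)
  have l0: "(of_nat l :: rat) \<noteq> 0" using l by simp
  have nd: "\<not> int l dvd 1" using l by simp
  have s: "padic_square l (of_int b1)" "padic_square l (of_int b2)"
    by (rule padic_square_Legendre[OF l]; fact L)+
  show "padic_square l (of_int b1 * (1 / of_nat l)\<^sup>2)"
    by (rule padic_square_mult_power2[OF l(1) s(1)])
  have "padic_square l (of_int (1\<^sup>2 + int l * (- int l * (int n)\<^sup>2)))"
    by (rule padic_square_cong_power2[OF l nd])
  from padic_square_mult_power2[OF l(1) padic_square_mult[OF l(1) s(2) this], of "1 / of_nat l"]
  show "padic_square l (of_int b2 * ((1 / of_nat l)\<^sup>2 - (of_nat n)\<^sup>2))"
    using l0 by (simp add: field_simps power2_eq_square)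
  have "padic_square l (of_int (1\<^sup>2 + int l * int l))"
    by (rule padic_square_cong_power2[OF l nd])
  from padic_square_mult_power2[OF l(1) padic_square_mult[OF l(1) padic_square_mult[OF l(1) s] this], of "1 / of_nat l"]
  show "padic_square l (of_int (b1 * b2) * ((1 / of_nat l)\<^sup>2 + 1))"
    using l0 by (simp add: field_simps power2_eq_square)
qed

text \<open>At most one of \<open>x\<close>, \<open>x - n\<^sup>2\<close> and \<open>x + 1\<close> vanishes modulo \<open>l\<close>, since \<open>n\<^sup>2\<close>, 1 and \<open>n\<^sup>2 + 1\<close> are units. If one
  does, \<open>x\<close> is moved within its residue class until that value is exactly 0; the other two are units
  in the right square class, so the roots lift.\<close>

lemma descent_soluble_good_prime:
  assumes l: "prime l" "l > 2" and m: "even m"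
    and good: "\<not> int l dvd int n" "\<not> int l dvd (int n)\<^sup>2 + 1" "\<not> int l dvd b1" "\<not> int l dvd b2"
  shows "descent_soluble (padic_field l) m n b1 b2"
proof -
  let ?L = "\<lambda>a. Legendre a (int l)"
  define e1 e2 where "e1 = ?L b1" and "e2 = ?L b2"
  have pr: "prime (int l)" using l by simp
  have e: "e1 \<in> {-1, 1}" "e2 \<in> {-1, 1}"
    using Legendre_cases[of b1 "int l"] Legendre_cases[of b2 "int l"] good(3,4)
    by (auto simp: e1_def e2_def Legendre_eq_0_iff)
  show ?thesis
  proof (cases "e1 = 1 \<and> e2 = 1")
    case True
    then show ?thesis using descent_soluble_both_squares[OF l m] by (simp add: e1_def e2_def)
  next
    case False
    define a where "a = (int n)\<^sup>2"
    have a: "\<not> int l dvd a" "\<not> int l dvd a + 1"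
      using good(1,2) prime_dvd_power[OF pr] unfolding a_def by blast+
    obtain x where x: "?L x \<in> {0, e1}" "?L (x - a) \<in> {0, e2}" "?L (x + 1) \<in> {0, e1 * e2}"
      using exists_residue_with_characters[OF l a e False] by blast
    define y where "y = (if int l dvd x then 0 else if int l dvd x - a then a else if int l dvd x + 1 then -1 else x)"
    have yx: "[y = x] (mod int l)"
      unfolding y_def by (auto simp: cong_iff_dvd_diff dvd_diff_commute add.commute)
    have c: "?L y = ?L x" "?L (y - a) = ?L (x - a)" "?L (y + 1) = ?L (x + 1)"
      by (rule Legendre_cong; intro cong_add cong_diff cong_refl yx)+
    have not_both: "\<not> (int l dvd x \<and> int l dvd x - a)" "\<not> (int l dvd x \<and> int l dvd x + 1)"
       "\<not> (int l dvd x - a \<and> int l dvd x + 1)"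
    proof -
      show "\<not> (int l dvd x \<and> int l dvd x - a)" using a(1) dvd_diff[of "int l" x "x - a"] by auto
      show "\<not> (int l dvd x \<and> int l dvd x + 1)" using l dvd_diff[of "int l" "x + 1" x] by auto
      show "\<not> (int l dvd x - a \<and> int l dvd x + 1)" using a(2) dvd_diff[of "int l" "x + 1" "x - a"] by (auto simp: add.commute)
    qed
    have y: "y = 0 \<or> ?L y = e1" "y - a = 0 \<or> ?L (y - a) = e2" "y + 1 = 0 \<or> ?L (y + 1) = e1 * e2"
      using x not_both unfolding c by (auto simp: Legendre_eq_0_iff y_def)
    have sq: "padic_square l (of_int (b * z))" if "z = 0 \<or> ?L z = ?L b" "?L b \<in> {-1, 1}" for b z
    proof (cases "z = 0")
      case True
      then show ?thesis by (simp add: padic_square_zero)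
    next
      case False
      then have "?L (b * z) = 1" using that Legendre_mult[OF l, of b z] by auto
      then show ?thesis by (rule padic_square_Legendre[OF l])
    qed
    have e12': "e1 * e2 \<in> {-1, 1}" using e by auto
    have e12: "?L (b1 * b2) = e1 * e2" by (simp add: e1_def e2_def Legendre_mult[OF l])
    show ?thesis
    proof (rule descent_soluble_padicI[OF l(1) m, where x = "of_int y"])
      show "b1 \<noteq> 0" "b2 \<noteq> 0" using good by auto
      show "padic_square l (of_int b1 * of_int y)"
        using sq[of y b1] y(1) e(1) by (simp add: e1_def)
      have "of_int b2 * (of_int y - (of_nat n)\<^sup>2) = (of_int (b2 * (y - a)) :: rat)" by (simp add: a_def)
      then show "padic_square l (of_int b2 * (of_int y - (of_nat n)\<^sup>2))"
        using sq[of "y - a" b2] y(2) e(2) by (simp only: e2_def)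
      have "of_int (b1 * b2) * (of_int y + 1) = (of_int ((b1 * b2) * (y + 1)) :: rat)" by simp
      then show "padic_square l (of_int (b1 * b2) * (of_int y + 1))"
        using sq[of "y + 1" "b1 * b2"] y(3) e12 e12' by (simp only:)
    qed
  qed
qed

lemma odd_prime_not_dvd_4:
  assumes "prime l" "2 < l"
  shows "\<not> int l dvd 4"
  using prime_dvd_power[of "int l" 2 2] odd_prime_not_dvd_2[OF assms(2)] assms(1) by auto

text \<open>As \<open>c\<close> is a square at \<open>l\<close>, the class of \<open>b1\<close> has to be that of \<open>x\<close> and \<open>x - n\<^sup>2\<close>. This holds over the
  rational numbers for \<open>x = b1 * w\<^sup>2\<close> and \<open>x - n\<^sup>2 = b1 * w'\<^sup>2\<close>, that is, if
  \<open>(w - w') * (w + w') = n\<^sup>2 / b1\<close>. The first factor \<open>u\<close> is free, and this leaves the condition on \<open>x + 1\<close>.\<close>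

lemma descent_soluble_conic:
  fixes u :: rat
  assumes l: "prime l" "l > 2" and m: "even m" and b1: "b1 \<noteq> 0" and c: "Legendre c (int l) = 1" and u: "u \<noteq> 0"
    and one: "padic_square l (of_int b1 * ((u + (of_nat n)\<^sup>2 / (of_int b1 * u)) / 2)\<^sup>2 + 1)"
  shows "descent_soluble (padic_field l) m n b1 (b1 * c)"
proof -
  define w w' where "w = (u + (of_nat n)\<^sup>2 / (of_int b1 * u)) / 2"
    and "w' = ((of_nat n)\<^sup>2 / (of_int b1 * u) - u) / 2"
  have sc: "padic_square l (of_int c)" by (rule padic_square_Legendre[OF l c])
  have nz: "(of_int b1 :: rat) \<noteq> 0" using b1 by simp
  have ww: "of_int b1 * w\<^sup>2 - (of_nat n)\<^sup>2 = of_int b1 * w'\<^sup>2"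
    using nz u by (simp add: w_def w'_def field_simps power2_eq_square)
  show ?thesis
  proof (rule descent_soluble_padicI[OF l(1) m, where x = "of_int b1 * w\<^sup>2"])
    show "b1 \<noteq> 0" "b1 * c \<noteq> 0" using b1 c by (auto simp: Legendre_def)
    have "of_int b1 * (of_int b1 * w\<^sup>2) = (of_int b1 * w)\<^sup>2" by (simp add: power2_eq_square)
    then show "padic_square l (of_int b1 * (of_int b1 * w\<^sup>2))" using padic_square_power2 by metis
    have "of_int (b1 * c) * (of_int b1 * w\<^sup>2 - (of_nat n)\<^sup>2) = of_int c * (of_int b1 * w')\<^sup>2"
      unfolding ww by (simp add: power2_eq_square)
    then show "padic_square l (of_int (b1 * c) * (of_int b1 * w\<^sup>2 - (of_nat n)\<^sup>2))"
      using padic_square_mult_power2[OF l(1) sc] by metis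
    have "of_int (b1 * (b1 * c)) * (of_int b1 * w\<^sup>2 + 1) = of_int c * (of_int b1 * w\<^sup>2 + 1) * (of_int b1)\<^sup>2"
      by (simp add: power2_eq_square)
    then show "padic_square l (of_int (b1 * (b1 * c)) * (of_int b1 * w\<^sup>2 + 1))"
      using padic_square_mult_power2[OF l(1) padic_square_mult[OF l(1) sc one[folded w_def]]] by metis
  qed
qed

text \<open>With \<open>u = 1\<close> if \<open>l\<close> divides \<open>b1\<close> and \<open>u = l\<close> otherwise, \<open>x\<close> is divisible by \<open>l\<close>, so \<open>x + 1\<close> is a square.\<close>

lemma descent_soluble_dvd_n:
  assumes l: "prime l" "l > 2" and m: "even m" and n: "l dvd n"
    and b1: "\<not> (int l)\<^sup>2 dvd b1" and c: "Legendre c (int l) = 1"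
  shows "descent_soluble (padic_field l) m n b1 (b1 * c)"
proof -
  obtain k where k: "n = l * k" using n by (elim dvdE)
  have pr: "prime (int l)" using l by simp
  have l0: "(of_nat l :: rat) \<noteq> 0" using l by simp
  show ?thesis
  proof (cases "int l dvd b1")
    case True
    then obtain b where b: "b1 = int l * b" by (elim dvdE)
    have lb: "\<not> int l dvd b" using b1 b by (auto simp: power2_eq_square)
    define A where "A = b + int l * (int k)\<^sup>2"
    have nz: "(of_int b :: rat) \<noteq> 0" using lb by auto
    have "\<not> int l dvd 4 * b" using odd_prime_not_dvd_4[OF l] lb pr by (simp add: prime_dvd_mult_iff)
    then have "padic_square l (of_int ((4 * b)\<^sup>2 + int l * (4 * b * A\<^sup>2)))"
      by (rule padic_square_cong_power2[OF l])
    note padic_square_mult_power2[OF l(1) this, of "1 / (4 * of_int b)"]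
    also have "of_int ((4 * b)\<^sup>2 + int l * (4 * b * A\<^sup>2)) * (1 / (4 * of_int b))\<^sup>2
        = of_int b1 * ((1 + (of_nat n)\<^sup>2 / (of_int b1 * 1)) / 2)\<^sup>2 + (1 :: rat)"
      using nz l0 by (simp add: A_def b k field_simps power2_eq_square)
    finally show ?thesis using True b1 by (intro descent_soluble_conic[OF l m _ c, of _ 1]) auto
  next
    case False
    define A where "A = b1 + (int k)\<^sup>2"
    have nz: "(of_int b1 :: rat) \<noteq> 0" using False by auto
    have "\<not> int l dvd 4 * b1" using odd_prime_not_dvd_4[OF l] False pr by (simp add: prime_dvd_mult_iff)
    then have "padic_square l (of_int ((4 * b1)\<^sup>2 + int l * (4 * b1 * int l * A\<^sup>2)))"
      by (rule padic_square_cong_power2[OF l])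
    note padic_square_mult_power2[OF l(1) this, of "1 / (4 * of_int b1)"]
    also have "of_int ((4 * b1)\<^sup>2 + int l * (4 * b1 * int l * A\<^sup>2)) * (1 / (4 * of_int b1))\<^sup>2
        = of_int b1 * ((of_nat l + (of_nat n)\<^sup>2 / (of_int b1 * of_nat l)) / 2)\<^sup>2 + (1 :: rat)"
      using nz l0 by (simp add: A_def k field_simps power2_eq_square)
    finally show ?thesis using False l0 by (intro descent_soluble_conic[OF l m _ c, of _ "of_nat l"]) auto
  qed
qed

text \<open>The three points of order 2, with \<open>x\<close> equal to 0, \<open>n\<^sup>2\<close> and \<open>-1\<close>, are solutions for the pairs in their
  own classes.\<close>

lemma descent_soluble_torsion:
  assumes l: "prime l" and m: "even m" and b: "b1 \<noteq> 0" "b2 \<noteq> 0"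
  shows "padic_square l (of_int (- b2)) \<Longrightarrow> padic_square l (of_int (b1 * b2)) \<Longrightarrow>
           descent_soluble (padic_field l) m n b1 b2"
    and "padic_square l (of_int b1) \<Longrightarrow> padic_square l (of_int (b1 * b2 * ((int n)\<^sup>2 + 1))) \<Longrightarrow>
           descent_soluble (padic_field l) m n b1 b2"
    and "padic_square l (of_int (- b1)) \<Longrightarrow> padic_square l (of_int (- b2 * ((int n)\<^sup>2 + 1))) \<Longrightarrow>
           descent_soluble (padic_field l) m n b1 b2"
proof -
  assume s: "padic_square l (of_int (- b2))" "padic_square l (of_int (b1 * b2))"
  show "descent_soluble (padic_field l) m n b1 b2"
    by (rule descent_soluble_padicI[OF l m b, where x = 0])
       (use padic_square_mult_power2[OF l s(1), of "of_nat n"] s(2) in \<open>simp_all add: padic_square_zero\<close>)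
next
  assume s: "padic_square l (of_int b1)" "padic_square l (of_int (b1 * b2 * ((int n)\<^sup>2 + 1)))"
  show "descent_soluble (padic_field l) m n b1 b2"
    by (rule descent_soluble_padicI[OF l m b, where x = "(of_nat n)\<^sup>2"])
       (use padic_square_mult_power2[OF l s(1), of "of_nat n"] s(2) in \<open>simp_all add: padic_square_zero\<close>)
next
  assume s: "padic_square l (of_int (- b1))" "padic_square l (of_int (- b2 * ((int n)\<^sup>2 + 1)))"
  have "of_int b2 * (- 1 - (of_nat n)\<^sup>2) = (of_int (- b2 * ((int n)\<^sup>2 + 1)) :: rat)"
    by (simp add: algebra_simps)
  then show "descent_soluble (padic_field l) m n b1 b2"
    by (intro descent_soluble_padicI[OF l m b, where x = "-1"])
       (use s in \<open>simp_all add: padic_square_zero\<close>)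
qed

context half_square_prime
begin

text \<open>2-adically \<open>b1\<close> is 1 or \<open>-1\<close> up to squares. If \<open>c\<close> is 2 or \<open>q\<close>, then \<open>q\<close> is 1 modulo 8 and so a square, whence \<open>q\<close>
  counts as 1 and 2 as \<open>2 * q\<close>. This leaves the trivial class and the classes of the torsion points.\<close>

lemma shape_soluble_two:
  assumes m: "even m" and e: "e \<in> {-1, 1}" and b: "b dvd n" "pm1_mod_8 b" and c: "c \<in> {1, 2, q, 2 * q}"
    and pm: "c \<in> {2, q} \<Longrightarrow> pm1_mod_8 n"
  shows "descent_soluble (padic_field 2) m n (e * int b) (e * int b * int c)"
proof -
  define b1 where "b1 = e * int b"
  have nz: "b1 \<noteq> 0" "b1 * int c \<noteq> 0" using e b c n_pos q_gt_2 by (auto simp: b1_def)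
  have two: "prime (2::nat)" by simp
  have "int b mod 8 = 1 \<or> int b mod 8 = 7"
    using b(2) unfolding pm1_mod_8_def by presburger
  then have "b1 mod 8 = 1 \<or> b1 mod 8 = 7" using e unfolding b1_def by auto presburger+
  then have b1: "b1 mod 8 = 1 \<or> (- b1) mod 8 = 1" by presburger
  have q8: "int q mod 8 = 1" if "c \<in> {2, q}" using q_mod_8[OF pm[OF that]] by presburger
  have sq: "padic_square 2 (of_int (u * v\<^sup>2))" if "u mod 8 = 1" for u v :: int
    using padic_square_mult_power2[OF two padic_square_two[OF that], of "of_int v"] by simp
  consider "c = 1 \<or> c = q" | "c = 2 \<or> c = 2 * q" using c by auto
  then show ?thesis
    unfolding b1_def[symmetric]
  proof cases
    case 1
    then have c8: "int c mod 8 = 1" using q8 by auto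
    show "descent_soluble (padic_field 2) m n b1 (b1 * int c)"
      using b1
    proof
      assume b8: "b1 mod 8 = 1"
      have cm: "b1 * int c mod 8 = 1" using mod_mult_eq[of b1 8 "int c"] b8 c8 by simp
      have sb: "padic_square 2 (of_int b1)" "padic_square 2 (of_int (b1 * int c))" "padic_square 2 (of_int (int c))"
        by (rule padic_square_two; fact b8 cm c8)+
      show ?thesis
      \<comment> \<open>Near infinity: \<open>16 * (x - n\<^sup>2)\<close> and \<open>16 * (x + 1)\<close> are 1 modulo 8.\<close>
      proof (rule descent_soluble_padicI[OF two m nz, where x = "(1 / 4)\<^sup>2"])
        show "padic_square 2 (of_int b1 * (1 / 4)\<^sup>2)" by (rule padic_square_mult_power2[OF two sb(1)])
        have "(1 - 16 * (int n)\<^sup>2) mod 8 = 1" by presburger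
        from padic_square_mult_power2[OF two padic_square_mult[OF two sb(2) padic_square_two[OF this]], of "1 / 4"]
        show "padic_square 2 (of_int (b1 * int c) * ((1 / 4)\<^sup>2 - (of_nat n)\<^sup>2))"
          by (simp add: field_simps power2_eq_square)
        have "(17::int) mod 8 = 1" by simp
        from padic_square_mult_power2[OF two padic_square_mult[OF two sb(3) padic_square_two[OF this]], of "of_int b1 / 4"]
        show "padic_square 2 (of_int (b1 * (b1 * int c)) * ((1 / 4)\<^sup>2 + 1))"
          by (simp add: field_simps power2_eq_square)
      qed
    next
      assume b8: "(- b1) mod 8 = 1"
      have "(- b1) * int c mod 8 = 1" using mod_mult_eq[of "- b1" 8 "int c"] b8 c8 by simp
      then have "padic_square 2 (of_int (- (b1 * int c)))" using padic_square_two by fastforce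
      moreover have "padic_square 2 (of_int (b1 * (b1 * int c)))"
        using sq[OF c8, of b1] by (simp add: power2_eq_square mult_ac)
      ultimately show ?thesis by (rule descent_soluble_torsion(1)[OF two m nz])
    qed
  next
    case 2
    obtain u v where uv: "u mod 8 = 1" "int c * ((int n)\<^sup>2 + 1) = u * v\<^sup>2"
    proof (cases "c = 2")
      case True
      then show ?thesis using that[of "int q" 2] q8 unfolding n_q_int by simp
    next
      case False
      then show ?thesis using 2 that[of 1 "2 * int q"] unfolding n_q_int by (simp add: power2_eq_square)
    qed
    show "descent_soluble (padic_field 2) m n b1 (b1 * int c)"
      using b1
    proof
      assume b8: "b1 mod 8 = 1"
      have "b1 * (b1 * int c) * ((int n)\<^sup>2 + 1) = u * (b1 * v)\<^sup>2"
        using uv(2) by (simp add: power2_eq_square mult_ac)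
      then have "padic_square 2 (of_int (b1 * (b1 * int c) * ((int n)\<^sup>2 + 1)))" using sq[OF uv(1)] by metis
      then show ?thesis by (rule descent_soluble_torsion(2)[OF two m nz padic_square_two[OF b8]])
    next
      assume b8: "(- b1) mod 8 = 1"
      have "(- b1) * u mod 8 = 1" using mod_mult_eq[of "- b1" 8 u] b8 uv(1) by simp
      moreover have "- (b1 * int c) * ((int n)\<^sup>2 + 1) = ((- b1) * u) * v\<^sup>2"
        using uv(2) by (simp add: mult_ac)
      ultimately have "padic_square 2 (of_int (- (b1 * int c) * ((int n)\<^sup>2 + 1)))" using sq by metis
      then show ?thesis by (rule descent_soluble_torsion(3)[OF two m nz padic_square_two[OF b8]])
    qed
  qed
qed

text \<open>The coefficient \<open>b1\<close> is a square at \<open>q\<close>, and so is 2 whenever \<open>c\<close> is 2 or \<open>q\<close>. Hence the pair is either trivial or in the class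
  of the torsion point with \<open>x = n\<^sup>2\<close>.\<close>

lemma shape_soluble_q:
  assumes m: "even m" and e: "e \<in> {-1, 1}" and b: "b dvd n" "pm1_mod_8 b" and c: "c \<in> {1, 2, q, 2 * q}"
    and pm: "c \<in> {2, q} \<Longrightarrow> pm1_mod_8 n"
  shows "descent_soluble (padic_field q) m n (e * int b) (e * int b * int c)"
proof -
  define b1 where "b1 = e * int b"
  have nz: "b1 \<noteq> 0" "b1 * int c \<noteq> 0" using e b c n_pos q_gt_2 by (auto simp: b1_def)
  have L: "Legendre b1 (int q) = 1" using Legendre_signed_divisor_q[OF b(1) e] b(2) by (simp add: b1_def)
  have L1: "Legendre 1 (int q) = 1" using Legendre_power2[of "int q" 1] q_prime q_gt_2 by simp
  have L2: "Legendre 2 (int q) = 1" if "c \<in> {2, q}"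
    using Legendre_two[OF q_prime q_gt_2] q_mod_8[OF pm[OF that]] by simp
  have s: "padic_square q (of_int b1)" by (rule padic_square_Legendre[OF q_prime q_gt_2 L])
  consider "c = 1 \<or> c = 2" | "c = q \<or> c = 2 * q" using c by auto
  then show ?thesis
    unfolding b1_def[symmetric]
  proof cases
    case 1
    then have "Legendre (int c) (int q) = 1" using L1 L2 by auto
    then have "Legendre (b1 * int c) (int q) = 1" using L Legendre_mult[OF q_prime q_gt_2] by simp
    then show "descent_soluble (padic_field q) m n b1 (b1 * int c)"
      by (rule descent_soluble_both_squares[OF q_prime q_gt_2 m L])
  next
    case 2
    have "\<exists>u v. Legendre u (int q) = 1 \<and> int c * ((int n)\<^sup>2 + 1) = u * v\<^sup>2"
    proof (cases "c = q")
      case True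
      then show ?thesis using L2 unfolding n_q_int by (intro exI[of _ 2] exI[of _ "int q"]) (simp add: power2_eq_square)
    next
      case False
      then show ?thesis using 2 L1 unfolding n_q_int by (intro exI[of _ 1] exI[of _ "2 * int q"]) (simp add: power2_eq_square)
    qed
    then obtain u v where uv: "Legendre u (int q) = 1" "int c * ((int n)\<^sup>2 + 1) = u * v\<^sup>2" by blast
    have "b1 * (b1 * int c) * ((int n)\<^sup>2 + 1) = u * (b1 * v)\<^sup>2"
      using uv(2) by (simp add: power2_eq_square mult_ac)
    moreover have "padic_square q (of_int (u * (b1 * v)\<^sup>2))"
      using padic_square_mult_power2[OF q_prime padic_square_Legendre[OF q_prime q_gt_2 uv(1)], of "of_int (b1 * v)"] by simp
    ultimately have "padic_square q (of_int (b1 * (b1 * int c) * ((int n)\<^sup>2 + 1)))" by (simp only:)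
    then show "descent_soluble (padic_field q) m n b1 (b1 * int c)"
      by (rule descent_soluble_torsion(2)[OF q_prime m nz s])
  qed
qed

lemma shape_imp_everywhere_soluble:
  assumes shape: "selmer_shape b1 b2" and m: "even m"
  shows "everywhere_soluble m n b1 b2"
proof -
  obtain e b c where e: "e \<in> {-1, 1}" and b: "b dvd n" "pm1_mod_8 b" and c: "c \<in> {1, 2, q, 2 * q}"
    and pm: "c \<in> {2, q} \<longrightarrow> (\<forall>p. prime p \<longrightarrow> p dvd n \<longrightarrow> pm1_mod_8 p)"
    and b1: "b1 = e * int b" and b2: "b2 = e * int b * int c"
    using shape unfolding selmer_shape_def by blast
  have pmn: "pm1_mod_8 n" if "c \<in> {2, q}" using pm1_mod_8_n pm that by blast
  have pos: "b > 0" "c > 0" using b c n_pos q_prime prime_gt_0_nat by (auto intro: dvd_pos_nat)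
  have "b1 * b2 = (e * e) * ((int b)\<^sup>2 * int c)" by (simp add: b1 b2 power2_eq_square)
  also have "e * e = 1" using e by auto
  finally have "b1 * b2 > 0" using pos by simp
  then have real: "descent_soluble (class_ring :: real ring) m n b1 b2" by (rule descent_soluble_realI)
  have "descent_soluble (padic_field l) m n b1 b2" if l: "prime l" for l
  proof -
    consider "l = 2" | "l = q" | "l dvd n" | "l \<noteq> 2" "l \<noteq> q" "\<not> l dvd n" by blast
    then show ?thesis
    proof cases
      case 1
      then show ?thesis unfolding b1 b2 using shape_soluble_two[OF m e b c pmn] by simp
    next
      case 2
      then show ?thesis unfolding b1 b2 using shape_soluble_q[OF m e b c pmn] by simp
    next
      case 3
      note l2 = prime_dvd_n[OF l 3]
      have L1: "Legendre 1 (int l) = 1" using Legendre_power2[of "int l" 1] l l2(1) by simp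
      have "Legendre 2 (int l) = 1" if "c \<in> {2, q}"
      proof -
        have "pm1_mod_8 l" using pm that l 3 by blast
        then show ?thesis using Legendre_two[OF l l2(1)] by (simp add: pm1_mod_8_def)
      qed
      then have L: "Legendre (int c) (int l) = 1"
        using c L1 Legendre_2q[OF l 3] Legendre_q_eq_2[OF l 3] by auto
      have b2': "b2 = b1 * int c" by (simp add: b1 b2)
      have "\<not> (int l)\<^sup>2 dvd b1"
      proof
        assume "(int l)\<^sup>2 dvd b1"
        then have "(int l)\<^sup>2 dvd int b" using e by (auto simp: b1)
        then have "l\<^sup>2 dvd n" using b(1) by (metis dvd_trans int_dvd_int_iff of_nat_power)
        then have "l dvd 1" using n_squarefree unfolding squarefree_def by blast
        then show False using l by simp
      qed
      then show ?thesis unfolding b2' using descent_soluble_dvd_n[OF l l2(1) m 3 _ L] by blast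
    next
      case 4
      have l2: "l > 2" using 4(1) prime_ge_2_nat[OF l] by simp
      have pr: "prime (int l)" using l by simp
      have nq: "\<not> int l dvd int q" using 4 l q_prime primes_dvd_imp_eq by auto
      have n2: "\<not> int l dvd 2" by (rule odd_prime_not_dvd_2[OF l2])
      have "\<not> l dvd b" using 4(3) b(1) dvd_trans by blast
      then have nb1: "\<not> int l dvd b1" using e by (auto simp: b1)
      have "\<not> l dvd 2" using l2 by (auto dest: dvd_imp_le)
      then have "\<not> int l dvd int c" using c nq l l2 by (auto simp: prime_dvd_mult_iff)
      then have nb2: "\<not> int l dvd b2" using nb1 pr by (simp add: b1 b2 prime_dvd_mult_iff)
      show ?thesis
        by (rule descent_soluble_good_prime[OF l l2 m _ _ nb1 nb2])
           (use 4(3) nq n2 pr in \<open>simp_all add: n_q_int prime_dvd_mult_iff\<close>)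
    qed
  qed
  then show ?thesis using real unfolding everywhere_soluble_def by blast
qed

end

section \<open>Dimension over the field of two elements\<close>

lemma F2_space_vectorspace:
  assumes G: "comm_group G" and H: "subgroup H G" and exp2: "\<And>x. x \<in> H \<Longrightarrow> x \<otimes>\<^bsub>G\<^esub> x = \<one>\<^bsub>G\<^esub>"
  shows "vectorspace (residue_ring 2) (F2_space G H)"
proof -
  interpret G: comm_group G by (rule G)
  interpret H: subgroup H G by (rule H)
  interpret K: residues_prime 2 "residue_ring 2" by unfold_locales (auto simp: residue_ring_def)
  have K: "carrier (residue_ring 2) = {0, 1}" by (auto simp: residue_ring_def)
  have ring: "a \<oplus>\<^bsub>residue_ring 2\<^esub> b = (a + b) mod 2" "a \<otimes>\<^bsub>residue_ring 2\<^esub> b = (a * b) mod 2"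
    "\<one>\<^bsub>residue_ring 2\<^esub> = 1" for a b by (simp_all add: residue_ring_def)
  have V: "carrier (F2_space G H) = H" "x \<oplus>\<^bsub>F2_space G H\<^esub> y = x \<otimes>\<^bsub>G\<^esub> y" "\<zero>\<^bsub>F2_space G H\<^esub> = \<one>\<^bsub>G\<^esub>"
    "a \<odot>\<^bsub>F2_space G H\<^esub> x = x [^]\<^bsub>G\<^esub> a" for x y a by (simp_all add: F2_space_def)
  have p0: "x [^]\<^bsub>G\<^esub> (0::int) = \<one>\<^bsub>G\<^esub>" for x by simp
  have p1: "x [^]\<^bsub>G\<^esub> (1::int) = x" if "x \<in> H" for x using that by simp
  have "abelian_group (F2_space G H)"
  proof (rule abelian_groupI)
    show "\<exists>y\<in>carrier (F2_space G H). y \<oplus>\<^bsub>F2_space G H\<^esub> x = \<zero>\<^bsub>F2_space G H\<^esub>"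
      if "x \<in> carrier (F2_space G H)" for x
      using that exp2 unfolding V by blast
  qed (auto simp: V G.m_ac)
  then have "module (residue_ring 2) (F2_space G H)"
    by (rule moduleI[OF K.cring]) (auto simp: V K ring p0 p1 exp2 G.m_ac)
  moreover have "field (residue_ring 2)" by unfold_locales
  ultimately show ?thesis unfolding vectorspace_def by simp
qed

text \<open>Every vector is a unique linear combination of a basis, with coefficients 0 or 1, so a basis with
  \<open>k\<close> elements yields \<open>2 ^ k\<close> vectors.\<close>

lemma F2_space_dim:
  assumes G: "comm_group G" and H: "subgroup H G" and exp2: "\<And>x. x \<in> H \<Longrightarrow> x \<otimes>\<^bsub>G\<^esub> x = \<one>\<^bsub>G\<^esub>"
    and card: "card H = 2 ^ d"
  shows "vectorspace.dim (residue_ring 2) (F2_space G H) = d"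
proof -
  interpret V: vectorspace "residue_ring 2" "F2_space G H" by (rule F2_space_vectorspace[OF G H exp2])
  have carr: "carrier (F2_space G H) = H" by (simp add: F2_space_def)
  have fin: "finite H" using card by (intro card_ge_0_finite) simp
  have "V.gen_set H" using V.in_own_span[of H] V.span_is_subset2[of H] carr by auto
  then have "V.fin_dim" unfolding V.fin_dim_def using fin carr by blast
  then obtain B where B: "finite B" "V.basis B" using V.finite_basis_exists by blast
  have BV: "B \<subseteq> carrier (F2_space G H)" using B(2) V.basis_def by blast
  have uniq: "\<exists>!a. a \<in> B \<rightarrow>\<^sub>E carrier (residue_ring 2) \<and> V.lincomb a B = v" if "v \<in> H" for v
    using V.basis_criterion[OF B(1) BV] B(2) that carr by blast
  have closed: "V.lincomb a B \<in> H" if "a \<in> B \<rightarrow>\<^sub>E carrier (residue_ring 2)" for a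
    using V.lincomb_closed[OF BV, of a] that carr by auto
  have "bij_betw (\<lambda>a. V.lincomb a B) (B \<rightarrow>\<^sub>E carrier (residue_ring 2)) H"
    unfolding bij_betw_def
  proof
    show "inj_on (\<lambda>a. V.lincomb a B) (B \<rightarrow>\<^sub>E carrier (residue_ring 2))"
      using uniq closed by (intro inj_onI) metis
    show "(\<lambda>a. V.lincomb a B) ` (B \<rightarrow>\<^sub>E carrier (residue_ring 2)) = H"
      using uniq closed by blast
  qed
  then have "card H = card (B \<rightarrow>\<^sub>E carrier (residue_ring 2))" by (metis bij_betw_same_card)
  also have "\<dots> = 2 ^ card B"
    using B(1) by (simp add: card_PiE residue_ring_def)
  finally have "card B = d" using card by simp
  then show ?thesis using V.dim_basis[OF B] by simp
qed

section \<open>Square classes of rational numbers\<close>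

lemma rat_units_simps [simp]:
  "carrier rat_units = {x. x \<noteq> 0}" "x \<otimes>\<^bsub>rat_units\<^esub> y = x * y" "\<one>\<^bsub>rat_units\<^esub> = 1"
  by (simp_all add: rat_units_def)

lemma rat_units_comm_group: "comm_group rat_units"
proof (rule comm_groupI)
  show "\<exists>y\<in>carrier rat_units. y \<otimes>\<^bsub>rat_units\<^esub> x = \<one>\<^bsub>rat_units\<^esub>" if "x \<in> carrier rat_units" for x
    using that by (intro bexI[of _ "1 / x"]) auto
qed auto

lemma rat_squares_subgroup: "subgroup rat_squares rat_units"
proof -
  interpret comm_group rat_units by (rule rat_units_comm_group)
  show ?thesis
  proof (rule subgroupI)
    show "rat_squares \<subseteq> carrier rat_units" by (auto simp: rat_squares_def)
    have "1 \<in> rat_squares" unfolding rat_squares_def by (intro CollectI exI[of _ 1]) simp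
    then show "rat_squares \<noteq> {}" by blast
    show "a \<otimes>\<^bsub>rat_units\<^esub> b \<in> rat_squares" if "a \<in> rat_squares" "b \<in> rat_squares" for a b
      using that unfolding rat_squares_def by (auto simp: power_mult_distrib[symmetric])
    show "inv\<^bsub>rat_units\<^esub> a \<in> rat_squares" if a: "a \<in> rat_squares" for a
    proof -
      obtain x where x: "a = x\<^sup>2" "x \<noteq> 0" using a by (auto simp: rat_squares_def)
      have "inv\<^bsub>rat_units\<^esub> a = (1 / x)\<^sup>2"
        by (rule inv_equality) (use x in \<open>auto simp: power_divide\<close>)
      then show ?thesis using x by (auto simp: rat_squares_def)
    qed
  qed
qed

lemma sq_group_comm_group: "comm_group sq_group"
  unfolding sq_group_def by (rule comm_group.abelian_FactGroup[OF rat_units_comm_group rat_squares_subgroup])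

lemma sq_group_carrier: "carrier sq_group = sq_class ` {x. x \<noteq> 0}"
  by (simp add: sq_group_def carrier_FactGroup sq_class_def)

lemma sq_class_mult:
  assumes "x \<noteq> 0" "y \<noteq> 0"
  shows "sq_class x \<otimes>\<^bsub>sq_group\<^esub> sq_class y = sq_class (x * y)"
proof -
  interpret normal rat_squares rat_units
    by (rule comm_group.subgroup_imp_normal[OF rat_units_comm_group rat_squares_subgroup])
  show ?thesis using rcos_sum[of x y] assms by (simp add: sq_group_def sq_class_def)
qed

lemma sq_class_in: "x \<in> sq_class y \<longleftrightarrow> (\<exists>z. z \<noteq> 0 \<and> x = z\<^sup>2 * y)"
  by (auto simp: sq_class_def r_coset_def rat_squares_def)

lemma sq_class_eq_iff:
  assumes "x \<noteq> 0" "y \<noteq> 0"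
  shows "sq_class x = sq_class y \<longleftrightarrow> (\<exists>z. z \<noteq> 0 \<and> x = z\<^sup>2 * y)"
proof
  assume "sq_class x = sq_class y"
  moreover have "x \<in> sq_class x" unfolding sq_class_in by (intro exI[of _ 1]) simp
  ultimately show "\<exists>z. z \<noteq> 0 \<and> x = z\<^sup>2 * y" by (simp add: sq_class_in)
next
  assume "\<exists>z. z \<noteq> 0 \<and> x = z\<^sup>2 * y"
  then obtain z where z: "z \<noteq> 0" "x = z\<^sup>2 * y" by blast
  have "w \<in> sq_class x \<longleftrightarrow> w \<in> sq_class y" for w
  proof
    assume "w \<in> sq_class x"
    then obtain v where v: "v \<noteq> 0" "w = v\<^sup>2 * x" unfolding sq_class_in by blast
    then show "w \<in> sq_class y"
      unfolding sq_class_in using z by (intro exI[of _ "v * z"]) (simp add: power_mult_distrib)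
  next
    assume "w \<in> sq_class y"
    then obtain v where v: "v \<noteq> 0" "w = v\<^sup>2 * y" unfolding sq_class_in by blast
    then show "w \<in> sq_class x"
      unfolding sq_class_in using z by (intro exI[of _ "v / z"]) (simp add: power_divide)
  qed
  then show "sq_class x = sq_class y" by blast
qed

lemma sq_class_square_mult:
  assumes "z \<noteq> 0" "y \<noteq> 0"
  shows "sq_class (z\<^sup>2 * y) = sq_class y"
  using assms by (subst sq_class_eq_iff) auto

lemma sq_group_one: "\<one>\<^bsub>sq_group\<^esub> = sq_class 1"
proof -
  have "sq_class 1 = rat_squares" by (auto simp: set_eq_iff sq_class_in rat_squares_def)
  then show ?thesis by (simp add: sq_group_def)
qed

text \<open>In \<open>a * v\<^sup>2 = d * u\<^sup>2\<close> with coprime \<open>u\<close> and \<open>v\<close>, a prime factor of \<open>a\<close> that does not divide \<open>d\<close> would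
  divide \<open>u\<close>, and then it would divide \<open>a\<close> twice.\<close>

lemma same_sq_class_prime_dvd:
  fixes a d :: int
  assumes eq: "sq_class (of_int a) = sq_class (of_int d)" and a: "squarefree a" and d: "d \<noteq> 0"
    and p: "prime p" "p dvd a"
  shows "p dvd d"
proof (rule ccontr)
  assume pd: "\<not> p dvd d"
  have "a \<noteq> 0" using a by auto
  then obtain z where z: "z \<noteq> 0" "(of_int a :: rat) = z\<^sup>2 * of_int d"
    using eq d by (auto simp: sq_class_eq_iff)
  obtain u v where uv: "quotient_of z = (u, v)" by (cases "quotient_of z")
  have v: "v > 0" and cop: "coprime u v" and zuv: "z = of_int u / of_int v"
    using uv quotient_of_denom_pos quotient_of_coprime quotient_of_div by blast+
  have "(of_int (a * v\<^sup>2) :: rat) = of_int (d * u\<^sup>2)"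
    using z v by (simp add: zuv power_divide field_simps)
  then have e: "a * v\<^sup>2 = d * u\<^sup>2" by (simp only: of_int_eq_iff)
  have "p dvd d * u\<^sup>2" using p(2) by (simp flip: e)
  then have pu: "p dvd u" using pd p(1) prime_dvd_power[of p u 2] by (auto simp: prime_dvd_mult_iff)
  then have "\<not> p dvd v" using cop p(1) by (meson coprime_common_divisor not_prime_unit)
  then have "coprime (p ^ 2) (v\<^sup>2)" using p(1) by (simp add: prime_imp_coprime)
  moreover have "p ^ 2 dvd a * v\<^sup>2" unfolding e using pu by (intro dvd_mult dvd_power_same)
  ultimately have "p ^ 2 dvd a" using coprime_dvd_mult_left_iff by blast
  then have "p dvd 1" using a unfolding squarefree_def by blast
  then show False using p(1) not_prime_unit by blast
qed

text \<open>This is what allows computations in the group of square classes to be carried out on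
  representatives.\<close>

lemma squarefree_sq_class_inject:
  fixes a b :: int
  assumes eq: "sq_class (of_int a) = sq_class (of_int b)" and sf: "squarefree a" "squarefree b"
  shows "a = b"
proof -
  have nz: "a \<noteq> 0" "b \<noteq> 0" using sf by auto
  have "nat \<bar>a\<bar> dvd nat \<bar>b\<bar>"
    using same_sq_class_prime_dvd[OF eq sf(1) nz(2)] nz
    by (intro squarefree_dvdI[OF squarefree_nat_abs[OF sf(1)]]) (auto simp: dvd_nat_abs_iff)
  moreover have "nat \<bar>b\<bar> dvd nat \<bar>a\<bar>"
    using same_sq_class_prime_dvd[OF eq[symmetric] sf(2) nz(1)] nz
    by (intro squarefree_dvdI[OF squarefree_nat_abs[OF sf(2)]]) (auto simp: dvd_nat_abs_iff)
  ultimately have "nat \<bar>a\<bar> = nat \<bar>b\<bar>" by (rule dvd_antisym)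
  then have "\<bar>a\<bar> = \<bar>b\<bar>" by simp
  moreover obtain z where z: "z \<noteq> 0" "(of_int a :: rat) = z\<^sup>2 * of_int b"
    using eq nz by (auto simp: sq_class_eq_iff)
  then have "sgn (of_int a :: rat) = sgn (of_int b)" by (simp add: sgn_mult) (simp add: sgn_if)
  then have "sgn a = sgn b" by (simp add: sgn_if split: if_splits)
  ultimately show ?thesis by (metis sgn_mult_abs)
qed

lemma sq_pairs_comm_group: "comm_group sq_pairs"
proof -
  interpret S: comm_group sq_group by (rule sq_group_comm_group)
  have "group sq_pairs" unfolding sq_pairs_def by (rule DirProd_group) (rule S.is_group)+
  then show ?thesis
    by (rule group.group_comm_groupI) (auto simp: sq_pairs_def S.m_comm)
qed

lemma sq_pairs_carrier: "carrier sq_pairs = {sq_pair x y | x y. x \<noteq> 0 \<and> y \<noteq> 0}"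
  by (auto simp: sq_pairs_def sq_group_carrier sq_pair_def)

lemma sq_pair_mult:
  assumes "x \<noteq> 0" "y \<noteq> 0" "x' \<noteq> 0" "y' \<noteq> 0"
  shows "sq_pair x y \<otimes>\<^bsub>sq_pairs\<^esub> sq_pair x' y' = sq_pair (x * x') (y * y')"
  using assms by (simp add: sq_pairs_def sq_pair_def sq_class_mult)

lemma sq_pairs_one: "\<one>\<^bsub>sq_pairs\<^esub> = sq_pair 1 1"
  by (simp add: sq_pairs_def sq_pair_def sq_group_one)

lemma sq_pair_power2_mult:
  assumes "x \<noteq> 0" "y \<noteq> 0" "z \<noteq> 0" "w \<noteq> 0"
  shows "sq_pair (z\<^sup>2 * x) (w\<^sup>2 * y) = sq_pair x y"
  using assms by (simp add: sq_pair_def sq_class_square_mult)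

lemma sq_pairs_exponent_2:
  assumes "x \<in> carrier sq_pairs"
  shows "x \<otimes>\<^bsub>sq_pairs\<^esub> x = \<one>\<^bsub>sq_pairs\<^esub>"
proof -
  obtain a b where ab: "x = sq_pair a b" "a \<noteq> 0" "b \<noteq> 0" using assms by (auto simp: sq_pairs_carrier)
  then show ?thesis
    using sq_pair_power2_mult[of 1 1 a b] by (simp add: sq_pair_mult sq_pairs_one power2_eq_square)
qed

text \<open>Every element is its own inverse.\<close>

lemma sq_pairs_subgroupI:
  assumes sub: "H \<subseteq> carrier sq_pairs" and one: "\<one>\<^bsub>sq_pairs\<^esub> \<in> H"
    and mult: "\<And>x y. x \<in> H \<Longrightarrow> y \<in> H \<Longrightarrow> x \<otimes>\<^bsub>sq_pairs\<^esub> y \<in> H"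
  shows "subgroup H sq_pairs"
proof -
  interpret comm_group sq_pairs by (rule sq_pairs_comm_group)
  show ?thesis
  proof (rule subgroupI[OF sub _ _ mult])
    show "H \<noteq> {}" using one by blast
    show "inv\<^bsub>sq_pairs\<^esub> a \<in> H" if "a \<in> H" for a
      using inv_equality[OF sq_pairs_exponent_2, of a] sub that by auto
  qed
qed

lemma internal_direct_productI:
  assumes G: "comm_group G" and A: "subgroup A G" and B: "subgroup B G"
    and AB: "A \<inter> B \<subseteq> {\<one>\<^bsub>G\<^esub>}"
  shows "internal_direct_product G (A <#>\<^bsub>G\<^esub> B) A B"
proof -
  interpret G: comm_group G by (rule G)
  let ?H = "A <#>\<^bsub>G\<^esub> B"
  have H: "subgroup ?H G" by (rule G.mult_subgroups[OF A B])
  have "comm_group (G\<lparr>carrier := ?H\<rparr>)"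
    by (rule group.group_comm_groupI[OF G.subgroup_imp_group[OF H]])
       (use subgroup.subset[OF H] G.m_comm in auto)
  moreover have AH: "A \<subseteq> ?H"
  proof
    fix a assume a: "a \<in> A"
    then have "a \<otimes>\<^bsub>G\<^esub> \<one>\<^bsub>G\<^esub> \<in> ?H" unfolding set_mult_def using subgroup.one_closed[OF B] by blast
    then show "a \<in> ?H" using a subgroup.subset[OF A] by auto
  qed
  moreover have BH: "B \<subseteq> ?H"
  proof
    fix b assume b: "b \<in> B"
    then have "\<one>\<^bsub>G\<^esub> \<otimes>\<^bsub>G\<^esub> b \<in> ?H" unfolding set_mult_def using subgroup.one_closed[OF A] by blast
    then show "b \<in> ?H" using b subgroup.subset[OF B] by auto
  qed
  ultimately have "A \<lhd> (G\<lparr>carrier := ?H\<rparr>)" "B \<lhd> (G\<lparr>carrier := ?H\<rparr>)"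
    using G.subgroup_incl[OF A H] G.subgroup_incl[OF B H] comm_group.subgroup_imp_normal by blast+
  moreover have "A \<inter> B = {\<one>\<^bsub>G\<^esub>}"
    using AB subgroup.one_closed[OF A] subgroup.one_closed[OF B] by blast
  ultimately show ?thesis using H unfolding internal_direct_product_def by blast
qed

context half_square_prime
begin

text \<open>Allowing square factors in \<open>d\<close> makes the statement stable under products; the next lemma returns to
  squarefree representatives.\<close>

lemma QS2_prime_dvd:
  assumes "B \<in> QS2 n q"
  shows "\<exists>d::int. d \<noteq> 0 \<and> B = sq_class (of_int d) \<and> (\<forall>p. prime p \<longrightarrow> int p dvd d \<longrightarrow> p dvd 2 * n * q)"
    (is "?P B")
proof -
  interpret S: comm_group sq_group by (rule sq_group_comm_group)
  have gen: "?P B" if "B \<in> sq_class ` ({-1, 2, of_nat q} \<union> {of_nat p | p. p \<in> prime_factors n})" for B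
  proof -
    from that consider "B = sq_class (of_int (-1))" | "B = sq_class (of_int 2)" | "B = sq_class (of_int (int q))"
      | p where "p \<in> prime_factors n" "B = sq_class (of_int (int p))" by auto
    then show ?thesis
    proof cases
      case 1
      then show ?thesis by (intro exI[of _ "-1"]) auto
    next
      case 2
      have "p dvd 2 * n * q" if "int p dvd 2" for p
        using that by (metis dvd_mult2 int_dvd_int_iff of_nat_numeral)
      then show ?thesis using 2 by (intro exI[of _ 2]) auto
    next
      case 3
      then show ?thesis using q_gt_2 by (intro exI[of _ "int q"]) auto
    next
      case 4
      then have "p dvd n" "prime p" by auto
      then have "r dvd 2 * n * q" if "r dvd p" for r
        using that by (meson dvd_mult dvd_mult2 dvd_trans)
      moreover have "p \<noteq> 0" using \<open>prime p\<close> by auto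
      ultimately show ?thesis using 4 by (intro exI[of _ "int p"]) auto
    qed
  qed
  show ?thesis
    using assms unfolding QS2_def
  proof (induction B rule: generate.induct)
    case one
    then show ?case by (intro exI[of _ 1]) (auto simp: sq_group_one)
  next
    case (incl B)
    then show ?case by (rule gen)
  next
    case (inv B)
    then obtain x :: int where x: "x \<noteq> 0" "B = sq_class (of_int x)" using gen by blast
    then have "B \<otimes>\<^bsub>sq_group\<^esub> B = \<one>\<^bsub>sq_group\<^esub>"
      using sq_class_square_mult[of "of_int x" 1] by (simp add: sq_class_mult sq_group_one power2_eq_square)
    then have "inv\<^bsub>sq_group\<^esub> B = B" using x by (intro S.inv_equality) (auto simp: sq_group_carrier)
    then show ?case using gen[OF inv] by simp
  next
    case (eng B C)
    then obtain d e where d: "d \<noteq> 0" "B = sq_class (of_int d)" "\<forall>p. prime p \<longrightarrow> int p dvd d \<longrightarrow> p dvd 2 * n * q"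
      and e: "e \<noteq> 0" "C = sq_class (of_int e)" "\<forall>p. prime p \<longrightarrow> int p dvd e \<longrightarrow> p dvd 2 * n * q" by blast
    show ?case
      using d e by (intro exI[of _ "d * e"]) (auto simp: sq_class_mult prime_dvd_mult_iff)
  qed
qed

lemma QS2_squarefree_dvd:
  assumes B: "sq_class (of_int b) \<in> QS2 n q" and b: "squarefree b"
  shows "nat \<bar>b\<bar> dvd 2 * n * q"
proof (rule squarefree_dvdI[OF squarefree_nat_abs[OF b]])
  show "2 * n * q \<noteq> 0" using n_pos q_gt_2 by simp
  fix p assume p: "prime p" "p dvd nat \<bar>b\<bar>"
  then have pb: "int p dvd b" by (simp add: dvd_nat_abs_iff)
  obtain d where d: "d \<noteq> 0" "sq_class (of_int b) = sq_class (of_int d)" "\<forall>p. prime p \<longrightarrow> int p dvd d \<longrightarrow> p dvd 2 * n * q"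
    using QS2_prime_dvd[OF B] by blast
  then have "int p dvd d" using same_sq_class_prime_dvd[OF d(2) b d(1) _ pb] p(1) by simp
  then show "p dvd 2 * n * q" using d(3) p(1) by blast
qed

lemma QS2_mult:
  assumes "sq_class x \<in> QS2 n q" "sq_class y \<in> QS2 n q" "x \<noteq> 0" "y \<noteq> 0"
  shows "sq_class (x * y) \<in> QS2 n q"
  using assms generate.eng[of "sq_class x" sq_group _ "sq_class y"] unfolding QS2_def
  by (simp add: sq_class_mult)

lemma QS2_gens:
  "sq_class 1 \<in> QS2 n q" "sq_class (-1) \<in> QS2 n q" "sq_class 2 \<in> QS2 n q" "sq_class (of_nat q) \<in> QS2 n q"
  "prime p \<Longrightarrow> p dvd n \<Longrightarrow> sq_class (of_nat p) \<in> QS2 n q"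
proof -
  show "sq_class 1 \<in> QS2 n q" unfolding QS2_def sq_group_one[symmetric] by (rule generate.one)
  show "sq_class (-1) \<in> QS2 n q" "sq_class 2 \<in> QS2 n q" "sq_class (of_nat q) \<in> QS2 n q"
    unfolding QS2_def by (rule generate.incl; simp)+
  assume "prime p" "p dvd n"
  then have "p \<in> prime_factors n" using n_pos by (simp add: prime_factors_dvd)
  then show "sq_class (of_nat p) \<in> QS2 n q" unfolding QS2_def by (intro generate.incl) auto
qed

lemma QS2_divisor: "b dvd n \<Longrightarrow> sq_class (of_nat b) \<in> QS2 n q"
proof (induction rule: divisor_induct)
  case one
  then show ?case using QS2_gens(1) by simp
next
  case (mult p c)
  then have "p \<noteq> 0" "c \<noteq> 0" using n_pos by auto
  then show ?case
    using QS2_mult[OF QS2_gens(5)[OF mult(1,2)] mult(4)] by simp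
qed

end

section \<open>The Selmer group\<close>

text \<open>The elements of all subgroups below have this form, where only few values of \<open>c\<close> occur.\<close>

definition twist :: "rat \<Rightarrow> nat \<Rightarrow> rat set \<times> rat set" where
  "twist x c = sq_pair x (x * of_nat c)"

definition twists :: "rat set \<Rightarrow> nat set \<Rightarrow> (rat set \<times> rat set) set" where
  "twists X C = {twist x c | x c. x \<in> X \<and> c \<in> C}"

lemma twist_mult:
  assumes nz: "x \<noteq> 0" "x' \<noteq> 0" "c \<noteq> 0" "c' \<noteq> 0" and eq: "x * x' = z\<^sup>2 * y" "c * c' = w\<^sup>2 * d"
  shows "twist x c \<otimes>\<^bsub>sq_pairs\<^esub> twist x' c' = twist y d"
proof -
  have "z \<noteq> 0" "y \<noteq> 0" using nz eq(1) by auto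
  moreover have "w\<^sup>2 * d \<noteq> 0" unfolding eq(2)[symmetric] using nz by simp
  then have "w \<noteq> 0" "d \<noteq> 0" by auto
  moreover have "x * of_nat c * (x' * of_nat c') = (x * x') * of_nat (c * c')" by simp
  then have "x * of_nat c * (x' * of_nat c') = (z * of_nat w)\<^sup>2 * (y * of_nat d)"
    unfolding eq by (simp add: power_mult_distrib)
  ultimately show ?thesis
    using nz sq_pair_power2_mult[of y "y * of_nat d" z "z * of_nat w"] unfolding twist_def
    by (simp add: sq_pair_mult eq(1))
qed

lemma twists_subgroup:
  assumes X: "0 \<notin> X" "1 \<in> X" "\<And>x x'. x \<in> X \<Longrightarrow> x' \<in> X \<Longrightarrow> \<exists>z. \<exists>y\<in>X. x * x' = z\<^sup>2 * y"
    and C: "0 \<notin> C" "1 \<in> C" "\<And>c c'. c \<in> C \<Longrightarrow> c' \<in> C \<Longrightarrow> \<exists>w. \<exists>d\<in>C. c * c' = w\<^sup>2 * d"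
  shows "subgroup (twists X C) sq_pairs"
proof (rule sq_pairs_subgroupI)
  have nz: "x \<noteq> 0" "c \<noteq> 0" if "x \<in> X" "c \<in> C" for x c using that X(1) C(1) by metis+
  then have "twist x c \<in> carrier sq_pairs" if "x \<in> X" "c \<in> C" for x c
    unfolding twist_def sq_pairs_carrier using that by fastforce
  then show "twists X C \<subseteq> carrier sq_pairs" unfolding twists_def by blast
  have "\<one>\<^bsub>sq_pairs\<^esub> = twist 1 1" by (simp add: twist_def sq_pairs_one)
  then show "\<one>\<^bsub>sq_pairs\<^esub> \<in> twists X C" unfolding twists_def using X(2) C(2) by blast
  fix u v assume "u \<in> twists X C" "v \<in> twists X C"
  then obtain x c x' c' where u: "u = twist x c" "x \<in> X" "c \<in> C" and v: "v = twist x' c'" "x' \<in> X" "c' \<in> C"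
    unfolding twists_def by blast
  obtain z y where zy: "y \<in> X" "x * x' = z\<^sup>2 * y" using X(3)[OF u(2) v(2)] by blast
  obtain w d where wd: "d \<in> C" "c * c' = w\<^sup>2 * d" using C(3)[OF u(3) v(3)] by blast
  have "u \<otimes>\<^bsub>sq_pairs\<^esub> v = twist y d"
    unfolding u v by (rule twist_mult[OF _ _ _ _ zy(2) wd(2)]) (use nz u v in auto)
  then show "u \<otimes>\<^bsub>sq_pairs\<^esub> v \<in> twists X C" unfolding twists_def using zy(1) wd(1) by blast
qed

lemma divisors_prime_mult:
  fixes p m :: nat
  assumes p: "prime p"
  shows "{b. b dvd p * m \<and> \<not> p dvd b} = {b. b dvd m \<and> \<not> p dvd b}"
    and "{b. b dvd p * m \<and> p dvd b} = (\<lambda>b. p * b) ` {b. b dvd m}"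
proof -
  show "{b. b dvd p * m \<and> \<not> p dvd b} = {b. b dvd m \<and> \<not> p dvd b}"
  proof (intro equalityI subsetI)
    fix b assume b: "b \<in> {b. b dvd p * m \<and> \<not> p dvd b}"
    then have "coprime b p" using prime_imp_coprime[OF p, of b] by (simp add: coprime_commute)
    then show "b \<in> {b. b dvd m \<and> \<not> p dvd b}" using b by (simp add: coprime_dvd_mult_right_iff)
  qed auto
  show "{b. b dvd p * m \<and> p dvd b} = (\<lambda>b. p * b) ` {b. b dvd m}"
    using p by (auto elim!: dvdE[of p])
qed

text \<open>Splitting off a prime factor \<open>p\<close> of \<open>n\<close>, the divisors are those of \<open>n div p\<close> and their multiples by \<open>p\<close>. The
  second kind has the same type modulo 8 if \<open>p\<close> is 1 or 7 modulo 8 and the opposite type otherwise, so both types have to be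
  counted at once: that is the role of \<open>v\<close>.\<close>

lemma card_divisors_pm1_mod_8:
  assumes "squarefree n" "odd n"
  shows "card {b. b dvd n \<and> pm1_mod_8 b = v} =
    (if \<forall>p\<in>prime_factors n. pm1_mod_8 p then if v then 2 ^ card (prime_factors n) else 0
     else 2 ^ (card (prime_factors n) - 1))"
  using assms
proof (induction n arbitrary: v rule: less_induct)
  case (less n)
  have n0: "n > 0" using less.prems by (cases n) auto
  show ?case
  proof (cases "n = 1")
    case True
    then have "{b. b dvd n \<and> pm1_mod_8 b = v} = (if v then {1} else {})"
      by (auto simp: pm1_mod_8_def)
    then show ?thesis using True by simp
  next
    case False
    then obtain p where p: "prime p" "p dvd n" using prime_factor_nat by blast
    then obtain m where m: "n = p * m" by (elim dvdE)
    have m0: "m > 0" using n0 m by simp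
    have mn: "m < n" using m0 m p(1) prime_gt_1_nat by simp
    have pm: "\<not> p dvd m"
    proof
      assume "p dvd m"
      then have "p ^ 2 dvd n" unfolding m power2_eq_square by (intro mult_dvd_mono) auto
      then have "p dvd 1" using less.prems(1) unfolding squarefree_def by blast
      then show False using p(1) by simp
    qed
    have sf: "squarefree m" "odd m" "odd p" using less.prems m squarefree_multD by auto
    define cm where "cm v = card {b. b dvd m \<and> pm1_mod_8 b = v}" for v
    have IH: "cm v = (if \<forall>p\<in>prime_factors m. pm1_mod_8 p then if v then 2 ^ card (prime_factors m) else 0
       else 2 ^ (card (prime_factors m) - 1))" for v
      unfolding cm_def by (rule less.IH[OF mn sf(1,2)])
    have fin: "finite {b. b dvd n}" using n0 by simp
    have "{b. b dvd n \<and> pm1_mod_8 b = v}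
        = {b \<in> {b. b dvd n \<and> \<not> p dvd b}. pm1_mod_8 b = v} \<union> {b \<in> {b. b dvd n \<and> p dvd b}. pm1_mod_8 b = v}" by blast
    also have "{b \<in> {b. b dvd n \<and> \<not> p dvd b}. pm1_mod_8 b = v} = {b. b dvd m \<and> pm1_mod_8 b = v}"
      unfolding m divisors_prime_mult(1)[OF p(1)] using pm dvd_trans by blast
    also have "{b \<in> {b. b dvd n \<and> p dvd b}. pm1_mod_8 b = v}
        = (\<lambda>b. p * b) ` {b. b dvd m \<and> pm1_mod_8 b = (v = pm1_mod_8 p)}"
    proof -
      have "pm1_mod_8 (p * b) \<longleftrightarrow> (pm1_mod_8 p \<longleftrightarrow> pm1_mod_8 b)" if "b dvd m" for b
        using that sf dvd_trans by (intro pm1_mod_8_mult) blast+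
      then show ?thesis unfolding m divisors_prime_mult(2)[OF p(1)] by auto
    qed
    finally have "card {b. b dvd n \<and> pm1_mod_8 b = v}
        = card ({b. b dvd m \<and> pm1_mod_8 b = v} \<union> (\<lambda>b. p * b) ` {b. b dvd m \<and> pm1_mod_8 b = (v = pm1_mod_8 p)})"
      by simp
    also have "\<dots> = card {b. b dvd m \<and> pm1_mod_8 b = v} + card ((\<lambda>b. p * b) ` {b. b dvd m \<and> pm1_mod_8 b = (v = pm1_mod_8 p)})"
    proof (rule card_Un_disjoint)
      have "finite {b. b dvd m}" using m0 by simp
      then show "finite {b. b dvd m \<and> pm1_mod_8 b = v}"
        "finite ((\<lambda>b. p * b) ` {b. b dvd m \<and> pm1_mod_8 b = (v = pm1_mod_8 p)})"
        by (auto intro: finite_subset[rotated])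
      show "{b. b dvd m \<and> pm1_mod_8 b = v} \<inter> (\<lambda>b. p * b) ` {b. b dvd m \<and> pm1_mod_8 b = (v = pm1_mod_8 p)} = {}"
        using pm dvd_trans[of p] by auto
    qed
    also have "card ((\<lambda>b. p * b) ` {b. b dvd m \<and> pm1_mod_8 b = (v = pm1_mod_8 p)}) = cm (v = pm1_mod_8 p)"
      unfolding cm_def using p(1) by (intro card_image) (auto simp: inj_on_def)
    finally have step: "card {b. b dvd n \<and> pm1_mod_8 b = v} = cm v + cm (v = pm1_mod_8 p)"
      by (simp add: cm_def)
    have pf: "prime_factors n = insert p (prime_factors m)"
      using p(1) m0 by (simp add: m prime_factors_product prime_prime_factors)
    have pnm: "p \<notin> prime_factors m" using pm by auto
    then have cpf: "card (prime_factors n) = Suc (card (prime_factors m))" unfolding pf by simp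
    show ?thesis
    proof (cases "\<forall>p\<in>prime_factors m. pm1_mod_8 p")
      case True
      then show ?thesis unfolding step IH cpf by (cases "pm1_mod_8 p"; cases v) (auto simp: pf)
    next
      case False
      then have "card (prime_factors m) > 0" by (auto simp: card_gt_0_iff)
      then have "(2::nat) ^ card (prime_factors m) = 2 * 2 ^ (card (prime_factors m) - 1)"
        by (simp flip: power_Suc)
      then show ?thesis using False unfolding step IH cpf by (simp add: pf)
    qed
  qed
qed

lemma prime_factors_Prod_primes:
  fixes S :: "nat set"
  assumes "finite S" "\<And>p. p \<in> S \<Longrightarrow> prime p"
  shows "prime_factors (\<Prod>S) = S"
proof -
  have "prime_factors (prod (\<lambda>p. p) S) = (\<Union>p\<in>S. prime_factors p)"
    using assms(1) assms(2)[of 0] by (subst prime_factors_prod) auto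
  also have "\<dots> = S" using assms(2) prime_prime_factors by auto
  finally show ?thesis .
qed

context half_square_prime
begin

definition divs_pm1 :: "nat set" where
  "divs_pm1 = {b. b dvd n \<and> pm1_mod_8 b}"

lemma divs_pm1_pos: "b \<in> divs_pm1 \<Longrightarrow> b > 0"
  using dvd_pos_nat[OF n_pos] by (simp add: divs_pm1_def)

lemma one_divs_pm1: "1 \<in> divs_pm1"
  by (simp add: divs_pm1_def pm1_mod_8_def)

text \<open>Products of divisors of \<open>n\<close> need not divide \<open>n\<close>, but they do after their common square factor is
  removed; odd squares do not change the type modulo 8.\<close>

lemma divs_pm1_mult:
  assumes b: "b \<in> divs_pm1" "b' \<in> divs_pm1"
  obtains g b'' where "b'' \<in> divs_pm1" "b * b' = g\<^sup>2 * b''"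
proof -
  define g where "g = gcd b b'"
  have g0: "g > 0" using divs_pm1_pos[OF b(1)] by (simp add: g_def)
  obtain x y where "b = x * g" "b' = y * g" "coprime x y"
    using gcd_coprime_exists[of b b'] g0 unfolding g_def by blast
  then have xy: "b = g * x" "b' = g * y" "coprime x y" by (simp_all only: mult.commute)
  have bn: "b dvd n" "b' dvd n" "pm1_mod_8 b" "pm1_mod_8 b'" using b by (auto simp: divs_pm1_def)
  have xn: "x dvd n" "y dvd n" "g dvd n" using bn xy dvd_mult_left dvd_mult_right by metis+
  have xyn: "x * y dvd n" using xn xy(3) by (simp add: divides_mult)
  have odd: "odd x" "odd y" "odd g" using xn n_odd dvd_trans by blast+
  have "pm1_mod_8 (x * y)" using bn(3,4) odd by (simp add: xy pm1_mod_8_mult)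
  moreover have "b * b' = g\<^sup>2 * (x * y)" by (simp add: xy power2_eq_square)
  ultimately show ?thesis using that[of "x * y" g] xyn by (simp add: divs_pm1_def)
qed

lemma squarefree_n_mult:
  assumes "b dvd n" "c \<in> {1, 2, q, 2 * q}"
  shows "squarefree (b * c)"
proof -
  have bn: "squarefree b" "odd b" "\<not> q dvd b"
    using assms(1) n_squarefree n_odd q_not_dvd_n squarefree_mono dvd_trans by blast+
  have "odd q" using q_gt_2 q_prime prime_odd_nat by blast
  then have "coprime 2 q" by simp
  then have "squarefree (2 * q)" using q_prime by (intro squarefree_mult_coprime squarefree_prime) auto
  then have "squarefree c" using assms(2) q_prime squarefree_mono[of _ "2 * q"] by auto
  moreover have "coprime b (2 * q)"
    using bn(2) prime_imp_coprime[OF q_prime bn(3)] by (simp add: coprime_commute)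
  then have "coprime b c" using assms(2) by auto
  ultimately show ?thesis using bn(1) by (intro squarefree_mult_coprime)
qed

lemma squarefree_shape:
  assumes "b dvd n" "c \<in> {1, 2, q, 2 * q}" "e \<in> {-1, 1}"
  shows "squarefree (e * int b)" "squarefree (e * int b * int c)"
proof -
  have sfi: "squarefree (int a)" if "squarefree a" for a
    unfolding squarefree_def
  proof (intro allI impI)
    fix x :: int assume "x\<^sup>2 dvd int a"
    then have "int (nat \<bar>x\<bar> ^ 2) dvd int a" by simp
    then have "(nat \<bar>x\<bar>)\<^sup>2 dvd a" by (simp only: int_dvd_int_iff)
    then have "nat \<bar>x\<bar> dvd 1" using that unfolding squarefree_def by blast
    then show "x dvd 1" by (simp add: nat_abs_dvd_iff)
  qed
  have "squarefree (int (b * c))" by (rule sfi[OF squarefree_n_mult[OF assms(1,2)]])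
  moreover have "squarefree (int (b * 1))" by (rule sfi[OF squarefree_n_mult[OF assms(1)]]) simp
  ultimately have "squarefree (int (b * c))" "squarefree (int b)" by (simp_all only: mult_1_right)
  then show "squarefree (e * int b)" "squarefree (e * int b * int c)"
    unfolding mult.assoc of_nat_mult[symmetric] using assms(3) by (auto simp del: of_nat_mult)
qed

lemma Sel2_eq:
  assumes m: "even m"
  shows "Sel2 m n q = {sq_pair (of_int b1) (of_int b2) | b1 b2. selmer_shape b1 b2}"
proof (intro equalityI subsetI)
  fix P assume "P \<in> Sel2 m n q"
  then obtain b1 b2 where b: "squarefree b1" "squarefree b2" "sq_class (of_int b1) \<in> QS2 n q"
      "sq_class (of_int b2) \<in> QS2 n q" "P = (sq_class (of_int b1), sq_class (of_int b2))"
      "everywhere_soluble m n b1 b2"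
    unfolding Sel2_def by blast
  then have "selmer_shape b1 b2"
    by (intro everywhere_soluble_imp_shape[OF b(1,2) m _ _ b(6)] QS2_squarefree_dvd)
  then show "P \<in> {sq_pair (of_int b1) (of_int b2) | b1 b2. selmer_shape b1 b2}"
    using b(5) by (auto simp: sq_pair_def)
next
  fix P assume "P \<in> {sq_pair (of_int b1) (of_int b2) | b1 b2. selmer_shape b1 b2}"
  then obtain b1 b2 where P: "P = sq_pair (of_int b1) (of_int b2)" and shape: "selmer_shape b1 b2" by blast
  obtain e b c where e: "e \<in> {-1, 1}" and b: "b dvd n" and c: "c \<in> {1, 2, q, 2 * q}"
    and b1: "b1 = e * int b" and b2: "b2 = e * int b * int c"
    using shape unfolding selmer_shape_def by blast
  have pos: "b > 0" "c > 0" using dvd_pos_nat[OF n_pos b] c q_gt_2 by auto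
  have "sq_class (of_int e) \<in> QS2 n q" using e QS2_gens by auto
  then have q1: "sq_class (of_int b1) \<in> QS2 n q"
    using QS2_mult[OF _ QS2_divisor[OF b], of "of_int e"] e pos by (auto simp: b1)
  have "sq_class (of_nat c) \<in> QS2 n q"
    using c QS2_gens QS2_mult[OF QS2_gens(3,4)] q_gt_2 by auto
  then have q2: "sq_class (of_int b2) \<in> QS2 n q"
    using QS2_mult[OF q1, of "of_nat c"] e pos by (auto simp: b1 b2)
  show "P \<in> Sel2 m n q"
  proof -
    have "squarefree b1" "squarefree b2" using squarefree_shape[OF b c e] by (simp_all only: b1 b2)
    then have "\<exists>b1' b2'. squarefree b1' \<and> squarefree b2' \<and>
        sq_class (of_int b1) = sq_class (of_int b1') \<and> sq_class (of_int b2) = sq_class (of_int b2') \<and>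
        everywhere_soluble m n b1' b2'"
      using shape_imp_everywhere_soluble[OF shape m] by blast
    then show ?thesis
      unfolding Sel2_def P sq_pair_def
      by (simp only: mem_Collect_eq prod.case mem_Times_iff fst_conv snd_conv q1 q2 simp_thms)
  qed
qed

lemma E2_star_eq:
  assumes m: "even m"
  shows "E2_star m n q = twists {-1, 1} {1, 2 * q}"
proof -
  have n0: "(of_nat n :: rat) \<noteq> 0" using n_pos by simp
  have q0: "(of_nat q :: rat) \<noteq> 0" using q_gt_2 by simp
  define w :: rat where "w = 2 ^ (m div 2)"
  have w: "w\<^sup>2 = 2 ^ m" "w \<noteq> 0"
    unfolding w_def using m by (simp_all flip: power_mult)
  have nq: "(of_nat n)\<^sup>2 + 1 = (2 * of_nat q :: rat)"
    using n_q by (metis of_nat_1 of_nat_add of_nat_mult of_nat_numeral of_nat_power)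
  have tors: "E_2torsion m n = {Infinity, Affine 0 0, Affine (w\<^sup>2 * (of_nat n)\<^sup>2) 0, Affine (- w\<^sup>2) 0}"
  proof -
    have "E_add m n (Affine x y) (Affine x y) = Infinity \<longleftrightarrow> y = 0" for x y
      by (simp add: E_add_def weierstrass_add_def Let_def)
    moreover have "E_add m n Infinity Infinity = Infinity" by (simp add: E_add_def weierstrass_add_def)
    moreover have "x + w\<^sup>2 = 0 \<longleftrightarrow> x = - w\<^sup>2" for x by (simp add: eq_neg_iff_add_eq_0)
    ultimately show ?thesis
      unfolding E_2torsion_def E_points_def w(1)[symmetric] by auto
  qed
  have "descent_map m n q Infinity = sq_pair 1 1" by (simp add: descent_map_def)
  moreover have "descent_map m n q (Affine 0 0) = sq_pair (-1) (-1)"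
    using sq_pair_power2_mult[of "-1" "-1" 1 w] w by (simp add: descent_map_def)
  moreover have "descent_map m n q (Affine (w\<^sup>2 * (of_nat n)\<^sup>2) 0) = sq_pair 1 (2 * of_nat q)"
    using sq_pair_power2_mult[of 1 "2 * of_nat q" w 1] w n0 q0 by (simp add: descent_map_def)
  moreover have "descent_map m n q (Affine (- w\<^sup>2) 0) = sq_pair (-1) (- (2 * of_nat q))"
  proof -
    have "- w\<^sup>2 \<noteq> w\<^sup>2 * (of_nat n)\<^sup>2"
    proof
      assume "- w\<^sup>2 = w\<^sup>2 * (of_nat n)\<^sup>2"
      then have "w\<^sup>2 * ((of_nat n)\<^sup>2 + 1) = 0" by (simp add: algebra_simps)
      then show False using w q0 unfolding nq by simp
    qed
    moreover have "- w\<^sup>2 \<noteq> 0" using w(2) by simp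
    ultimately have "descent_map m n q (Affine (- w\<^sup>2) 0) = sq_pair (- w\<^sup>2) (- w\<^sup>2 - w\<^sup>2 * (of_nat n)\<^sup>2)"
      unfolding descent_map_def w(1)[symmetric] by (simp only: point.case if_False)
    also have "- w\<^sup>2 - w\<^sup>2 * (of_nat n)\<^sup>2 = w\<^sup>2 * (- ((of_nat n)\<^sup>2 + 1))" by (simp add: algebra_simps)
    also have "\<dots> = w\<^sup>2 * (- (2 * of_nat q))" unfolding nq ..
    also have "sq_pair (- w\<^sup>2) (w\<^sup>2 * (- (2 * of_nat q))) = sq_pair (-1) (- (2 * of_nat q))"
      using sq_pair_power2_mult[of "-1" "- (2 * of_nat q)" w w] w q0 by simp
    finally show ?thesis .
  qed
  ultimately have "E2_star m n q = {sq_pair 1 1, sq_pair (-1) (-1), sq_pair 1 (2 * of_nat q), sq_pair (-1) (- (2 * of_nat q))}"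
    unfolding E2_star_def tors by simp
  also have "\<dots> = (\<Union>x\<in>{-1, 1}. twist x ` {1, 2 * q})"
    by (auto simp: twist_def)
  also have "\<dots> = twists {-1, 1} {1, 2 * q}" unfolding twists_def by blast
  finally show ?thesis .
qed

lemma E2_star_subgroup:
  assumes m: "even m"
  shows "subgroup (E2_star m n q) sq_pairs"
  unfolding E2_star_eq[OF m]
proof (rule twists_subgroup)
  show "\<exists>z. \<exists>y\<in>{-1, 1}. x * x' = z\<^sup>2 * y" if "x \<in> {-1, 1}" "x' \<in> {-1, 1}" for x x' :: rat
    using that by (intro exI[of _ 1]) auto
  show "\<exists>w. \<exists>d\<in>{1, 2 * q}. c * c' = w\<^sup>2 * d" if "c \<in> {1, 2 * q}" "c' \<in> {1, 2 * q}" for c c'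
    using that by (auto simp: power2_eq_square intro: exI[of _ "1::nat"] exI[of _ "2 * q"])
qed (use q_gt_2 in auto)

text \<open>For \<open>C = {1}\<close> these are the diagonal generators, which already form a group. For \<open>C = {1, 2}\<close> they
  form the group generated by the diagonal generators and \<open>(1, 2)\<close>.\<close>

definition diag_twists :: "nat set \<Rightarrow> (rat set \<times> rat set) set" where
  "diag_twists C = twists (of_nat ` divs_pm1) C"

lemma diag_twists_subgroup:
  assumes C: "C = {1} \<or> C = {1, 2}"
  shows "subgroup (diag_twists C) sq_pairs"
  unfolding diag_twists_def
proof (rule twists_subgroup)
  show "\<exists>z. \<exists>y\<in>of_nat ` divs_pm1. x * x' = z\<^sup>2 * y"
    if x: "x \<in> of_nat ` divs_pm1" "x' \<in> of_nat ` divs_pm1" for x x' :: rat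
  proof -
    obtain b b' where b: "b \<in> divs_pm1" "b' \<in> divs_pm1" and xb: "x = of_nat b" "x' = of_nat b'" using x by blast
    obtain g b'' where g: "b'' \<in> divs_pm1" "b * b' = g\<^sup>2 * b''" using divs_pm1_mult[OF b] by blast
    have "x * x' = (of_nat g)\<^sup>2 * of_nat b''" unfolding xb using g(2) by (metis of_nat_mult of_nat_power)
    then show ?thesis using g(1) by blast
  qed
  show "\<exists>w. \<exists>d\<in>C. c * c' = w\<^sup>2 * d" if "c \<in> C" "c' \<in> C" for c c'
    using that C by (auto simp: power2_eq_square intro: exI[of _ "1::nat"] exI[of _ "2::nat"])
  show "(0 :: rat) \<notin> of_nat ` divs_pm1" using divs_pm1_pos[of 0] by auto
  show "(1 :: rat) \<in> of_nat ` divs_pm1" using one_divs_pm1 by force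
qed (use C in auto)

lemma diagonal_gens_eq: "diagonal_gens n = diag_twists {1}"
  by (auto simp: diagonal_gens_def diag_twists_def twists_def twist_def divs_pm1_def pm1_mod_8_def)

lemma generate_diagonal_gens: "generate sq_pairs (diagonal_gens n) = diag_twists {1}"
proof -
  interpret comm_group sq_pairs by (rule sq_pairs_comm_group)
  have "generate sq_pairs (diag_twists {1}) \<subseteq> diag_twists {1}"
    by (intro generate_subgroup_incl diag_twists_subgroup) auto
  then show ?thesis unfolding diagonal_gens_eq by (intro equalityI subsetI generate.incl) auto
qed

lemma generate_diagonal_gens_2: "generate sq_pairs (diagonal_gens n \<union> {sq_pair 1 2}) = diag_twists {1, 2}"
proof -
  interpret comm_group sq_pairs by (rule sq_pairs_comm_group)
  have tw: "twist (of_nat b) c \<in> diag_twists C" if "b \<in> divs_pm1" "c \<in> C" for b c C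
    using that unfolding diag_twists_def twists_def by blast
  have two: "sq_pair 1 2 = twist 1 2" by (simp add: twist_def)
  have "twist 1 2 \<in> diag_twists {1, 2}" using tw[OF one_divs_pm1, of 2 "{1, 2}"] by simp
  moreover have "diag_twists {1} \<subseteq> diag_twists {1, 2}" unfolding diag_twists_def twists_def by blast
  ultimately have "generate sq_pairs (diagonal_gens n \<union> {sq_pair 1 2}) \<subseteq> diag_twists {1, 2}"
    unfolding diagonal_gens_eq two by (intro generate_subgroup_incl diag_twists_subgroup) auto
  moreover have "P \<in> generate sq_pairs (diagonal_gens n \<union> {sq_pair 1 2})" if P: "P \<in> diag_twists {1, 2}" for P
  proof -
    obtain b c where b: "b \<in> divs_pm1" "c \<in> {1, 2}" "P = twist (of_nat b) c"
      using P unfolding diag_twists_def twists_def by blast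
    have d: "twist (of_nat b) 1 \<in> diagonal_gens n" unfolding diagonal_gens_eq using tw[OF b(1)] by simp
    show ?thesis
    proof (cases "c = 1")
      case True
      then show ?thesis using b(3) d by (auto intro: generate.incl)
    next
      case False
      have "P = twist (of_nat b) 1 \<otimes>\<^bsub>sq_pairs\<^esub> twist 1 2"
        unfolding b(3) by (rule twist_mult[symmetric, where z = 1 and w = 1]) (use False b(2) divs_pm1_pos[OF b(1)] in auto)
      also have "\<dots> \<in> generate sq_pairs (diagonal_gens n \<union> {sq_pair 1 2})"
        unfolding two by (rule generate.eng; rule generate.incl) (use d in auto)
      finally show ?thesis .
    qed
  qed
  ultimately show ?thesis by blast
qed

definition diag_factors :: "nat set" where
  "diag_factors = (if \<forall>p\<in>prime_factors n. pm1_mod_8 p then {1, 2} else {1})"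

definition selmer_factors :: "nat set" where
  "selmer_factors = (if \<forall>p\<in>prime_factors n. pm1_mod_8 p then {1, 2, q, 2 * q} else {1, 2 * q})"

lemma selmer_factors_subset: "selmer_factors \<subseteq> {1, 2, q, 2 * q}"
  by (auto simp: selmer_factors_def)

lemma selmer_shape_iff:
  "selmer_shape b1 b2 \<longleftrightarrow> (\<exists>e b c. e \<in> {-1, 1} \<and> b \<in> divs_pm1 \<and> c \<in> selmer_factors \<and>
     b1 = e * int b \<and> b2 = e * int b * int c)"
proof -
  have "(\<forall>p. prime p \<longrightarrow> p dvd n \<longrightarrow> pm1_mod_8 p) \<longleftrightarrow> (\<forall>p\<in>prime_factors n. pm1_mod_8 p)"
    using n_pos by (auto simp: prime_factors_dvd)
  then have "c \<in> selmer_factors \<longleftrightarrow> c \<in> {1, 2, q, 2 * q} \<and>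
      (c \<in> {2, q} \<longrightarrow> (\<forall>p. prime p \<longrightarrow> p dvd n \<longrightarrow> pm1_mod_8 p))" for c
    using q_gt_2 by (auto simp: selmer_factors_def)
  then show ?thesis unfolding selmer_shape_def divs_pm1_def by (simp only: mem_Collect_eq conj_assoc)
qed

lemma Sel2_eq_twists:
  assumes m: "even m"
  shows "Sel2 m n q = {twist (of_int e * of_nat b) c | e b c. e \<in> {-1, 1} \<and> b \<in> divs_pm1 \<and> c \<in> selmer_factors}"
proof -
  have eq: "sq_pair (of_int (e * int b)) (of_int (e * int b * int c)) = twist (of_int e * of_nat b) c" for e b c
    by (simp add: twist_def)
  show ?thesis unfolding Sel2_eq[OF m] selmer_shape_iff eq[symmetric] by blast
qed

lemma twist_inject:
  assumes eq: "twist (of_int e * of_nat b) c = twist (of_int e' * of_nat b') c'"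
    and e: "e \<in> {-1, 1}" "e' \<in> {-1, 1}" and b: "b dvd n" "b' dvd n"
    and c: "c \<in> {1, 2, q, 2 * q}" "c' \<in> {1, 2, q, 2 * q}"
  shows "e = e' \<and> b = b' \<and> c = c'"
proof -
  have eqs: "sq_class (of_int (e * int b)) = sq_class (of_int (e' * int b'))"
    "sq_class (of_int (e * int b * int c)) = sq_class (of_int (e' * int b' * int c'))"
    using eq by (simp_all add: twist_def sq_pair_def)
  have 1: "e * int b = e' * int b'"
    by (rule squarefree_sq_class_inject[OF eqs(1) squarefree_shape(1)[OF b(1) c(1) e(1)] squarefree_shape(1)[OF b(2) c(2) e(2)]])
  have 2: "e * int b * int c = e' * int b' * int c'"
    by (rule squarefree_sq_class_inject[OF eqs(2) squarefree_shape(2)[OF b(1) c(1) e(1)] squarefree_shape(2)[OF b(2) c(2) e(2)]])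
  have pos: "b > 0" "b' > 0" using b dvd_pos_nat[OF n_pos] by auto
  then have eb: "e = e' \<and> b = b'" using 1 e by auto
  then have "c = c'" using 2 e pos by auto
  then show ?thesis using eb by blast
qed

lemma diag_twists_Int_E2_star:
  assumes m: "even m" and C: "C \<subseteq> {1, 2}"
  shows "diag_twists C \<inter> E2_star m n q \<subseteq> {\<one>\<^bsub>sq_pairs\<^esub>}"
proof
  fix P assume "P \<in> diag_twists C \<inter> E2_star m n q"
  then obtain b c x c' where b: "b \<in> divs_pm1" "c \<in> {1, 2}" "P = twist (of_nat b) c"
    and x: "x \<in> {-1, 1}" "c' \<in> {1, 2 * q}" "P = twist x c'"
    using C unfolding diag_twists_def twists_def E2_star_eq[OF m] by blast
  obtain e where e: "e \<in> {-1, 1}" "x = of_int e" using x(1) by (metis insert_iff of_int_1 of_int_minus singletonD)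
  have "twist (of_int 1 * of_nat b) c = twist (of_int e * of_nat 1) c'" using b(3) x(3) e(2) by simp
  then have "1 = e \<and> b = 1 \<and> c = c'"
    by (rule twist_inject) (use b(1,2) x(2) e(1) in \<open>auto simp: divs_pm1_def\<close>)
  moreover from this have "c = 1" using b(2) x(2) q_gt_2 by auto
  ultimately have "b = 1" "c = 1" by blast+
  then show "P \<in> {\<one>\<^bsub>sq_pairs\<^esub>}" using b(3) by (simp add: twist_def sq_pairs_one)
qed

text \<open>The square factor \<open>w\<^sup>2\<close> of \<open>c1 * c2\<close> is 4 when \<open>c1 = 2\<close> and \<open>c2 = 2 * q\<close>; this is how the value \<open>q\<close> arises.\<close>

lemma Sel2_eq_set_mult:
  assumes m: "even m"
  shows "Sel2 m n q = diag_twists diag_factors <#>\<^bsub>sq_pairs\<^esub> E2_star m n q"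
proof -
  have prod: "twist (of_nat b) c1 \<otimes>\<^bsub>sq_pairs\<^esub> twist (of_int e) c2 = twist (of_int e * of_nat b) c"
    if "b \<in> divs_pm1" "e \<in> {-1, 1}" "c1 \<in> diag_factors" "c2 \<in> {1, 2 * q}" "c1 * c2 = w\<^sup>2 * c" for b c1 e c2 c w
  proof (rule twist_mult[OF _ _ _ _ _ that(5), where z = 1])
    show "(of_nat b :: rat) \<noteq> 0" using divs_pm1_pos[OF that(1)] by simp
    show "(of_int e :: rat) \<noteq> 0" using that(2) by auto
    show "c1 \<noteq> 0" using that(3) by (auto simp: diag_factors_def split: if_splits)
    show "c2 \<noteq> 0" using that(4) q_gt_2 by auto
  qed simp
  have signs: "{-1, 1 :: rat} = of_int ` {-1, 1}" by simp
  have E2: "E2_star m n q = {twist (of_int e) c | e c. e \<in> {-1, 1} \<and> c \<in> {1, 2 * q}}"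
    unfolding E2_star_eq[OF m] twists_def signs by blast
  have split: "\<exists>c1\<in>diag_factors. \<exists>c2\<in>{1, 2 * q}. \<exists>w. c1 * c2 = w\<^sup>2 * c" if "c \<in> selmer_factors" for c
    using that unfolding diag_factors_def selmer_factors_def
    by (auto split: if_splits simp: power2_eq_square intro: exI[of _ "1::nat"] exI[of _ "2::nat"])
  have join: "\<exists>c\<in>selmer_factors. \<exists>w. c1 * c2 = w\<^sup>2 * c" if "c1 \<in> diag_factors" "c2 \<in> {1, 2 * q}" for c1 c2
    using that unfolding diag_factors_def selmer_factors_def
    by (auto split: if_splits simp: power2_eq_square intro: exI[of _ "1::nat"] exI[of _ "2::nat"])
  show ?thesis
  proof (intro equalityI subsetI)
    fix P assume "P \<in> Sel2 m n q"
    then obtain e b c where e: "e \<in> {-1, 1}" "b \<in> divs_pm1" "c \<in> selmer_factors" "P = twist (of_int e * of_nat b) c"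
      unfolding Sel2_eq_twists[OF m] by blast
    then obtain c1 c2 w where c: "c1 \<in> diag_factors" "c2 \<in> {1, 2 * q}" "c1 * c2 = w\<^sup>2 * c" using split by blast
    have "P = twist (of_nat b) c1 \<otimes>\<^bsub>sq_pairs\<^esub> twist (of_int e) c2" using prod[OF e(2,1) c] e(4) by simp
    then show "P \<in> diag_twists diag_factors <#>\<^bsub>sq_pairs\<^esub> E2_star m n q"
      unfolding set_mult_def diag_twists_def twists_def E2 using e c by blast
  next
    fix P assume "P \<in> diag_twists diag_factors <#>\<^bsub>sq_pairs\<^esub> E2_star m n q"
    then obtain b c1 e c2 where b: "b \<in> divs_pm1" "c1 \<in> diag_factors" and e: "e \<in> {-1, 1}" "c2 \<in> {1, 2 * q}"
      and P: "P = twist (of_nat b) c1 \<otimes>\<^bsub>sq_pairs\<^esub> twist (of_int e) c2"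
      unfolding set_mult_def diag_twists_def twists_def E2 by blast
    obtain c w where c: "c \<in> selmer_factors" "c1 * c2 = w\<^sup>2 * c" using join[OF b(2) e(2)] by blast
    then show "P \<in> Sel2 m n q"
      unfolding Sel2_eq_twists[OF m] P prod[OF b(1) e(1) b(2) e(2) c(2)] using b(1) e(1) by blast
  qed
qed

lemma card_Sel2:
  assumes m: "even m"
  shows "card (Sel2 m n q) = 2 ^ (if \<forall>p\<in>prime_factors n. pm1_mod_8 p then card (prime_factors n) + 3
     else card (prime_factors n) + 1)"
proof -
  let ?all = "\<forall>p\<in>prime_factors n. pm1_mod_8 p"
  define f where "f = (\<lambda>(e::int, b::nat, c). twist (of_int e * of_nat b) c)"
  have "Sel2 m n q = f ` ({-1, 1} \<times> divs_pm1 \<times> selmer_factors)"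
    unfolding Sel2_eq_twists[OF m] f_def by (force simp: image_iff)
  moreover have "inj_on f ({-1, 1} \<times> divs_pm1 \<times> selmer_factors)"
  proof (rule inj_onI)
    fix u v assume "u \<in> {-1, 1} \<times> divs_pm1 \<times> selmer_factors" "v \<in> {-1, 1} \<times> divs_pm1 \<times> selmer_factors" and "f u = f v"
    moreover obtain e b c e' b' c' where uv: "u = (e, b, c)" "v = (e', b', c')" by (metis prod_cases3)
    ultimately show "u = v"
      using twist_inject[of e b c e' b' c'] selmer_factors_subset by (auto simp: f_def divs_pm1_def)
  qed
  ultimately have "card (Sel2 m n q) = card ({-1, 1 :: int} \<times> divs_pm1 \<times> selmer_factors)" by (simp add: card_image)
  also have "\<dots> = 2 * (card divs_pm1 * card selmer_factors)" by (simp add: card_cartesian_product)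
  also have "card selmer_factors = (if ?all then 4 else 2)" using q_gt_2 by (auto simp: selmer_factors_def)
  also have "card divs_pm1 = (if ?all then 2 ^ card (prime_factors n) else 2 ^ (card (prime_factors n) - 1))"
    using card_divisors_pm1_mod_8[OF n_squarefree n_odd, of True] by (simp add: divs_pm1_def)
  finally have card: "card (Sel2 m n q) = 2 * ((if ?all then 2 ^ card (prime_factors n) else 2 ^ (card (prime_factors n) - 1)) * (if ?all then 4 else 2))" .
  show ?thesis
  proof (cases ?all)
    case True
    then show ?thesis unfolding card by (simp add: power_add)
  next
    case False
    then have "card (prime_factors n) > 0" by (auto simp: card_gt_0_iff)
    then show ?thesis unfolding card using False by (cases "card (prime_factors n)") auto
  qed
qed

lemma Sel2_internal_direct_product:
  assumes m: "even m"
  shows "internal_direct_product sq_pairs (Sel2 m n q) (diag_twists diag_factors) (E2_star m n q)"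
  unfolding Sel2_eq_set_mult[OF m]
  by (intro internal_direct_productI sq_pairs_comm_group diag_twists_subgroup E2_star_subgroup m
        diag_twists_Int_E2_star) (auto simp: diag_factors_def)

lemma selmer_rank_eq:
  assumes m: "even m"
  shows "selmer_rank m n q = (if \<forall>p\<in>prime_factors n. pm1_mod_8 p then int (card (prime_factors n)) + 1
     else int (card (prime_factors n)) - 1)"
proof -
  have H: "subgroup (Sel2 m n q) sq_pairs"
    using Sel2_internal_direct_product[OF m] by (simp add: internal_direct_product_def)
  have "vectorspace.dim (residue_ring 2) (F2_space sq_pairs (Sel2 m n q))
      = (if \<forall>p\<in>prime_factors n. pm1_mod_8 p then card (prime_factors n) + 3 else card (prime_factors n) + 1)"
    by (rule F2_space_dim[OF sq_pairs_comm_group H sq_pairs_exponent_2 card_Sel2[OF m]])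
       (use subgroup.subset[OF H] in auto)
  then show ?thesis unfolding selmer_rank_def by simp
qed

end

theorem theorem3p2:
  fixes m n q n1 n2 r s t :: nat
  assumes "n > 0" and "squarefree n" and "odd n"
    and "prime q" and "n\<^sup>2 + 1 = 2 * q"
    and "n1 = \<Prod>{p \<in> prime_factors n. p mod 8 = 1 \<or> p mod 8 = 7}"
    and "n2 = \<Prod>{p \<in> prime_factors n. p mod 8 = 3 \<or> p mod 8 = 5}"
    and "r = card {p \<in> prime_factors n1. p mod 8 = 1}"
    and "s = card {p \<in> prime_factors n1. p mod 8 = 7}"
    and "t = card (prime_factors n2)"
    and "even m"
  shows "(n2 = 1 \<longrightarrow>
            internal_direct_product sq_pairs (Sel2 m n q)
              (generate sq_pairs (diagonal_gens n \<union> {sq_pair 1 2})) (E2_star m n q)) \<and>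
         (n2 > 1 \<longrightarrow>
            internal_direct_product sq_pairs (Sel2 m n q)
              (generate sq_pairs (diagonal_gens n)) (E2_star m n q)) \<and>
         (n2 = 1 \<longrightarrow> selmer_rank m n q = int r + int s + 1) \<and>
         (n2 > 1 \<longrightarrow> selmer_rank m n q = int r + int s + int t - 1)"
proof -
  interpret half_square_prime n q by unfold_locales (use assms in auto)
  let ?all = "\<forall>p\<in>prime_factors n. pm1_mod_8 p"
  define S1 S3 where "S1 = {p \<in> prime_factors n. p mod 8 = 1 \<or> p mod 8 = 7}"
    and "S3 = {p \<in> prime_factors n. p mod 8 = 3 \<or> p mod 8 = 5}"
  have pf1: "prime_factors n1 = S1" and pf2: "prime_factors n2 = S3"
    unfolding assms(6,7) S1_def S3_def by (rule prime_factors_Prod_primes; auto)+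
  have odd_p: "p mod 8 = 1 \<or> p mod 8 = 3 \<or> p mod 8 = 5 \<or> p mod 8 = 7" if "p \<in> prime_factors n" for p
  proof -
    have "odd p" using that n_odd dvd_trans by blast
    then show ?thesis by presburger
  qed
  have all_iff: "?all \<longleftrightarrow> S3 = {}" using odd_p by (auto simp: S3_def pm1_mod_8_def)
  have fin: "finite S1" "finite S3" by (auto simp: S1_def S3_def)
  have "S1 \<union> S3 = prime_factors n" "S1 \<inter> S3 = {}" using odd_p by (auto simp: S1_def S3_def)
  then have "card (prime_factors n) = card S1 + card S3" using card_Un_disjoint[OF fin] by simp
  moreover have "S1 = {p \<in> S1. p mod 8 = 1} \<union> {p \<in> S1. p mod 8 = 7}" by (auto simp: S1_def)
  then have "card S1 = r + s"
    using card_Un_disjoint[of "{p \<in> S1. p mod 8 = 1}" "{p \<in> S1. p mod 8 = 7}"] fin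
    unfolding assms(8,9) pf1 by (simp add: disjoint_iff)
  ultimately have card: "card (prime_factors n) = r + s + t" using assms(10) pf2 by simp
  have "n2 > 0" unfolding assms(7) by (intro prod_pos) (auto intro: prime_gt_0_nat)
  then have n2: "n2 = 1 \<longleftrightarrow> ?all" unfolding all_iff pf2[symmetric] by (auto simp: prime_factorization_empty_iff)
  have t0: "t = 0" if ?all using that assms(10) pf2 all_iff by simp
  show ?thesis
  proof (cases ?all)
    case True
    then have "n2 = 1" "diag_factors = {1, 2}" "selmer_rank m n q = int r + int s + 1"
      using n2 t0 card selmer_rank_eq[OF \<open>even m\<close>] by (auto simp: diag_factors_def)
    then show ?thesis
      using Sel2_internal_direct_product[OF \<open>even m\<close>] by (simp only: generate_diagonal_gens_2) simp
  next
    case False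
    then have "n2 \<noteq> 1" "diag_factors = {1}" "selmer_rank m n q = int r + int s + int t - 1"
      using n2 card selmer_rank_eq[OF \<open>even m\<close>] by (auto simp: diag_factors_def)
    then show ?thesis
      using Sel2_internal_direct_product[OF \<open>even m\<close>] by (simp only: generate_diagonal_gens) simp
  qed
qed

end
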